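(* Let $\Delta$ be a pattern on $I$ and $1 \leq n < \omega$. (1) If $T$ is a complete countable theory, then $T$ admits $\Delta$ if and only if $T$ admits $\Delta^n$. (2) If $V \models ZFC^-$ is transitive with $\Delta, I \in V$ and $\mathbf{j}: V \preceq \hat{V}$ with $\hat{V}$ $\omega$-nonstandard, then $\lambda_{\hat{V}}(\Delta) = \lambda_{\hat{V}}(\Delta^n)$. (3) If $\mathcal{U}$ is an ultrafilter on a complete Boolean algebra $\mathcal{B}$, then $\lambda_{\mathcal{U}}(\Delta) = \lambda_{\mathcal{U}}(\Delta^n)$.
   Context: A pattern on $I$ is a subset-closed $\Delta\subseteq[I]^{<\aleph_0}$. $\Delta^n$ is the pattern on $[I]^{\le n}$ consisting of all finite $s\subseteq[I]^{\le n}$ with $\bigcup s\in\Delta$. A formula $\varphi(\bar x,\bar y)$ of $T$ admits $\Delta$ if there are $(\bar a_i:i\in I)$ in the monster model of $T$ such that for every finite $s\subseteq I$, $\exists\bar x\bigwedge_{i\in s}\varphi(\bar x,\bar a_i)$ holds iff $s\in\Delta$; $T$ admits $\Delta$ if some formula of $T$ does. $ZFC^-$ is ZFC without power set, with collection and the well-ordering principle; $\hat V$ may be ill-founded, $\omega$-nonstandard meaning some element of $\hat\omega$ has infinitely many predecessors; elements of $\hat V$ are identified with their $\hat\in$-extensions; $X\subseteq\hat V$ is pseudofinite if contained in some $\hat X\in\hat V$ believed finite by $\hat V$. $\lambda_{\hat V}(\Delta)$ is the least $\lambda$ such that some pseudofinite $X\subseteq\mathbf j(I)$ with $|X|\le\lambda$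 has all finite subsets in $\mathbf j(\Delta)$ but lies in no $\hat X\in\mathbf j(\Delta)$ ($\infty$ if none). For a complete Boolean algebra $\mathcal B$ with positive part $\mathcal B_+$, an $I$-distribution is $\mathbf A:[I]^{<\aleph_0}\to\mathcal B_+$ with $\mathbf A(\emptyset)=1$ and $s\subseteq t\Rightarrow\mathbf A(s)\ge\mathbf A(t)$; it is in a filter $\mathcal U$ if its image is in $\mathcal U$; $\mathbf B$ refines $\mathbf A$ if $\mathbf B(s)\le\mathbf A(s)$ for all $s$; $\mathbf A$ is multiplicative if $\mathbf A(s)=\bigwedge_{i\in s}\mathbf A(\{i\})$. A $J$-distribution $\mathbf A$ is a $(J,\Delta)$-distribution if for every finite $s\subseteq J$ and every $\mathbf c\in\mathcal B_+$ deciding $\mathbf A(t)$ for all $t\subseteq s$ (i.e. $\mathbf c\le\mathbf A(t)$ or $\mathbf c\wedge\mathbf A(t)=0$), there is $f:s\to I$ with: for all $t\subseteq s$, $\mathbf c\le\mathbf A(t)$ iff $f[t]\in\Delta$. $\lambda_{\mathcal U}(\Delta)$ is the least cardinal $\lambda$ such that some $(\lambda,\Delta)$-distribution in $\mathcal U$ has no multiplicative refinement in $\mathcal U$.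
   Formalization: In (1) the models of T are assumed to have at least two elements; for T the theory of a one-element structure, I nonempty and Δ = {∅}, T admits Δ but not Δ^n, since [I]^{≤n} contains the empty set. *)

theory Defs
  imports Main "HOL-Library.Countable_Set"
begin

unbundle cardinal_syntax

section \<open>Patterns\<close>

definition pattern :: "'i set \<Rightarrow> 'i set set \<Rightarrow> bool" where
  "pattern I \<Delta> \<longleftrightarrow>
     (\<forall>s\<in>\<Delta>. finite s \<and> s \<subseteq> I) \<and> (\<forall>s\<in>\<Delta>. \<forall>t. t \<subseteq> s \<longrightarrow> t \<in> \<Delta>)"

text \<open>The index set \<open>[I]\<^bsup>\<le>n\<^esup>\<close>; the empty set is one of its members.\<close>

definition subsets_upto :: "nat \<Rightarrow> 'i set \<Rightarrow> 'i set set" where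
  "subsets_upto n I = {u. u \<subseteq> I \<and> finite u \<and> card u \<le> n}"

definition pattern_power :: "nat \<Rightarrow> 'i set \<Rightarrow> 'i set set \<Rightarrow> 'i set set set" where
  "pattern_power n I \<Delta> = {s. finite s \<and> s \<subseteq> subsets_upto n I \<and> \<Union>s \<in> \<Delta>}"

section \<open>Least cardinals\<close>

text \<open>
  A cardinal is represented by the class of all sets of that cardinality over a type \<open>'k\<close>,
  and \<open>\<infinity>\<close> by the empty class.  For a property \<open>P\<close> of sets that is invariant
  under equipollence, \<open>least_card P\<close> is the least cardinal with property \<open>P\<close>.
  The only cardinals seen are those of sets over \<open>'k\<close>, so an equation between two
  such values expresses equality of the cardinals when it is asserted for every type \<open>'k\<close>.
\<close>

definition least_card :: "('k set \<Rightarrow> bool) \<Rightarrow> 'k set set" where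
  "least_card P = {K. P K \<and> (\<forall>K'. P K' \<longrightarrow> |K| \<le>o |K'| )}"

section \<open>First-order logic\<close>

record ('f, 'r) language =
  fun_syms :: "('f \<times> nat) set"
  rel_syms :: "('r \<times> nat) set"

datatype 'f tm = Var nat | Fn 'f "'f tm list"

datatype ('f, 'r) fm =
    Equal "'f tm" "'f tm"
  | Rel 'r "'f tm list"
  | Neg "('f, 'r) fm"
  | Conj "('f, 'r) fm" "('f, 'r) fm"
  | Exi nat "('f, 'r) fm"

fun fv_tm :: "'f tm \<Rightarrow> nat set" where
  "fv_tm (Var k) = {k}"
| "fv_tm (Fn f ts) = (\<Union>t\<in>set ts. fv_tm t)"

fun fv :: "('f, 'r) fm \<Rightarrow> nat set" where
  "fv (Equal t u) = fv_tm t \<union> fv_tm u"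
| "fv (Rel r ts) = (\<Union>t\<in>set ts. fv_tm t)"
| "fv (Neg \<phi>) = fv \<phi>"
| "fv (Conj \<phi> \<psi>) = fv \<phi> \<union> fv \<psi>"
| "fv (Exi k \<phi>) = fv \<phi> - {k}"

fun wf_tm :: "('f, 'r) language \<Rightarrow> 'f tm \<Rightarrow> bool" where
  "wf_tm L (Var k) = True"
| "wf_tm L (Fn f ts) = ((f, length ts) \<in> fun_syms L \<and> (\<forall>t\<in>set ts. wf_tm L t))"

fun wf_fm :: "('f, 'r) language \<Rightarrow> ('f, 'r) fm \<Rightarrow> bool" where
  "wf_fm L (Equal t u) = (wf_tm L t \<and> wf_tm L u)"
| "wf_fm L (Rel r ts) = ((r, length ts) \<in> rel_syms L \<and> (\<forall>t\<in>set ts. wf_tm L t))"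
| "wf_fm L (Neg \<phi>) = wf_fm L \<phi>"
| "wf_fm L (Conj \<phi> \<psi>) = (wf_fm L \<phi> \<and> wf_fm L \<psi>)"
| "wf_fm L (Exi k \<phi>) = wf_fm L \<phi>"

definition formulas :: "('f, 'r) language \<Rightarrow> ('f, 'r) fm set" where
  "formulas L = {\<phi>. wf_fm L \<phi>}"

definition sentences :: "('f, 'r) language \<Rightarrow> ('f, 'r) fm set" where
  "sentences L = {\<phi>. wf_fm L \<phi> \<and> fv \<phi> = {}}"

record ('m, 'f, 'r) struct =
  carrier :: "'m set"
  fun_interp :: "'f \<Rightarrow> 'm list \<Rightarrow> 'm"
  rel_interp :: "'r \<Rightarrow> 'm list \<Rightarrow> bool"

definition is_struct :: "('f, 'r) language \<Rightarrow> ('m, 'f, 'r) struct \<Rightarrow> bool" where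
  "is_struct L M \<longleftrightarrow> carrier M \<noteq> {} \<and>
     (\<forall>f k. (f, k) \<in> fun_syms L \<longrightarrow>
        (\<forall>xs. set xs \<subseteq> carrier M \<and> length xs = k \<longrightarrow> fun_interp M f xs \<in> carrier M))"

fun val :: "('m, 'f, 'r) struct \<Rightarrow> (nat \<Rightarrow> 'm) \<Rightarrow> 'f tm \<Rightarrow> 'm" where
  "val M e (Var k) = e k"
| "val M e (Fn f ts) = fun_interp M f (map (val M e) ts)"

fun sat :: "('m, 'f, 'r) struct \<Rightarrow> (nat \<Rightarrow> 'm) \<Rightarrow> ('f, 'r) fm \<Rightarrow> bool" where
  "sat M e (Equal t u) = (val M e t = val M e u)"
| "sat M e (Rel r ts) = rel_interp M r (map (val M e) ts)"
| "sat M e (Neg \<phi>) = (\<not> sat M e \<phi>)"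
| "sat M e (Conj \<phi> \<psi>) = (sat M e \<phi> \<and> sat M e \<psi>)"
| "sat M e (Exi k \<phi>) = (\<exists>a\<in>carrier M. sat M (e(k := a)) \<phi>)"

definition is_model ::
  "('f, 'r) language \<Rightarrow> ('f, 'r) fm set \<Rightarrow> ('m, 'f, 'r) struct \<Rightarrow> bool" where
  "is_model L T M \<longleftrightarrow> is_struct L M \<and> (\<forall>\<sigma>\<in>T. \<forall>e. sat M e \<sigma>)"

definition countable_language :: "('f, 'r) language \<Rightarrow> bool" where
  "countable_language L \<longleftrightarrow> countable (fun_syms L) \<and> countable (rel_syms L)"

text \<open>
  One cannot quantify over models of all types.  Consequence and consistency are therefore
  tested on structures whose universe is a set of natural numbers.  By the downward
  Loewenheim-Skolem theorem this is no restriction for countable languages, the only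
  ones to which these notions are applied.
\<close>

definition entails ::
  "('f, 'r) language \<Rightarrow> ('f, 'r) fm set \<Rightarrow> ('f, 'r) fm \<Rightarrow> bool" where
  "entails L T \<sigma> \<longleftrightarrow> (\<forall>M :: (nat, 'f, 'r) struct. is_model L T M \<longrightarrow> (\<forall>e. sat M e \<sigma>))"

definition complete_theory :: "('f, 'r) language \<Rightarrow> ('f, 'r) fm set \<Rightarrow> bool" where
  "complete_theory L T \<longleftrightarrow> T \<subseteq> sentences L \<and>
     (\<exists>M :: (nat, 'f, 'r) struct. is_model L T M) \<and>
     (\<forall>\<sigma>\<in>sentences L. entails L T \<sigma> \<or> entails L T (Neg \<sigma>))"

text \<open>\<open>h\<close> restricted to \<open>A\<close> is a partial elementary map from \<open>M\<close> to \<open>N\<close>.\<close>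

definition elementary_on ::
  "('f, 'r) language \<Rightarrow> ('m, 'f, 'r) struct \<Rightarrow> ('n, 'f, 'r) struct \<Rightarrow>
     'm set \<Rightarrow> ('m \<Rightarrow> 'n) \<Rightarrow> bool" where
  "elementary_on L M N A h \<longleftrightarrow> A \<subseteq> carrier M \<and> h ` A \<subseteq> carrier N \<and>
     (\<forall>\<phi>\<in>formulas L. \<forall>e. (\<forall>k\<in>fv \<phi>. e k \<in> A) \<longrightarrow> (sat M e \<phi> \<longleftrightarrow> sat N (h \<circ> e) \<phi>))"

definition elementary_embedding ::
  "('f, 'r) language \<Rightarrow> ('m, 'f, 'r) struct \<Rightarrow> ('n, 'f, 'r) struct \<Rightarrow> ('m \<Rightarrow> 'n) \<Rightarrow> bool" where
  "elementary_embedding L M N h \<longleftrightarrow> elementary_on L M N (carrier M) h"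

definition automorphism ::
  "('f, 'r) language \<Rightarrow> ('m, 'f, 'r) struct \<Rightarrow> ('m \<Rightarrow> 'm) \<Rightarrow> bool" where
  "automorphism L M g \<longleftrightarrow> bij_betw g (carrier M) (carrier M) \<and>
     (\<forall>f k xs. (f, k) \<in> fun_syms L \<and> set xs \<subseteq> carrier M \<and> length xs = k \<longrightarrow>
        g (fun_interp M f xs) = fun_interp M f (map g xs)) \<and>
     (\<forall>r k xs. (r, k) \<in> rel_syms L \<and> set xs \<subseteq> carrier M \<and> length xs = k \<longrightarrow>
        (rel_interp M r xs \<longleftrightarrow> rel_interp M r (map g xs)))"

text \<open>
  A pair \<open>(\<phi>, e)\<close> with \<open>e k \<in> A\<close> for every free variable \<open>k \<noteq> 0\<close> of \<open>\<phi>\<close> is a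
  formula in the variable \<open>0\<close> with parameters from \<open>A\<close>; \<open>p\<close> is a set of such formulas.
\<close>

definition saturated :: "'c rel \<Rightarrow> ('f, 'r) language \<Rightarrow> ('m, 'f, 'r) struct \<Rightarrow> bool" where
  "saturated \<kappa> L M \<longleftrightarrow>
     (\<forall>A p. A \<subseteq> carrier M \<and> |A| <o \<kappa> \<and>
        (\<forall>(\<phi>, e)\<in>p. \<phi> \<in> formulas L \<and> (\<forall>k\<in>fv \<phi> - {0}. e k \<in> A)) \<and>
        (\<forall>q. finite q \<and> q \<subseteq> p \<longrightarrow> (\<exists>b\<in>carrier M. \<forall>(\<phi>, e)\<in>q. sat M (e(0 := b)) \<phi>)) \<longrightarrow>
        (\<exists>b\<in>carrier M. \<forall>(\<phi>, e)\<in>p. sat M (e(0 := b)) \<phi>))"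

definition strongly_homogeneous ::
  "'c rel \<Rightarrow> ('f, 'r) language \<Rightarrow> ('m, 'f, 'r) struct \<Rightarrow> bool" where
  "strongly_homogeneous \<kappa> L M \<longleftrightarrow>
     (\<forall>A h. |A| <o \<kappa> \<and> elementary_on L M M A h \<longrightarrow>
        (\<exists>g. automorphism L M g \<and> (\<forall>a\<in>A. g a = h a)))"

definition monster_model ::
  "'c rel \<Rightarrow> ('f, 'r) language \<Rightarrow> ('f, 'r) fm set \<Rightarrow> ('m, 'f, 'r) struct \<Rightarrow> bool" where
  "monster_model \<kappa> L T M \<longleftrightarrow>
     is_model L T M \<and> saturated \<kappa> L M \<and> strongly_homogeneous \<kappa> L M"

text \<open>
  Here \<open>M\<close> is the monster model.  In \<open>\<phi>\<close> the variables below \<open>k\<close> are the tuple \<open>x\<close>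
  and the next \<open>m\<close> ones the tuple \<open>y\<close>.
\<close>

definition admits ::
  "('f, 'r) language \<Rightarrow> ('m, 'f, 'r) struct \<Rightarrow> 'i set \<Rightarrow> 'i set set \<Rightarrow> bool" where
  "admits L M I \<Delta> \<longleftrightarrow>
     (\<exists>\<phi>\<in>formulas L. \<exists>k m. fv \<phi> \<subseteq> {..<k + m} \<and>
       (\<exists>a :: 'i \<Rightarrow> 'm list.
          (\<forall>i\<in>I. length (a i) = m \<and> set (a i) \<subseteq> carrier M) \<and>
          (\<forall>s. finite s \<and> s \<subseteq> I \<longrightarrow>
             ((\<exists>b. length b = k \<and> set b \<subseteq> carrier M \<and> (\<forall>i\<in>s. sat M (nth (b @ a i)) \<phi>))
                \<longleftrightarrow> s \<in> \<Delta>))))"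

section \<open>Models of set theory\<close>

text \<open>The language has a single binary relation symbol \<open>()\<close> and no function symbols.\<close>

definition set_language :: "(unit, unit) language" where
  "set_language = \<lparr>fun_syms = {}, rel_syms = {((), 2)}\<rparr>"

definition set_struct :: "'v set \<Rightarrow> ('v \<Rightarrow> 'v \<Rightarrow> bool) \<Rightarrow> ('v, unit, unit) struct" where
  "set_struct V E =
     \<lparr>carrier = V, fun_interp = (\<lambda>_ _. undefined), rel_interp = (\<lambda>_ xs. E (xs ! 0) (xs ! 1))\<rparr>"

text \<open>
  The following are the usual formulas of set theory, relativised to the structure \<open>(V, E)\<close>.
\<close>

context
  fixes V :: "'v set" and E :: "'v \<Rightarrow> 'v \<Rightarrow> bool"
begin

definition is_sub :: "'v \<Rightarrow> 'v \<Rightarrow> bool" where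
  "is_sub x y \<longleftrightarrow> (\<forall>u\<in>V. E u x \<longrightarrow> E u y)"

definition is_upair :: "'v \<Rightarrow> 'v \<Rightarrow> 'v \<Rightarrow> bool" where
  "is_upair z x y \<longleftrightarrow> (\<forall>u\<in>V. E u z \<longleftrightarrow> u = x \<or> u = y)"

definition is_opair :: "'v \<Rightarrow> 'v \<Rightarrow> 'v \<Rightarrow> bool" where
  "is_opair p x y \<longleftrightarrow> (\<exists>u\<in>V. \<exists>w\<in>V. is_upair u x x \<and> is_upair w x y \<and> is_upair p u w)"

definition pair_in :: "'v \<Rightarrow> 'v \<Rightarrow> 'v \<Rightarrow> bool" where
  "pair_in r x y \<longleftrightarrow> (\<exists>p\<in>V. is_opair p x y \<and> E p r)"

definition is_succ :: "'v \<Rightarrow> 'v \<Rightarrow> bool" where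
  "is_succ z x \<longleftrightarrow> (\<forall>u\<in>V. E u z \<longleftrightarrow> E u x \<or> u = x)"

definition is_inductive :: "'v \<Rightarrow> bool" where
  "is_inductive w \<longleftrightarrow>
     (\<exists>z\<in>V. (\<forall>u\<in>V. \<not> E u z) \<and> E z w) \<and>
     (\<forall>x\<in>V. E x w \<longrightarrow> (\<exists>z\<in>V. is_succ z x \<and> E z w))"

definition is_omega :: "'v \<Rightarrow> bool" where
  "is_omega w \<longleftrightarrow> is_inductive w \<and> (\<forall>w'\<in>V. is_inductive w' \<longrightarrow> is_sub w w')"

definition is_bijection :: "'v \<Rightarrow> 'v \<Rightarrow> 'v \<Rightarrow> bool" where
  "is_bijection f a b \<longleftrightarrow>
     (\<forall>p\<in>V. E p f \<longrightarrow> (\<exists>x\<in>V. \<exists>y\<in>V. E x a \<and> E y b \<and> is_opair p x y)) \<and>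
     (\<forall>x\<in>V. E x a \<longrightarrow> (\<exists>!y. y \<in> V \<and> E y b \<and> pair_in f x y)) \<and>
     (\<forall>y\<in>V. E y b \<longrightarrow> (\<exists>!x. x \<in> V \<and> E x a \<and> pair_in f x y))"

definition is_finite :: "'v \<Rightarrow> bool" where
  "is_finite x \<longleftrightarrow>
     (\<exists>w\<in>V. is_omega w \<and> (\<exists>k\<in>V. E k w \<and> (\<exists>f\<in>V. is_bijection f k x)))"

definition is_wellorder :: "'v \<Rightarrow> 'v \<Rightarrow> bool" where
  "is_wellorder r a \<longleftrightarrow>
     (\<forall>x\<in>V. E x a \<longrightarrow> \<not> pair_in r x x) \<and>
     (\<forall>x\<in>V. \<forall>y\<in>V. \<forall>z\<in>V. E x a \<and> E y a \<and> E z a \<and> pair_in r x y \<and> pair_in r y z \<longrightarrow>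
        pair_in r x z) \<and>
     (\<forall>x\<in>V. \<forall>y\<in>V. E x a \<and> E y a \<longrightarrow> x = y \<or> pair_in r x y \<or> pair_in r y x) \<and>
     (\<forall>b\<in>V. is_sub b a \<and> (\<exists>x\<in>V. E x b) \<longrightarrow>
        (\<exists>x\<in>V. E x b \<and> (\<forall>y\<in>V. E y b \<longrightarrow> y = x \<or> pair_in r x y)))"

text \<open>
  ZFC without power set, with the collection schema and the well-ordering principle.  In the two
  schemas the assignment \<open>e\<close> supplies the parameters.
\<close>

definition ZFC_minus :: bool where
  "ZFC_minus \<longleftrightarrow>
     V \<noteq> {} \<and>
     \<comment> \<open>extensionality\<close>
     (\<forall>x\<in>V. \<forall>y\<in>V. (\<forall>u\<in>V. E u x \<longleftrightarrow> E u y) \<longrightarrow> x = y) \<and>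
     \<comment> \<open>foundation\<close>
     (\<forall>x\<in>V. (\<exists>u\<in>V. E u x) \<longrightarrow> (\<exists>y\<in>V. E y x \<and> \<not> (\<exists>u\<in>V. E u x \<and> E u y))) \<and>
     \<comment> \<open>pairing\<close>
     (\<forall>x\<in>V. \<forall>y\<in>V. \<exists>z\<in>V. is_upair z x y) \<and>
     \<comment> \<open>union\<close>
     (\<forall>x\<in>V. \<exists>z\<in>V. \<forall>u\<in>V. E u z \<longleftrightarrow> (\<exists>y\<in>V. E y x \<and> E u y)) \<and>
     \<comment> \<open>infinity\<close>
     (\<exists>w\<in>V. is_inductive w) \<and>
     \<comment> \<open>separation\<close>
     (\<forall>\<phi>\<in>formulas set_language. \<forall>e. range e \<subseteq> V \<longrightarrow>
        (\<forall>a\<in>V. \<exists>b\<in>V. \<forall>x\<in>V. E x b \<longleftrightarrow> E x a \<and> sat (set_struct V E) (e(0 := x)) \<phi>)) \<and>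
     \<comment> \<open>collection\<close>
     (\<forall>\<phi>\<in>formulas set_language. \<forall>e. range e \<subseteq> V \<longrightarrow>
        (\<forall>a\<in>V.
           (\<forall>x\<in>V. E x a \<longrightarrow> (\<exists>y\<in>V. sat (set_struct V E) (e(0 := x, 1 := y)) \<phi>)) \<longrightarrow>
           (\<exists>b\<in>V. \<forall>x\<in>V. E x a \<longrightarrow>
              (\<exists>y\<in>V. E y b \<and> sat (set_struct V E) (e(0 := x, 1 := y)) \<phi>)))) \<and>
     \<comment> \<open>well-ordering principle\<close>
     (\<forall>a\<in>V. \<exists>r\<in>V. is_wellorder r a)"

definition omega_nonstandard :: bool where
  "omega_nonstandard \<longleftrightarrow>
     (\<exists>w\<in>V. is_omega w \<and> (\<exists>k\<in>V. E k w \<and> infinite {u \<in> V. E u k}))"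

definition extension :: "'v \<Rightarrow> 'v set" where
  "extension x = {u \<in> V. E u x}"

definition pseudofinite :: "'v set \<Rightarrow> bool" where
  "pseudofinite X \<longleftrightarrow> (\<exists>x\<in>V. is_finite x \<and> X \<subseteq> extension x)"

text \<open>
  \<open>\<lambda>\<^bsub>(V, E)\<^esub>(\<Delta>)\<close>, where \<open>jI\<close> and \<open>j\<Delta>\<close> are the images of \<open>I\<close> and \<open>\<Delta>\<close> under
  the elementary embedding.
\<close>

definition lambda_model :: "'v \<Rightarrow> 'v \<Rightarrow> 'k set set" where
  "lambda_model jI j\<Delta> = least_card (\<lambda>K :: 'k set.
     \<exists>X. pseudofinite X \<and> X \<subseteq> extension jI \<and> |X| \<le>o |K| \<and>
       (\<forall>s. finite s \<and> s \<subseteq> X \<longrightarrow> (\<exists>d\<in>V. E d j\<Delta> \<and> extension d = s)) \<and>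
       \<not> (\<exists>d\<in>V. E d j\<Delta> \<and> X \<subseteq> extension d))"

end

text \<open>
  There is no ambient universe of sets in HOL.  Its role is played by an arbitrary type with a
  well-founded extensional relation \<open>mem\<close>, in which transitivity of a collection \<open>V\<close> has its
  literal meaning.
\<close>

definition membership :: "('v \<Rightarrow> 'v \<Rightarrow> bool) \<Rightarrow> bool" where
  "membership mem \<longleftrightarrow> wfP mem \<and> (\<forall>x y. (\<forall>u. mem u x \<longleftrightarrow> mem u y) \<longrightarrow> x = y)"

definition transitive_in :: "('v \<Rightarrow> 'v \<Rightarrow> bool) \<Rightarrow> 'v set \<Rightarrow> bool" where
  "transitive_in mem V \<longleftrightarrow> (\<forall>x\<in>V. \<forall>u. mem u x \<longrightarrow> u \<in> V)"

text \<open>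
  \<open>x\<close> is the set, in the sense of \<open>mem\<close>, whose members are exactly the objects named
  through \<open>R\<close> by the members of \<open>S\<close>.  With \<open>R = (=)\<close>, \<open>x\<close> is the set with
  extension \<open>S\<close>; nesting \<open>names\<close> treats sets of sets, and so on.
\<close>

definition names :: "('v \<Rightarrow> 'v \<Rightarrow> bool) \<Rightarrow> ('a \<Rightarrow> 'v \<Rightarrow> bool) \<Rightarrow> 'a set \<Rightarrow> 'v \<Rightarrow> bool" where
  "names mem R S x \<longleftrightarrow> rel_set R S {u. mem u x}"

section \<open>Distributions in Boolean algebras\<close>

text \<open>
  A complete Boolean algebra is a type of sort \<open>{boolean_algebra, complete_lattice}\<close>.  The class
  \<open>complete_boolean_algebra\<close> is not used since it requires complete distributivity.
\<close>

definition bool_filter :: "'b :: boolean_algebra set \<Rightarrow> bool" where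
  "bool_filter U \<longleftrightarrow> top \<in> U \<and> bot \<notin> U \<and>
     (\<forall>x\<in>U. \<forall>y. x \<le> y \<longrightarrow> y \<in> U) \<and> (\<forall>x\<in>U. \<forall>y\<in>U. inf x y \<in> U)"

definition bool_ultrafilter :: "'b :: boolean_algebra set \<Rightarrow> bool" where
  "bool_ultrafilter U \<longleftrightarrow> bool_filter U \<and> (\<forall>x. x \<in> U \<or> - x \<in> U)"

text \<open>
  A function on \<open>[J]\<^bsup><\<aleph>\<^sub>0\<^esup>\<close> is a total function on sets of which only the values at the
  finite subsets of \<open>J\<close> matter.
\<close>

definition distribution ::
  "'j set \<Rightarrow> ('j set \<Rightarrow> 'b :: {boolean_algebra, complete_lattice}) \<Rightarrow> bool" where
  "distribution J A \<longleftrightarrow> A {} = top \<and>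
     (\<forall>s. finite s \<and> s \<subseteq> J \<longrightarrow> A s \<noteq> bot) \<and>
     (\<forall>s t. finite t \<and> t \<subseteq> J \<and> s \<subseteq> t \<longrightarrow> A t \<le> A s)"

definition dist_in ::
  "'j set \<Rightarrow> 'b :: {boolean_algebra, complete_lattice} set \<Rightarrow> ('j set \<Rightarrow> 'b) \<Rightarrow> bool" where
  "dist_in J U A \<longleftrightarrow> (\<forall>s. finite s \<and> s \<subseteq> J \<longrightarrow> A s \<in> U)"

definition refines ::
  "'j set \<Rightarrow> ('j set \<Rightarrow> 'b :: {boolean_algebra, complete_lattice}) \<Rightarrow> ('j set \<Rightarrow> 'b) \<Rightarrow> bool" where
  "refines J B A \<longleftrightarrow> (\<forall>s. finite s \<and> s \<subseteq> J \<longrightarrow> B s \<le> A s)"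

definition multiplicative ::
  "'j set \<Rightarrow> ('j set \<Rightarrow> 'b :: {boolean_algebra, complete_lattice}) \<Rightarrow> bool" where
  "multiplicative J A \<longleftrightarrow> (\<forall>s. finite s \<and> s \<subseteq> J \<longrightarrow> A s = (INF i\<in>s. A {i}))"

definition pattern_distribution ::
  "'j set \<Rightarrow> 'i set \<Rightarrow> 'i set set \<Rightarrow>
     ('j set \<Rightarrow> 'b :: {boolean_algebra, complete_lattice}) \<Rightarrow> bool" where
  "pattern_distribution J I \<Delta> A \<longleftrightarrow> distribution J A \<and>
     (\<forall>s c. finite s \<and> s \<subseteq> J \<and> c \<noteq> bot \<and> (\<forall>t\<subseteq>s. c \<le> A t \<or> inf c (A t) = bot) \<longrightarrow>
        (\<exists>f. f ` s \<subseteq> I \<and> (\<forall>t\<subseteq>s. c \<le> A t \<longleftrightarrow> f ` t \<in> \<Delta>)))"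

definition lambda_ultrafilter ::
  "'b :: {boolean_algebra, complete_lattice} set \<Rightarrow> 'i set \<Rightarrow> 'i set set \<Rightarrow> 'k set set" where
  "lambda_ultrafilter U I \<Delta> = least_card (\<lambda>J :: 'k set.
     \<exists>A. pattern_distribution J I \<Delta> A \<and> dist_in J U A \<and>
       \<not> (\<exists>B. distribution J B \<and> multiplicative J B \<and> refines J B A \<and> dist_in J U B))"

end

theory Submission
  imports Defs
begin

text \<open>
  In each part one direction identifies \<open>i\<close> with \<open>{i}\<close>; the other replaces a set \<open>u \<in> [I]\<^bsup>\<le>n\<^esup>\<close> by its
  elements.

  For formulas this is the conjunction \<open>\<phi>(x, y\<^sub>0) \<and> \<dots> \<and> \<phi>(x, y\<^sub>n\<^sub>-\<^sub>1)\<close>, with a disjunct \<open>z = w\<close> for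
  \<open>u = {}\<close>.  In a model of set theory one passes from \<open>X\<close> to its union, whose finiteness properties
  are inherited through the elementary embedding because \<open>V\<close>, being transitive, computes finiteness
  correctly.

  For ultrafilters, a \<open>(J, \<Delta>\<^sup>n)\<close>-distribution is a Boolean-valued \<open>\<Delta>\<^sup>n\<close>-pattern on \<open>J\<close>, finitely much of
  which is always realized by a map into \<open>[I]\<^bsup>\<le>n\<^esup>\<close>.  Sikorski's extension theorem supplies
  Boolean values for statements about enumerations of the values of this map, hence a distribution on
  \<open>J \<times> n\<close>.  Where the map is empty there is nothing to enumerate, so only those \<open>j\<close> are kept for which
  the ultrafilter says that the value at \<open>j\<close> is nonempty.
\<close>

section \<open>Admitting patterns\<close>

text \<open>A distribution for the power of \<Delta> fixes only the Boolean values of statements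
  "the union of the values over s lies in \<Delta>". Values of statements about single elements are
  not determined by these, and separately chosen ones could be inconsistent; hence the homomorphism
  defined on all statements at once. With it, every estimate becomes an inclusion between sets of
  points. The enumerated distribution lives on a product with n, while the equality of cardinals
  asks for the old index set \<open>K\<close>. A finite index set always admits a multiplicative
  refinement, so \<open>K\<close> is infinite and maps onto the product. The same question of size
  arises for models of set theory: the union of \<open>X\<close> must not be larger than
  \<open>X\<close>. Since n is a standard number, the members of \<open>X\<close> are finite even
  when seen from outside, and \<open>X\<close> itself is infinite. A further obstacle is the missing
  power set: that the index set and the pattern of the power are elements of \<open>V\<close> has to
  be derived from collection.\<close>

lemma val_cong: "(\<And>k. k \<in> fv_tm t \<Longrightarrow> e k = e' k) \<Longrightarrow> val M e t = val M e' t"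
proof (induction t)
  case (Fn f ts)
  have "map (val M e) ts = map (val M e') ts"
  proof (rule map_cong[OF refl])
    fix t assume t: "t \<in> set ts"
    show "val M e t = val M e' t"
      by (rule Fn.IH[OF t], rule Fn.prems) (use t in auto)
  qed
  then show ?case by (simp only: val.simps)
qed simp

lemma sat_cong: "(\<And>k. k \<in> fv \<phi> \<Longrightarrow> e k = e' k) \<Longrightarrow> sat M e \<phi> \<longleftrightarrow> sat M e' \<phi>"
proof (induction \<phi> arbitrary: e e')
  case (Equal t u)
  have "val M e t = val M e' t" "val M e u = val M e' u"
    by (rule val_cong, rule Equal.prems, simp)+
  then show ?case by simp
next
  case (Rel r ts)
  have "map (val M e) ts = map (val M e') ts"
  proof (rule map_cong[OF refl])
    fix t assume t: "t \<in> set ts"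
    show "val M e t = val M e' t"
      by (rule val_cong, rule Rel.prems) (use t in auto)
  qed
  then show ?case by (simp only: sat.simps)
next
  case (Neg \<phi>)
  have "sat M e \<phi> \<longleftrightarrow> sat M e' \<phi>"
    by (rule Neg.IH, rule Neg.prems) simp
  then show ?case by simp
next
  case (Conj \<phi> \<psi>)
  have "sat M e \<phi> \<longleftrightarrow> sat M e' \<phi>" "sat M e \<psi> \<longleftrightarrow> sat M e' \<psi>"
    by (rule Conj.IH, rule Conj.prems, simp)+
  then show ?case by simp
next
  case (Exi k \<phi>)
  have "sat M (e(k := a)) \<phi> \<longleftrightarrow> sat M (e'(k := a)) \<phi>" for a
    by (rule Exi.IH) (use Exi.prems in auto)
  then show ?case by simp
qed

section \<open>Injective renaming, finite conjunctions and blocks of variables\<close>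

fun rename_tm :: "(nat \<Rightarrow> nat) \<Rightarrow> 'f tm \<Rightarrow> 'f tm" where
  "rename_tm \<pi> (Var k) = Var (\<pi> k)"
| "rename_tm \<pi> (Fn f ts) = Fn f (map (rename_tm \<pi>) ts)"

text \<open>Bound variables are renamed too, so for injective \<open>\<pi>\<close> no capture can occur.\<close>

fun rename_fm :: "(nat \<Rightarrow> nat) \<Rightarrow> ('f, 'r) fm \<Rightarrow> ('f, 'r) fm" where
  "rename_fm \<pi> (Equal t u) = Equal (rename_tm \<pi> t) (rename_tm \<pi> u)"
| "rename_fm \<pi> (Rel r ts) = Rel r (map (rename_tm \<pi>) ts)"
| "rename_fm \<pi> (Neg \<phi>) = Neg (rename_fm \<pi> \<phi>)"
| "rename_fm \<pi> (Conj \<phi> \<psi>) = Conj (rename_fm \<pi> \<phi>) (rename_fm \<pi> \<psi>)"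
| "rename_fm \<pi> (Exi k \<phi>) = Exi (\<pi> k) (rename_fm \<pi> \<phi>)"

lemma wf_rename_tm: "wf_tm L t \<Longrightarrow> wf_tm L (rename_tm \<pi> t)"
  by (induction t) auto

lemma wf_rename_fm: "wf_fm L \<phi> \<Longrightarrow> wf_fm L (rename_fm \<pi> \<phi>)"
  by (induction \<phi>) (auto simp: wf_rename_tm)

lemma fv_rename_tm: "fv_tm (rename_tm \<pi> t) = \<pi> ` fv_tm t"
  by (induction t) auto

lemma fv_rename_fm: "inj \<pi> \<Longrightarrow> fv (rename_fm \<pi> \<phi>) = \<pi> ` fv \<phi>"
  by (induction \<phi>) (auto simp: fv_rename_tm image_Un inj_def)

lemma val_rename_tm: "val M e (rename_tm \<pi> t) = val M (e \<circ> \<pi>) t"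
proof (induction t)
  case (Fn f ts)
  then have "map (val M e) (map (rename_tm \<pi>) ts) = map (val M (e \<circ> \<pi>)) ts"
    by (simp add: o_def)
  then show ?case by (simp only: val.simps rename_tm.simps)
qed simp

lemma sat_rename_fm: "inj \<pi> \<Longrightarrow> sat M e (rename_fm \<pi> \<phi>) \<longleftrightarrow> sat M (e \<circ> \<pi>) \<phi>"
proof (induction \<phi> arbitrary: e)
  case (Rel r ts)
  have "map (val M e) (map (rename_tm \<pi>) ts) = map (val M (e \<circ> \<pi>)) ts"
    by (simp add: val_rename_tm)
  then show ?case by (simp only: sat.simps rename_fm.simps)
next
  case (Exi k \<phi>)
  have "e(\<pi> k := a) \<circ> \<pi> = (e \<circ> \<pi>)(k := a)" for a
    using Exi.prems by (auto simp: inj_def)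
  with Exi.IH[OF Exi.prems] show ?case by (simp only: rename_fm.simps sat.simps)
qed (simp_all add: val_rename_tm)

text \<open>The case distinction drops the initial equation as soon as there is a conjunct, so that
  its variable 0 does not become a free variable of the conjunction.\<close>

fun conj_upto :: "(nat \<Rightarrow> ('f, 'r) fm) \<Rightarrow> nat \<Rightarrow> ('f, 'r) fm" where
  "conj_upto \<phi> 0 = Equal (Var 0) (Var 0)"
| "conj_upto \<phi> (Suc n) = (if n = 0 then \<phi> 0 else Conj (conj_upto \<phi> n) (\<phi> n))"

lemma wf_conj_upto: "(\<And>i. i < n \<Longrightarrow> wf_fm L (\<phi> i)) \<Longrightarrow> wf_fm L (conj_upto \<phi> n)"
  by (induction n) auto

lemma fv_conj_upto: "1 \<le> n \<Longrightarrow> fv (conj_upto \<phi> n) = (\<Union>i<n. fv (\<phi> i))"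
proof (induction n)
  case (Suc n)
  then show ?case by (cases n) (auto simp: less_Suc_eq)
qed simp

lemma sat_conj_upto: "sat M e (conj_upto \<phi> n) \<longleftrightarrow> (\<forall>i<n. sat M e (\<phi> i))"
  by (induction n) (auto simp: less_Suc_eq)

text \<open>Moves the block of variables \<open>k, \<dots>, k + m - 1\<close> to the \<open>i\<close>-th of \<open>n\<close> consecutive blocks.\<close>

definition shift_block :: "nat \<Rightarrow> nat \<Rightarrow> nat \<Rightarrow> nat \<Rightarrow> nat \<Rightarrow> nat" where
  "shift_block k m n i v = (if v < k then v else if v < k + m then v + i * m else v + n * m)"

lemma block_bound: "i < n \<Longrightarrow> i * m + m \<le> n * (m::nat)"
  using mult_le_mono1[of "Suc i" n m] by simp

text \<open>Variables from \<open>k + m\<close> upward, which may occur bound, move past all n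
  blocks and so cannot collide with the shifted block, which ends at or before
  \<open>k + n * m\<close>.\<close>

lemma inj_shift_block: "i < n \<Longrightarrow> inj (shift_block k m n i)"
  using block_bound[of i n m] unfolding inj_def shift_block_def by (simp split: if_split)

lemma nth_concat_block:
  assumes "\<And>xs. xs \<in> set xss \<Longrightarrow> length xs = m" "i < length xss" "l < m"
  shows "concat xss ! (i * m + l) = xss ! i ! l"
  using assms
proof (induction xss arbitrary: i)
  case (Cons xs xss)
  then show ?case by (cases i) (auto simp: nth_append)
qed simp

lemma length_concat_block:
  "(\<And>xs. xs \<in> set xss \<Longrightarrow> length xs = m) \<Longrightarrow> length (concat xss) = length xss * m"
  by (induction xss) auto

text \<open>Small sets are padded by repeating one element, so that all enumerations share the
  length n. This is what fails for the empty set.\<close>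

lemma list_of_finite_set:
  assumes "finite u" "u \<noteq> {}" "card u \<le> n"
  obtains xs where "set xs = u" "length xs = n"
proof -
  obtain ys where ys: "set ys = u" "distinct ys" using assms finite_distinct_list by blast
  then have "length ys \<le> n" using assms(3) distinct_card[of ys] by simp
  obtain y where "y \<in> u" using assms(2) by blast
  with ys \<open>length ys \<le> n\<close> show thesis
    by (intro that[of "ys @ replicate (n - length ys) y"]) (auto simp: set_replicate_conv_if)
qed

section \<open>Admitting a pattern and admitting its power\<close>

lemma pattern_power_singletons:
  assumes "1 \<le> n" "finite s" "s \<subseteq> I"
  shows "(\<lambda>i. {i}) ` s \<in> pattern_power n I \<Delta> \<longleftrightarrow> s \<in> \<Delta>"
  using assms by (auto simp: pattern_power_def subsets_upto_def)

lemma admitsI: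
  assumes "\<phi> \<in> formulas L" "fv \<phi> \<subseteq> {..<k + m}"
    and "\<And>i. i \<in> I \<Longrightarrow> length (a i) = m \<and> set (a i) \<subseteq> carrier M"
    and "\<And>s. finite s \<Longrightarrow> s \<subseteq> I \<Longrightarrow>
      (\<exists>b. length b = k \<and> set b \<subseteq> carrier M \<and> (\<forall>i\<in>s. sat M (nth (b @ a i)) \<phi>)) \<longleftrightarrow> s \<in> \<Delta>"
  shows "admits L M I \<Delta>"
  unfolding admits_def
  by (rule bexI[OF _ assms(1)], rule exI[of _ k], rule exI[of _ m], rule conjI[OF assms(2)], rule exI[of _ a])
    (simp add: assms(3,4))

lemma admitsE:
  assumes "admits L M I \<Delta>"
  obtains \<phi> k m a where "\<phi> \<in> formulas L" "fv \<phi> \<subseteq> {..<k + m}"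
    and "\<And>i. i \<in> I \<Longrightarrow> length (a i) = m \<and> set (a i) \<subseteq> carrier M"
    and "\<And>s. finite s \<Longrightarrow> s \<subseteq> I \<Longrightarrow>
      (\<exists>b. length b = k \<and> set b \<subseteq> carrier M \<and> (\<forall>i\<in>s. sat M (nth (b @ a i)) \<phi>)) \<longleftrightarrow> s \<in> \<Delta>"
proof -
  from assms obtain \<phi> k m a where "\<phi> \<in> formulas L" "fv \<phi> \<subseteq> {..<k + m}"
    and a: "\<forall>i\<in>I. length (a i) = m \<and> set (a i) \<subseteq> carrier M"
    and adm: "\<forall>s. finite s \<and> s \<subseteq> I \<longrightarrow>
      ((\<exists>b. length b = k \<and> set b \<subseteq> carrier M \<and> (\<forall>i\<in>s. sat M (nth (b @ a i)) \<phi>)) \<longleftrightarrow> s \<in> \<Delta>)"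
    unfolding admits_def by (elim bexE exE conjE) (rule that)
  from this(1,2) show thesis
  proof (rule that)
    show "length (a i) = m \<and> set (a i) \<subseteq> carrier M" if "i \<in> I" for i
      using a that by blast
  next
    fix s assume "finite s" "s \<subseteq> I"
    then show "(\<exists>b. length b = k \<and> set b \<subseteq> carrier M \<and> (\<forall>i\<in>s. sat M (nth (b @ a i)) \<phi>)) \<longleftrightarrow> s \<in> \<Delta>"
      using adm by simp
  qed
qed

lemma admits_from_pattern_power:
  assumes "1 \<le> n" and "admits L M (subsets_upto n I) (pattern_power n I \<Delta>)"
  shows "admits L M I \<Delta>"
proof -
  obtain \<phi> k m a where \<phi>: "\<phi> \<in> formulas L" "fv \<phi> \<subseteq> {..<k + m}"
    and a: "\<And>u. u \<in> subsets_upto n I \<Longrightarrow> length (a u) = m \<and> set (a u) \<subseteq> carrier M"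
    and adm: "\<And>s. finite s \<Longrightarrow> s \<subseteq> subsets_upto n I \<Longrightarrow>
      (\<exists>b. length b = k \<and> set b \<subseteq> carrier M \<and> (\<forall>i\<in>s. sat M (nth (b @ a i)) \<phi>))
        \<longleftrightarrow> s \<in> pattern_power n I \<Delta>"
    by (rule admitsE[OF assms(2)], rule that)
  have sing: "{i} \<in> subsets_upto n I" if "i \<in> I" for i
    using that \<open>1 \<le> n\<close> by (simp add: subsets_upto_def)
  have "(\<exists>b. length b = k \<and> set b \<subseteq> carrier M \<and> (\<forall>i\<in>s. sat M (nth (b @ a {i})) \<phi>)) \<longleftrightarrow> s \<in> \<Delta>"
    if "finite s" "s \<subseteq> I" for s
  proof -
    have "(\<lambda>i. {i}) ` s \<subseteq> subsets_upto n I" using sing that by blast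
    then show ?thesis
      using adm[of "(\<lambda>i. {i}) ` s"] that pattern_power_singletons[OF \<open>1 \<le> n\<close> that, of \<Delta>] by simp
  qed
  then show ?thesis
    by (intro admitsI[OF \<phi>, of I "\<lambda>i. a {i}"]) (use a sing in auto)
qed

text \<open>
  The formula for \<open>\<Delta>\<^sup>n\<close> is \<open>z = w \<or> (\<And>\<^bsub>i<n\<^esub> \<phi>(x, y\<^sub>i))\<close>; a nonempty index \<open>u\<close> is coded by an
  enumeration of \<open>u\<close> with \<open>z \<noteq> w\<close>, and the empty index by \<open>z = w\<close>.
\<close>

lemma admits_pattern_power:
  assumes "admits L M I \<Delta>" and n: "1 \<le> n"
    and p: "p \<in> carrier M" and q: "q \<in> carrier M" and "p \<noteq> q"
  shows "admits L M (subsets_upto n I) (pattern_power n I \<Delta>)"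
proof -
  obtain \<phi> k m a where \<phi>: "\<phi> \<in> formulas L" "fv \<phi> \<subseteq> {..<k + m}"
    and a: "\<And>i. i \<in> I \<Longrightarrow> length (a i) = m \<and> set (a i) \<subseteq> carrier M"
    and adm: "\<And>s. finite s \<Longrightarrow> s \<subseteq> I \<Longrightarrow>
      (\<exists>b. length b = k \<and> set b \<subseteq> carrier M \<and> (\<forall>i\<in>s. sat M (nth (b @ a i)) \<phi>)) \<longleftrightarrow> s \<in> \<Delta>"
    by (rule admitsE[OF assms(1)], rule that)
  define \<psi> where "\<psi> = conj_upto (\<lambda>i. rename_fm (shift_block k m n i) \<phi>) n"
  \<comment> \<open>The variables \<open>z\<close> and \<open>Suc z\<close> are the first ones after
    all n parameter blocks.\<close>
  define z where "z = k + n * m"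
  define \<phi>' where "\<phi>' = Neg (Conj (Neg (Equal (Var z) (Var (Suc z)))) (Neg \<psi>))"
  have "\<exists>xs. set xs = u \<and> length xs = n" if "u \<in> subsets_upto n I" "u \<noteq> {}" for u
    using that list_of_finite_set[of u n] by (auto simp: subsets_upto_def)
  then obtain enum where enum: "\<And>u. u \<in> subsets_upto n I \<Longrightarrow> u \<noteq> {} \<Longrightarrow> set (enum u) = u \<and> length (enum u) = n"
    by metis
  \<comment> \<open>For the empty index the last two entries agree, which makes the equation true;
    the other copies of \<open>p\<close> only fill the tuple up to its length.\<close>
  define a' where "a' u = (if u = {} then replicate (n * m) p @ [p, p]
    else concat (map a (enum u)) @ [p, q])" for u
  have sub: "u \<subseteq> I" if "u \<in> subsets_upto n I" for u
    using that by (simp add: subsets_upto_def)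
  have len: "length (concat (map a (enum u))) = n * m" if "u \<in> subsets_upto n I" "u \<noteq> {}" for u
    using enum[OF that] a sub[OF that(1)] length_concat_block[of "map a (enum u)" m] by auto
  have a': "length (a' u) = n * m + 2 \<and> set (a' u) \<subseteq> carrier M" if "u \<in> subsets_upto n I" for u
  proof (cases "u = {}")
    case True
    then show ?thesis using p by (auto simp: a'_def)
  next
    case False
    have "set (concat (map a (enum u))) \<subseteq> carrier M"
      using enum[OF that False] a sub[OF that] by auto
    then show ?thesis using len[OF that False] p q False
      by (simp add: a'_def)
  qed
  have fv\<psi>: "fv \<psi> \<subseteq> {..<z}"
  proof -
    have "shift_block k m n i v < z" if "i < n" "v < k + m" for i v
      using that block_bound[OF that(1), of m] by (auto simp: shift_block_def z_def)
    then show ?thesis unfolding \<psi>_def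
      using n \<phi>(2) by (fastforce simp: fv_conj_upto fv_rename_fm inj_shift_block)
  qed
  have wf: "\<phi>' \<in> formulas L"
    using \<phi>(1) unfolding formulas_def by (simp add: \<phi>'_def \<psi>_def wf_conj_upto wf_rename_fm)
  have fv': "fv \<phi>' \<subseteq> {..<k + (n * m + 2)}"
    using fv\<psi> by (auto simp: \<phi>'_def z_def)
  have key: "sat M (nth (b @ a' u)) \<phi>' \<longleftrightarrow> (\<forall>i\<in>u. sat M (nth (b @ a i)) \<phi>)"
    if u: "u \<in> subsets_upto n I" and b: "length b = k" for u b
  proof (cases "u = {}")
    case True
    then have "(b @ a' u) ! z = p" "(b @ a' u) ! Suc z = p"
      using b by (simp_all add: a'_def z_def nth_append)
    with True show ?thesis by (simp add: \<phi>'_def)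
  next
    case False
    note e = enum[OF u False] and l = len[OF u False]
    have "(b @ a' u) ! z = p" "(b @ a' u) ! Suc z = q"
      using b l False by (simp_all add: a'_def z_def nth_append)
    then have "sat M (nth (b @ a' u)) \<phi>' \<longleftrightarrow> sat M (nth (b @ a' u)) \<psi>"
      using \<open>p \<noteq> q\<close> by (simp add: \<phi>'_def)
    also have "\<dots> \<longleftrightarrow> (\<forall>i<n. sat M (nth (b @ a' u) \<circ> shift_block k m n i) \<phi>)"
      by (simp add: \<psi>_def sat_conj_upto sat_rename_fm inj_shift_block)
    also have "\<dots> \<longleftrightarrow> (\<forall>i<n. sat M (nth (b @ a (enum u ! i))) \<phi>)"
    proof -
      have "sat M (nth (b @ a' u) \<circ> shift_block k m n i) \<phi> \<longleftrightarrow> sat M (nth (b @ a (enum u ! i))) \<phi>"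
        if i: "i < n" for i
      proof (rule sat_cong)
        fix v assume "v \<in> fv \<phi>"
        with \<phi>(2) have v: "v < k + m" by auto
        show "(nth (b @ a' u) \<circ> shift_block k m n i) v = (b @ a (enum u ! i)) ! v"
        proof (cases "v < k")
          case True
          then show ?thesis using b by (simp add: shift_block_def nth_append)
        next
          case F: False
          define r where "r = v - k"
          have r: "v = k + r" "r < m" using F v by (auto simp: r_def)
          have "concat (map a (enum u)) ! (i * m + r) = map a (enum u) ! i ! r"
            by (rule nth_concat_block) (use e i a sub[OF u] r in auto)
          moreover have "i * m + r < n * m" using block_bound[OF i, of m] r by simp
          ultimately show ?thesis using b l r e i False
            by (simp add: shift_block_def nth_append a'_def ac_simps)
        qed
      qed
      then show ?thesis by auto
    qed
    \<comment> \<open>Repetitions in the enumeration are harmless, since a conjunct may occur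
      twice.\<close>
    also have "\<dots> \<longleftrightarrow> (\<forall>i\<in>u. sat M (nth (b @ a i)) \<phi>)"
      using e by (metis in_set_conv_nth nth_mem)
    finally show ?thesis .
  qed
  have "(\<exists>b. length b = k \<and> set b \<subseteq> carrier M \<and> (\<forall>u\<in>s. sat M (nth (b @ a' u)) \<phi>'))
      \<longleftrightarrow> s \<in> pattern_power n I \<Delta>" if s: "finite s" "s \<subseteq> subsets_upto n I" for s
  proof -
    \<comment> \<open>The variables below \<open>k\<close> are not shifted, so the same tuple
      \<open>b\<close> serves as witness on both sides.\<close>
    have "(\<forall>u\<in>s. sat M (nth (b @ a' u)) \<phi>') \<longleftrightarrow> (\<forall>i\<in>\<Union>s. sat M (nth (b @ a i)) \<phi>)"
      if "length b = k" for b
      using key[OF _ that] s(2) by (simp add: subset_iff)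
    then have "(\<exists>b. length b = k \<and> set b \<subseteq> carrier M \<and> (\<forall>u\<in>s. sat M (nth (b @ a' u)) \<phi>'))
      \<longleftrightarrow> (\<exists>b. length b = k \<and> set b \<subseteq> carrier M \<and> (\<forall>i\<in>\<Union>s. sat M (nth (b @ a i)) \<phi>))"
      by (simp cong: conj_cong)
    also have "\<dots> \<longleftrightarrow> \<Union>s \<in> \<Delta>"
      by (rule adm) (use s in \<open>auto simp: subsets_upto_def\<close>)
    finally show ?thesis using s by (simp add: pattern_power_def)
  qed
  then show ?thesis
    by (intro admitsI[OF wf fv', of _ a']) (use a' in auto)
qed

section \<open>Boolean-valued realizations\<close>

text \<open>In the language of forcing: the condition \<open>c\<close> decides the statement with
  Boolean value \<open>b\<close>.\<close>

definition decides :: "'b::boolean_algebra \<Rightarrow> 'b \<Rightarrow> bool" where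
  "decides c b \<longleftrightarrow> c \<le> b \<or> inf c b = bot"

lemma decides_mono: "decides c b \<Longrightarrow> d \<le> c \<Longrightarrow> decides d b"
  unfolding decides_def
proof (elim disjE)
  assume "d \<le> c" "inf c b = bot"
  then have "inf d b \<le> bot" by (metis inf_mono order_refl)
  then show "d \<le> b \<or> inf d b = bot" by (simp add: bot_unique)
qed (meson order_trans)

text \<open>A decision is kept by every smaller nonzero condition: if \<open>d\<close> is below
  \<open>b\<close>, then \<open>c\<close> meets \<open>b\<close>, so \<open>c\<close> cannot have
  decided against it. This allows conditions to be shrunk without changing the truth values already
  decided.\<close>

lemma decides_le_iff:
  assumes "decides c b" "d \<le> c" "d \<noteq> bot"
  shows "d \<le> b \<longleftrightarrow> c \<le> b"
proof
  assume "d \<le> b"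
  with assms(2) have "d \<le> inf c b" by simp
  with assms(3) have "inf c b \<noteq> bot" by (metis bot.extremum_uniqueI)
  with assms(1) show "c \<le> b" by (simp add: decides_def)
qed (use assms(2) in order)

text \<open>The members of \<open>B\<close> are treated one at a time: a condition disjoint from
  \<open>b\<close> has decided it, any other is replaced by its meet with \<open>b\<close>.\<close>

lemma ex_decides:
  assumes "c \<noteq> bot" "finite B"
  obtains d where "d \<noteq> bot" "d \<le> c" "\<And>b. b \<in> B \<Longrightarrow> decides d b"
proof -
  have "\<exists>d. d \<noteq> bot \<and> d \<le> c \<and> (\<forall>b\<in>B. decides d b)"
    using assms(2)
  proof (induction B)
    case empty
    then show ?case using assms(1) by blast
  next
    case (insert b B)
    then obtain d where d: "d \<noteq> bot" "d \<le> c" "\<forall>b\<in>B. decides d b" by blast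
    show ?case
    proof (cases "inf d b = bot")
      case True
      then have "decides d b" by (simp add: decides_def)
      with d show ?thesis by blast
    next
      case False
      have "decides (inf d b) b" by (simp add: decides_def)
      moreover have "decides (inf d b) b'" if "b' \<in> B" for b'
        by (rule decides_mono[OF _ inf_le1]) (use d(3) that in blast)
      moreover have "inf d b \<le> c" using d(2) by (rule le_infI1)
      ultimately show ?thesis using False by blast
    qed
  qed
  with that show thesis by blast
qed

text \<open>
  Equivalently, sending \<open>Y\<close> to \<open>b\<close> for \<open>(Y, b) \<in> G\<close> extends to a homomorphism from the algebra of
  subsets of \<open>R\<close> generated by these sets \<open>Y\<close>.
\<close>

definition realizable :: "'r set \<Rightarrow> ('r set \<times> 'b::boolean_algebra) set \<Rightarrow> bool" where
  "realizable R G \<longleftrightarrow> (\<forall>F c. finite F \<longrightarrow> F \<subseteq> G \<longrightarrow> c \<noteq> bot \<longrightarrow> (\<forall>p\<in>F. decides c (snd p)) \<longrightarrow>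
     (\<exists>r\<in>R. \<forall>p\<in>F. r \<in> fst p \<longleftrightarrow> c \<le> snd p))"

lemma realizableD:
  assumes "realizable R G" "finite F" "F \<subseteq> G" "c \<noteq> bot" "\<forall>p\<in>F. decides c (snd p)"
  shows "\<exists>r\<in>R. \<forall>p\<in>F. r \<in> fst p \<longleftrightarrow> c \<le> snd p"
  using assms unfolding realizable_def by simp

lemma realizable_subset:
  assumes "realizable R G" "G' \<subseteq> G"
  shows "realizable R G'"
  unfolding realizable_def
  by (intro allI impI realizableD[OF assms(1)]) (use assms(2) in auto)

text \<open>If \<open>c\<close> is disjoint from every member of \<open>S\<close>, then
  \<open>- c\<close> is an upper bound of \<open>S\<close> and hence of its supremum. Binary meets
  distribute over arbitrary joins in every complete Boolean algebra, without complete
  distributivity.\<close>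

lemma inf_Sup_neq_bot:
  fixes c :: "'b::{boolean_algebra, complete_lattice}"
  assumes "inf c (Sup S) \<noteq> bot"
  obtains s where "s \<in> S" "inf c s \<noteq> bot"
proof -
  have "inf c (Sup S) = bot" if "\<And>s. s \<in> S \<Longrightarrow> inf c s = bot"
  proof -
    have "Sup S \<le> - c"
    proof (rule Sup_least)
      fix s assume "s \<in> S"
      then have "inf s c = bot" by (subst inf_commute) (rule that)
      then show "s \<le> - c" by (simp add: inf_shunt)
    qed
    then have "inf (Sup S) c = bot" by (simp add: inf_shunt)
    then show ?thesis by (simp add: inf_commute)
  qed
  with assms that show thesis by blast
qed

text \<open>The one-step extension. \<open>S\<close> consists of the conditions under which finitely
  many constraints of \<open>G\<close> already force a point into \<open>Y\<close>; its supremum is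
  the least value that \<open>Y\<close> can take.\<close>

lemma realizable_insert:
  fixes G :: "('r set \<times> 'b::{boolean_algebra, complete_lattice}) set"
  assumes G: "realizable R G"
  shows "\<exists>b. realizable R (insert (Y, b) G)"
proof -
  define S where "S = {c. \<exists>F. finite F \<and> F \<subseteq> G \<and> (\<forall>p\<in>F. decides c (snd p)) \<and>
    (\<forall>r\<in>R. (\<forall>p\<in>F. r \<in> fst p \<longleftrightarrow> c \<le> snd p) \<longrightarrow> r \<in> Y)}"
  have "\<exists>r\<in>R. \<forall>p\<in>F. r \<in> fst p \<longleftrightarrow> c \<le> snd p"
    if F: "finite F" "F \<subseteq> insert (Y, Sup S) G" and c: "c \<noteq> bot" and dec: "\<forall>p\<in>F. decides c (snd p)" for F c
  proof -
    define F' where "F' = F - {(Y, Sup S)}"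
    have F': "finite F'" "F' \<subseteq> G" using F by (auto simp: F'_def)
    have subF: "F \<subseteq> insert (Y, Sup S) F'" by (auto simp: F'_def)
    have decF': "\<forall>p\<in>F'. decides c (snd p)" using dec by (auto simp: F'_def)
    show ?thesis
    proof (cases "(Y, Sup S) \<in> F")
      case False
      then have "F' = F" by (simp add: F'_def)
      with realizableD[OF G F' c decF'] show ?thesis by simp
    next
      case True
      with dec have "decides c (Sup S)" by auto
      then consider "c \<le> Sup S" | "inf c (Sup S) = bot" by (auto simp: decides_def)
      then show ?thesis
      proof cases
        \<comment> \<open>Some \<open>c'\<close> in \<open>S\<close> meets \<open>c\<close>. A point
          realizing the constraints under the meet agrees with \<open>c\<close> on
          \<open>F'\<close>, and with \<open>c'\<close> on \<open>H\<close>, which forces it into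
          \<open>Y\<close>.\<close>
        case 1
        then have "inf c (Sup S) \<noteq> bot" using c by (simp add: inf.absorb1)
        then obtain c' where c': "c' \<in> S" "inf c c' \<noteq> bot" by (rule inf_Sup_neq_bot)
        then obtain H where H: "finite H" "H \<subseteq> G" and decH: "\<forall>p\<in>H. decides c' (snd p)"
          and HY: "\<forall>r\<in>R. (\<forall>p\<in>H. r \<in> fst p \<longleftrightarrow> c' \<le> snd p) \<longrightarrow> r \<in> Y"
          unfolding S_def by blast
        have "\<forall>p\<in>F' \<union> H. decides (inf c c') (snd p)"
          using decF' decH decides_mono[OF _ inf_le1, of c _ c'] decides_mono[OF _ inf_le2, of c' _ c] by blast
        moreover have "finite (F' \<union> H)" "F' \<union> H \<subseteq> G" using F' H by auto
        ultimately obtain r where r: "r \<in> R" "\<forall>p\<in>F' \<union> H. r \<in> fst p \<longleftrightarrow> inf c c' \<le> snd p"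
          using realizableD[OF G _ _ c'(2)] by blast
        have "inf c c' \<le> snd p \<longleftrightarrow> c' \<le> snd p" if "p \<in> H" for p
          using decides_le_iff[OF _ inf_le2 c'(2)] decH that by blast
        then have "r \<in> Y" using HY r by simp
        moreover have "inf c c' \<le> snd p \<longleftrightarrow> c \<le> snd p" if "p \<in> F'" for p
          using decides_le_iff[OF _ inf_le1 c'(2)] decF' that by blast
        ultimately have "\<forall>p\<in>insert (Y, Sup S) F'. r \<in> fst p \<longleftrightarrow> c \<le> snd p"
          using r(2) 1 by simp
        then show ?thesis using r(1) subF by blast
      next
        \<comment> \<open>Here \<open>c\<close> is not in \<open>S\<close>, so the constraints of
          \<open>F'\<close> do not force a point into \<open>Y\<close>, and some point realizing
          them stays outside.\<close>
        case 2
        have notle: "\<not> c \<le> Sup S" using 2 c by (auto simp: inf.absorb1)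
        then have "c \<notin> S" by (auto intro: Sup_upper)
        then obtain r where r: "r \<in> R" "\<forall>p\<in>F'. r \<in> fst p \<longleftrightarrow> c \<le> snd p" "r \<notin> Y"
          using F' decF' unfolding S_def by blast
        then have "\<forall>p\<in>insert (Y, Sup S) F'. r \<in> fst p \<longleftrightarrow> c \<le> snd p"
          using notle by simp
        then show ?thesis using r(1) subF by blast
      qed
    qed
  qed
  then have "realizable R (insert (Y, Sup S) G)" unfolding realizable_def by blast
  then show ?thesis ..
qed

text \<open>Sikorski's extension theorem for the power set algebra of \<open>R\<close>.\<close>

lemma realizable_extension:
  fixes G :: "('r set \<times> 'b::{boolean_algebra, complete_lattice}) set"
  assumes G: "realizable R G"
  obtains h where "\<And>Y b. (Y, b) \<in> G \<Longrightarrow> h Y = b" "realizable R (range (\<lambda>Y. (Y, h Y)))"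
proof -
  let ?\<A> = "{H. G \<subseteq> H \<and> realizable R H}"
  have "\<exists>M\<in>?\<A>. \<forall>X\<in>?\<A>. M \<subseteq> X \<longrightarrow> X = M"
  proof (rule subset_Zorn_nonempty)
    show "?\<A> \<noteq> {}" using G by blast
  next
    fix \<C> assume \<C>: "\<C> \<noteq> {}" "subset.chain ?\<A> \<C>"
    then have sub: "\<C> \<subseteq> ?\<A>" by (simp add: subset.chain_def)
    have "realizable R (\<Union>\<C>)"
      unfolding realizable_def
    proof (intro allI impI)
      fix F c assume F: "finite F" "F \<subseteq> \<Union>\<C>" and c: "c \<noteq> bot" "\<forall>p\<in>F. decides c (snd p)"
      obtain H where "H \<in> \<C>" "F \<subseteq> H"
        using finite_subset_Union_chain[OF F \<C>] by blast
      with sub have "realizable R H" by blast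
      from realizableD[OF this F(1) \<open>F \<subseteq> H\<close> c]
      show "\<exists>r\<in>R. \<forall>p\<in>F. r \<in> fst p \<longleftrightarrow> c \<le> snd p" .
    qed
    then show "\<Union>\<C> \<in> ?\<A>" using sub \<C>(1) by blast
  qed
  then obtain M where M: "G \<subseteq> M" "realizable R M"
    and max: "\<And>X. M \<subseteq> X \<Longrightarrow> realizable R X \<Longrightarrow> X = M"
    by auto
  \<comment> \<open>By the one-step extension, a maximal family gives a value to every set.\<close>
  have "\<exists>b. (Y, b) \<in> M" for Y
    using realizable_insert[OF M(2), of Y] max by blast
  then obtain h where h: "\<And>Y. (Y, h Y) \<in> M" by metis
  \<comment> \<open>Under a nonzero part of \<open>b\<close> outside \<open>b'\<close>, a realizing
    point would lie both in \<open>Y\<close> and outside \<open>Y\<close>.\<close>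
  have uniq: "b \<le> b'" if bb: "(Y, b) \<in> M" "(Y, b') \<in> M" for Y b b'
  proof (rule ccontr)
    assume "\<not> b \<le> b'"
    then have "inf b (- b') \<noteq> bot" by (simp add: inf_shunt)
    moreover have "\<forall>p\<in>{(Y, b), (Y, b')}. decides (inf b (- b')) (snd p)"
      by (simp add: decides_def inf_assoc)
    ultimately obtain r where "\<forall>p\<in>{(Y, b), (Y, b')}. r \<in> fst p \<longleftrightarrow> inf b (- b') \<le> snd p"
      using realizableD[OF M(2), of "{(Y, b), (Y, b')}" "inf b (- b')"] bb by auto
    then have "inf b (- b') \<le> b'" by auto
    then have "inf b (- b') \<le> inf b' (- b')" by (intro le_infI inf_le2)
    then have "inf b (- b') \<le> bot" by (simp only: inf_compl_bot)
    with \<open>inf b (- b') \<noteq> bot\<close> show False by (simp add: bot_unique)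
  qed
  show thesis
  proof
    show "h Y = b" if "(Y, b) \<in> G" for Y b
      by (rule antisym; rule uniq[of Y]) (use that M(1) h in blast)+
    show "realizable R (range (\<lambda>Y. (Y, h Y)))"
    proof -
      have "range (\<lambda>Y. (Y, h Y)) \<subseteq> M" by (rule image_subsetI) (rule h)
      with M(2) show ?thesis by (rule realizable_subset)
    qed
  qed
qed

lemma realizable_fun:
  assumes "realizable R (range (\<lambda>Y. (Y, h Y)))"
    and "finite F" "c \<noteq> bot" "\<And>Y. Y \<in> F \<Longrightarrow> decides c (h Y)"
  obtains r where "r \<in> R" "\<forall>Y\<in>F. r \<in> Y \<longleftrightarrow> c \<le> h Y"
proof -
  have "finite ((\<lambda>Y. (Y, h Y)) ` F)" "(\<lambda>Y. (Y, h Y)) ` F \<subseteq> range (\<lambda>Y. (Y, h Y))"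
    using assms(2) by auto
  moreover have "\<forall>p\<in>(\<lambda>Y. (Y, h Y)) ` F. decides c (snd p)"
    using assms(4) by auto
  ultimately have "\<exists>r\<in>R. \<forall>p\<in>(\<lambda>Y. (Y, h Y)) ` F. r \<in> fst p \<longleftrightarrow> c \<le> snd p"
    using realizableD[OF assms(1) _ _ assms(3)] by blast
  then show thesis using that by auto
qed

text \<open>If the meet were not below \<open>h Z\<close>, the difference would decide for all
  members of \<open>F\<close> and against \<open>Z\<close>, and a realizing point would contradict
  the inclusion. All later inequalities between Boolean values are obtained from inclusions in this
  way; an empty \<open>F\<close> yields the value \<open>top\<close>.\<close>

lemma realizable_fun_le:
  fixes h :: "'r set \<Rightarrow> 'b::{boolean_algebra, complete_lattice}"
  assumes "realizable R (range (\<lambda>Y. (Y, h Y)))" "finite F" "\<And>r. r \<in> R \<Longrightarrow> (\<And>Y. Y \<in> F \<Longrightarrow> r \<in> Y) \<Longrightarrow> r \<in> Z"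
  shows "(INF Y\<in>F. h Y) \<le> h Z"
proof (rule ccontr)
  let ?c = "inf (INF Y\<in>F. h Y) (- h Z)"
  assume "\<not> ?thesis"
  then have c: "?c \<noteq> bot" by (simp add: inf_shunt)
  have le: "?c \<le> h Y" if "Y \<in> F" for Y
    using that by (meson INF_lower le_infI1)
  have z: "inf ?c (h Z) = bot" by (simp add: inf_assoc)
  then have nz: "\<not> ?c \<le> h Z" using c by (metis inf.absorb1)
  have dec: "decides ?c (h Y)" if "Y \<in> insert Z F" for Y
    using that le z by (auto simp: decides_def)
  from assms(2) have "finite (insert Z F)" by simp
  from realizable_fun[OF assms(1) this c dec]
  obtain r where "r \<in> R" "\<forall>Y\<in>insert Z F. r \<in> Y \<longleftrightarrow> ?c \<le> h Y" by blast
  with assms(3)[of r] le nz show False by blast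
qed

text \<open>A nonzero condition disjoint from both values would be realized by a point lying neither
  in \<open>Z\<close> nor in its complement.\<close>

lemma realizable_fun_compl:
  fixes h :: "'r set \<Rightarrow> 'b::{boolean_algebra, complete_lattice}"
  assumes "realizable R (range (\<lambda>Y. (Y, h Y)))"
  shows "- h Z \<le> h (- Z)"
proof (rule ccontr)
  let ?c = "inf (- h Z) (- h (- Z))"
  assume "\<not> ?thesis"
  then have c: "?c \<noteq> bot" by (simp add: inf_shunt)
  have "?c \<le> - h Y" if "Y \<in> {Z, - Z}" for Y
    using that by (auto intro: le_infI1 le_infI2)
  then have bot: "inf ?c (h Y) = bot" if "Y \<in> {Z, - Z}" for Y
    using that by (simp add: inf_shunt)
  then have "decides ?c (h Y)" if "Y \<in> {Z, - Z}" for Y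
    using that by (auto simp: decides_def)
  from realizable_fun[OF assms _ c this, of "{Z, - Z}"]
  obtain r where r: "\<forall>Y\<in>{Z, - Z}. r \<in> Y \<longleftrightarrow> ?c \<le> h Y" by auto
  moreover have "\<not> ?c \<le> h Y" if "Y \<in> {Z, - Z}" for Y
  proof
    assume "?c \<le> h Y"
    then have "inf ?c (h Y) = ?c" by (rule inf.absorb1)
    with bot[OF that] c show False by simp
  qed
  ultimately show False by blast
qed

section \<open>Filters, distributions and refinements\<close>

lemma bool_filter_INF:
  fixes b :: "'a \<Rightarrow> 'b::{boolean_algebra, complete_lattice}"
  assumes "bool_filter U" "finite S" "\<And>k. k \<in> S \<Longrightarrow> b k \<in> U"
  shows "(INF k\<in>S. b k) \<in> U"
  using assms(2,3)
proof (induction S)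
  case empty
  then show ?case using assms(1) by (simp add: bool_filter_def)
next
  case (insert k S)
  then show ?case using assms(1) by (auto simp: bool_filter_def)
qed

text \<open>A multiplicative distribution is determined by its values at singletons, and any family
  from the filter may be prescribed there: finite meets stay in the filter and are therefore
  nonzero. The refinements below are all built like this.\<close>

lemma pointwise_distribution:
  fixes b :: "'k \<Rightarrow> 'b::{boolean_algebra, complete_lattice}"
  assumes U: "bool_filter U" and b: "\<And>k. k \<in> K \<Longrightarrow> b k \<in> U"
  shows "distribution K (\<lambda>s. INF k\<in>s. b k)" "multiplicative K (\<lambda>s. INF k\<in>s. b k)"
    "dist_in K U (\<lambda>s. INF k\<in>s. b k)"
proof -
  show dist: "dist_in K U (\<lambda>s. INF k\<in>s. b k)"
    using bool_filter_INF[OF U] b unfolding dist_in_def by blast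
  show "multiplicative K (\<lambda>s. INF k\<in>s. b k)"
    by (simp add: multiplicative_def)
  have "bot \<notin> U" using U by (simp add: bool_filter_def)
  then have "(INF k\<in>s. b k) \<noteq> bot" if "finite s" "s \<subseteq> K" for s
  proof -
    have "(INF k\<in>s. b k) \<in> U" using dist that by (simp add: dist_in_def)
    with \<open>bot \<notin> U\<close> show ?thesis by metis
  qed
  then show "distribution K (\<lambda>s. INF k\<in>s. b k)"
    by (simp add: distribution_def INF_superset_mono)
qed

lemma pattern_distributionD:
  assumes "pattern_distribution J I \<Delta> A" "finite s" "s \<subseteq> J" "c \<noteq> bot"
    and "\<And>t. t \<subseteq> s \<Longrightarrow> c \<le> A t \<or> inf c (A t) = bot"
  shows "\<exists>f. f ` s \<subseteq> I \<and> (\<forall>t\<subseteq>s. c \<le> A t \<longleftrightarrow> f ` t \<in> \<Delta>)"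
  using assms unfolding pattern_distribution_def by simp

text \<open>The same \<open>A\<close> serves for both patterns: replacing \<open>f k\<close> by the
  singleton of \<open>f k\<close> does not change the union that is tested against \<Delta>.\<close>

lemma pattern_distribution_power:
  assumes "1 \<le> n" "pattern_distribution J I \<Delta> A"
  shows "pattern_distribution J (subsets_upto n I) (pattern_power n I \<Delta>) A"
  unfolding pattern_distribution_def
proof (intro conjI allI impI)
  show "distribution J A" using assms(2) by (simp add: pattern_distribution_def)
next
  fix s c assume *: "finite s \<and> s \<subseteq> J \<and> c \<noteq> bot \<and> (\<forall>t\<subseteq>s. c \<le> A t \<or> inf c (A t) = bot)"
  then obtain f where f: "f ` s \<subseteq> I" "\<And>t. t \<subseteq> s \<Longrightarrow> c \<le> A t \<longleftrightarrow> f ` t \<in> \<Delta>"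
    using pattern_distributionD[OF assms(2), of s c] by blast
  have "(\<lambda>k. {f k}) ` t \<in> pattern_power n I \<Delta> \<longleftrightarrow> f ` t \<in> \<Delta>" if "t \<subseteq> s" for t
  proof -
    have "finite (f ` t)" "f ` t \<subseteq> I" using that f(1) * by (auto intro: finite_subset)
    from pattern_power_singletons[OF assms(1) this, of \<Delta>] show ?thesis
      by (simp add: image_image)
  qed
  moreover have "(\<lambda>k. {f k}) ` s \<subseteq> subsets_upto n I"
    using f(1) assms(1) by (auto simp: subsets_upto_def)
  ultimately show "\<exists>f'. f' ` s \<subseteq> subsets_upto n I \<and> (\<forall>t\<subseteq>s. c \<le> A t \<longleftrightarrow> f' ` t \<in> pattern_power n I \<Delta>)"
    using f(2) by (intro exI[of _ "\<lambda>k. {f k}"]) simp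
qed

lemma bool_ultrafilterD:
  assumes "bool_ultrafilter U"
  shows "bool_filter U" "bot \<notin> U" "x \<in> U \<Longrightarrow> x \<le> y \<Longrightarrow> y \<in> U" "x \<notin> U \<Longrightarrow> - x \<in> U"
  using assms unfolding bool_ultrafilter_def bool_filter_def by blast+

text \<open>On a finite \<open>K\<close> the value \<open>A K\<close> lies in the filter and below
  all other values of \<open>A\<close>, so it can be prescribed at every singleton; at the empty set
  both sides are \<open>top\<close>.\<close>

lemma unrefinable_infinite:
  assumes U: "bool_filter U" and A: "distribution K A" "dist_in K U A"
    and noref: "\<not> (\<exists>B. distribution K B \<and> multiplicative K B \<and> refines K B A \<and> dist_in K U B)"
  shows "infinite K"
proof
  assume fin: "finite K"
  then have "A K \<in> U" using A(2) by (simp add: dist_in_def)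
  then have "distribution K (\<lambda>s. INF k\<in>s. A K)" "multiplicative K (\<lambda>s. INF k\<in>s. A K)"
    "dist_in K U (\<lambda>s. INF k\<in>s. A K)"
    using pointwise_distribution[OF U, of K "\<lambda>_. A K"] by blast+
  moreover have "refines K (\<lambda>s. INF k\<in>s. A K) A"
    unfolding refines_def
  proof (intro allI impI)
    fix s assume s: "finite s \<and> s \<subseteq> K"
    show "(INF k\<in>s. A K) \<le> A s"
    proof (cases "s = {}")
      case True
      then show ?thesis using A(1) by (simp add: distribution_def)
    next
      case False
      then show ?thesis using A(1) s fin by (simp add: distribution_def)
    qed
  qed
  ultimately show False using noref by blast
qed

text \<open>
  Points of \<open>list_choices\<close> are functions into \<open>[I]\<^bsup>\<le>n\<^esup>\<close> together with an enumeration of each value;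
  the empty set admits no enumeration of length \<open>n\<close>.
\<close>

definition list_choices :: "nat \<Rightarrow> 'i set \<Rightarrow> ('k \<Rightarrow> 'i list) set" where
  "list_choices n I = {r. \<forall>k. set (r k) \<subseteq> I \<and> (r k = [] \<or> length (r k) = n)}"

section \<open>From a distribution for the power to one for the pattern itself\<close>

text \<open>The condition \<open>c\<close> decides only the sets occurring in \<open>F\<close>. It
  is shrunk to \<open>d\<close>, which decides all subsets of their union \<open>S\<close>, where
  the definition of a pattern distribution yields a map; the decisions of \<open>c\<close> are
  unchanged.\<close>

lemma realizable_pattern_power:
  assumes A: "pattern_distribution K (subsets_upto n I) (pattern_power n I \<Delta>) A"
  shows "realizable (list_choices n I)
    ((\<lambda>s. ({r. (\<Union>k\<in>s. set (r k)) \<in> \<Delta>}, A s)) ` {s. finite s \<and> s \<subseteq> K})"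
  unfolding realizable_def
proof (intro allI impI)
  let ?p = "\<lambda>s. ({r. (\<Union>k\<in>s. set (r k)) \<in> \<Delta>}, A s)"
  fix F c assume F: "finite F" "F \<subseteq> ?p ` {s. finite s \<and> s \<subseteq> K}"
    and c: "c \<noteq> bot" "\<forall>p\<in>F. decides c (snd p)"
  from finite_subset_image[OF F] obtain \<S> where
    \<S>: "\<S> \<subseteq> {s. finite s \<and> s \<subseteq> K}" "finite \<S>" "F = ?p ` \<S>" by blast
  define S where "S = \<Union>\<S>"
  have S: "finite S" "S \<subseteq> K" using \<S> by (auto simp: S_def)
  then have "finite (A ` Pow S)" by simp
  then obtain d where d: "d \<noteq> bot" "d \<le> c" "\<And>b. b \<in> A ` Pow S \<Longrightarrow> decides d b"
    using ex_decides[OF c(1)] by metis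
  then have "\<forall>t\<subseteq>S. d \<le> A t \<or> inf d (A t) = bot" by (auto simp: decides_def)
  then obtain f where f: "f ` S \<subseteq> subsets_upto n I"
    "\<And>t. t \<subseteq> S \<Longrightarrow> d \<le> A t \<longleftrightarrow> f ` t \<in> pattern_power n I \<Delta>"
    using pattern_distributionD[OF A S d(1)] by blast
  have "\<exists>xs. set xs = f k \<and> (xs = [] \<or> length xs = n)" if "k \<in> S" for k
  proof (cases "f k = {}")
    case False
    have "f k \<in> subsets_upto n I" by (rule subsetD[OF f(1) imageI[OF that]])
    then have "finite (f k)" "card (f k) \<le> n" by (simp_all add: subsets_upto_def)
    with False obtain xs where "set xs = f k" "length xs = n" by (elim list_of_finite_set)
    then show ?thesis by blast
  qed simp
  then obtain r0 where r0: "\<And>k. k \<in> S \<Longrightarrow> set (r0 k) = f k \<and> (r0 k = [] \<or> length (r0 k) = n)"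
    by metis
  \<comment> \<open>Outside \<open>S\<close> the empty list is an admissible default.\<close>
  define r where "r k = (if k \<in> S then r0 k else [])" for k
  have r: "set (r k) = f k" if "k \<in> S" for k using r0[OF that] that by (simp add: r_def)
  have "r \<in> list_choices n I"
    using r0 f(1) by (auto simp: list_choices_def r_def subsets_upto_def)
  moreover have "(\<Union>k\<in>s. set (r k)) \<in> \<Delta> \<longleftrightarrow> c \<le> A s" if s: "s \<in> \<S>" for s
  proof -
    have sS: "s \<subseteq> S" using s by (auto simp: S_def)
    then have "(\<Union>k\<in>s. set (r k)) = \<Union>(f ` s)" using r by (simp add: subset_iff)
    moreover have "finite (f ` s)" "f ` s \<subseteq> subsets_upto n I"
      using sS S(1) f(1) by (auto intro: finite_subset)
    ultimately have "(\<Union>k\<in>s. set (r k)) \<in> \<Delta> \<longleftrightarrow> d \<le> A s"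
      using f(2)[OF sS] by (simp add: pattern_power_def)
    moreover have "decides c (A s)" using c(2) s \<S>(3) by force
    ultimately show ?thesis using decides_le_iff[of c "A s" d] d by blast
  qed
  ultimately show "\<exists>r\<in>list_choices n I. \<forall>p\<in>F. r \<in> fst p \<longleftrightarrow> c \<le> snd p"
    using \<S>(3) by (intro bexI[of _ r]) auto
qed

text \<open>For a set s of indices let T be the product of the part of s in \<open>J\<close> with n.
  At points of \<open>list_choices\<close> whose values on s are nonempty exactly on
  \<open>J\<close>, the events \<open>X s\<close> and \<open>Y T\<close> coincide, as the elements
  named by T form the union over s. One inclusion of this kind puts the new distribution into
  \<open>U\<close>, the other carries a multiplicative refinement back to \<open>A\<close>.\<close>

lemma unrefinable_power_imp:
  fixes U :: "'b::{boolean_algebra, complete_lattice} set" and I :: "'i set" and K :: "'k set"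
  assumes U: "bool_ultrafilter U" and pat: "pattern I \<Delta>" and n: "1 \<le> n"
    and A: "pattern_distribution K (subsets_upto n I) (pattern_power n I \<Delta>) A" "dist_in K U A"
    and noref: "\<not> (\<exists>B. distribution K B \<and> multiplicative K B \<and> refines K B A \<and> dist_in K U B)"
  shows "\<exists>A. pattern_distribution K I \<Delta> A \<and> dist_in K U A \<and>
    \<not> (\<exists>B. distribution K B \<and> multiplicative K B \<and> refines K B A \<and> dist_in K U B)"
proof -
  note fU = bool_ultrafilterD(1)[OF U] and botU = bool_ultrafilterD(2)[OF U]
    and upU = bool_ultrafilterD(3)[OF U] and complU = bool_ultrafilterD(4)[OF U]
  have distA: "distribution K A" using A(1) by (simp add: pattern_distribution_def)
  have infK: "infinite K" by (rule unrefinable_infinite[OF fU distA A(2) noref])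
  have sub: "s \<in> \<Delta>" if "t \<in> \<Delta>" "s \<subseteq> t" for s t
    using pat that by (auto simp: pattern_def)
  let ?R = "list_choices n I :: ('k \<Rightarrow> 'i list) set"
  define X where "X s = {r :: 'k \<Rightarrow> 'i list. (\<Union>k\<in>s. set (r k)) \<in> \<Delta>}" for s
  define E where "E k = {r :: 'k \<Rightarrow> 'i list. r k = []}" for k
  obtain h where hG: "\<And>Y b. (Y, b) \<in> (\<lambda>s. (X s, A s)) ` {s. finite s \<and> s \<subseteq> K} \<Longrightarrow> h Y = b"
    and h: "realizable ?R (range (\<lambda>Y. (Y, h Y)))"
    using realizable_extension[OF realizable_pattern_power[OF A(1), folded X_def]] by blast
  have hX: "h (X s) = A s" if "finite s" "s \<subseteq> K" for s
    using hG[of "X s" "A s"] that by blast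
  \<comment> \<open>A pattern may be empty as a set; the value \<open>top\<close> of
    \<open>A\<close> at the empty set excludes this here.\<close>
  have empty: "{} \<in> \<Delta>"
  proof -
    have "top \<noteq> (bot :: 'b)" using fU by (auto simp: bool_filter_def)
    moreover have "A {} = top" using distA by (simp add: distribution_def)
    ultimately have "\<exists>f. f ` {} \<subseteq> subsets_upto n I \<and>
        (\<forall>t\<subseteq>{}. top \<le> A t \<longleftrightarrow> f ` t \<in> pattern_power n I \<Delta>)"
      by (intro pattern_distributionD[OF A(1)]) auto
    then show ?thesis using \<open>A {} = top\<close> by (auto simp: pattern_power_def)
  qed
  define J where "J = {k \<in> K. h (- E k) \<in> U}"
  have J_E: "h (- E k) \<in> U" if "k \<in> J" for k using that by (simp add: J_def)
  \<comment> \<open>The ultrafilter contains the complement of \<open>h (- E k)\<close>, which lies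
    below \<open>h (E k)\<close>.\<close>
  have nJ_E: "h (E k) \<in> U" if "k \<in> K" "k \<notin> J" for k
    using realizable_fun_compl[OF h, of "- E k"] complU[of "h (- E k)"] upU that by (auto simp: J_def)
  have refine: "\<exists>B. distribution K B \<and> multiplicative K B \<and> refines K B A \<and> dist_in K U B"
    if b: "\<And>k. k \<in> K \<Longrightarrow> b k \<in> U" and bA: "\<And>s. finite s \<Longrightarrow> s \<subseteq> K \<Longrightarrow> (INF k\<in>s. b k) \<le> A s" for b
  proof (intro exI conjI)
    show "distribution K (\<lambda>s. INF k\<in>s. b k)" "multiplicative K (\<lambda>s. INF k\<in>s. b k)"
      "dist_in K U (\<lambda>s. INF k\<in>s. b k)"
      by (rule pointwise_distribution[OF fU], rule b, assumption)+
    show "refines K (\<lambda>s. INF k\<in>s. b k) A" using bA by (simp add: refines_def)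
  qed
  \<comment> \<open>If \<open>U\<close> considered every value empty, the family
    \<open>h (E k)\<close> would refine \<open>A\<close>, because a union of empty sets is in
    \<Delta>.\<close>
  have Jne: "J \<noteq> {}"
  proof
    assume "J = {}"
    have "(INF k\<in>s. h (E k)) \<le> A s" if "finite s" "s \<subseteq> K" for s
    proof -
      have "(INF Z\<in>E ` s. h Z) \<le> h (X s)"
      proof (rule realizable_fun_le[OF h])
        fix r assume r: "\<And>Z. Z \<in> E ` s \<Longrightarrow> r \<in> Z"
        have "r k = []" if "k \<in> s" for k
          using r[OF imageI[OF that]] by (simp add: E_def)
        then have "(\<Union>k\<in>s. set (r k)) = {}" by simp
        then show "r \<in> X s" by (simp only: X_def mem_Collect_eq empty)
      qed (use that in simp)
      then show ?thesis by (simp only: image_image hX[OF that])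
    qed
    with nJ_E \<open>J = {}\<close> have "\<exists>B. distribution K B \<and> multiplicative K B \<and> refines K B A \<and> dist_in K U B"
      by (intro refine[of "\<lambda>k. h (E k)"]) auto
    with noref show False ..
  qed
  obtain i0 where i0: "i0 \<in> I"
  proof -
    obtain k where "k \<in> J" using Jne by blast
    then have "h (- E k) \<noteq> bot" using J_E botU by metis
    from realizable_fun[OF h _ this, of "{- E k}"] obtain r where "r \<in> ?R" "r \<in> - E k"
      by (auto simp: decides_def)
    then have "set (r k) \<noteq> {}" "set (r k) \<subseteq> I" by (auto simp: E_def list_choices_def)
    then obtain i where "i \<in> I" by (meson ex_in_conv subsetD)
    then show thesis by (rule that)
  qed
  \<comment> \<open>\<open>g r (k, l)\<close> is the \<open>l\<close>-th element of the value at
    \<open>k\<close>, with \<open>i0\<close> as default when that value is empty.\<close>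
  define g where "g r x = (if r (fst x) = [] then i0 else r (fst x) ! snd x)"
    for r :: "'k \<Rightarrow> 'i list" and x :: "'k \<times> nat"
  have gI: "g r x \<in> I" if "r \<in> ?R" "snd x < n" for r x
  proof (cases "r (fst x) = []")
    case False
    then have "r (fst x) ! snd x \<in> set (r (fst x))" "set (r (fst x)) \<subseteq> I"
      using that by (auto simp: list_choices_def)
    with False show ?thesis by (simp add: g_def subset_iff)
  qed (simp add: g_def i0)
  have g_set: "set (r k) = (\<lambda>l. g r (k, l)) ` {..<n}" if "r \<in> ?R" "r \<notin> E k" for r k
    using that by (auto simp: g_def list_choices_def E_def set_conv_nth)
  define Y where "Y t = {r. g r ` t \<in> \<Delta>}" for t
  \<comment> \<open>The new distribution must again live on \<open>K\<close>, so the product is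
    reindexed by a surjection from the infinite set \<open>K\<close>; repeated names do no
    harm.\<close>
  have "|UNIV :: nat set| \<le>o |K|" using infK by (simp add: infinite_iff_card_of_nat)
  then have "|{..<n}| \<le>o |K|" by (rule ordLeq_transitive[OF card_of_mono1[OF subset_UNIV]])
  moreover have "|J| \<le>o |K|" by (rule card_of_mono1) (auto simp: J_def)
  ultimately have "|J \<times> {..<n}| \<le>o |K|" using infK by (intro card_of_Sigma_ordLeq_infinite) auto
  moreover have "J \<times> {..<n} \<noteq> {}" using Jne n by (auto simp: lessThan_empty_iff)
  ultimately have "\<exists>q. q ` K = J \<times> {..<n}" using card_of_ordLeq2[of "J \<times> {..<n}" K] by simp
  then obtain q where q: "q ` K = J \<times> {..<n}" by blast
  have qK: "fst (q k) \<in> J \<and> snd (q k) < n" if "k \<in> K" for k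
    using imageI[OF that, of q] unfolding q by (auto simp: mem_Times_iff)
  define A' where "A' t = h (Y (q ` t))" for t
  have inU: "dist_in K U A'"
    unfolding dist_in_def
  proof (intro allI impI)
    fix s assume s: "finite s \<and> s \<subseteq> K"
    define P where "P = fst ` q ` s"
    have P: "finite P" "P \<subseteq> J" using s qK by (auto simp: P_def)
    then have PK: "P \<subseteq> K" by (auto simp: J_def)
    let ?F = "insert (X P) ((\<lambda>k. - E k) ` P)"
    \<comment> \<open>If all values over \<open>P\<close> are nonempty, the elements named by
      \<open>s\<close> belong to the union over \<open>P\<close>. As \<open>P\<close> lies in
      \<open>J\<close>, the nonemptiness events have values in \<open>U\<close>.\<close>
    have "(INF Z\<in>?F. h Z) \<le> A' s"
      unfolding A'_def
    proof (rule realizable_fun_le[OF h])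
      fix r assume r: "r \<in> ?R" "\<And>Z. Z \<in> ?F \<Longrightarrow> r \<in> Z"
      have "g r ` q ` s \<subseteq> (\<Union>k\<in>P. set (r k))"
      proof
        fix i assume "i \<in> g r ` q ` s"
        then obtain x where x: "x \<in> q ` s" "i = g r x" by blast
        then have "fst x \<in> P" "snd x < n" using qK s by (auto simp: P_def)
        moreover have "r \<notin> E (fst x)" using r(2) \<open>fst x \<in> P\<close> by blast
        moreover have "i = g r (fst x, snd x)" using x(2) by simp
        ultimately have "i \<in> set (r (fst x))" using g_set[OF r(1), of "fst x"] by blast
        with \<open>fst x \<in> P\<close> show "i \<in> (\<Union>k\<in>P. set (r k))" by blast
      qed
      moreover have "(\<Union>k\<in>P. set (r k)) \<in> \<Delta>" using r(2) by (auto simp: X_def)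
      ultimately show "r \<in> Y (q ` s)" using sub by (auto simp: Y_def)
    qed (use P in simp)
    moreover have "(INF Z\<in>?F. h Z) \<in> U"
    proof (rule bool_filter_INF[OF fU])
      have "A P \<in> U" using A(2) P(1) PK by (simp add: dist_in_def)
      then show "h Z \<in> U" if "Z \<in> ?F" for Z using that hX P(1) PK J_E P(2) by auto
    qed (use P in simp)
    ultimately show "A' s \<in> U" by (rule upU[rotated])
  qed
  have "distribution K A'"
    unfolding distribution_def
  proof (intro conjI allI impI)
    have "Inf (h ` {}) \<le> A' {}"
      unfolding A'_def by (rule realizable_fun_le[OF h]) (simp_all add: Y_def empty)
    then show "A' {} = top" by (simp add: top_unique)
    show "A' s \<noteq> bot" if "finite s \<and> s \<subseteq> K" for s
      using inU that botU unfolding dist_in_def by metis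
    show "A' t \<le> A' s" if "finite t \<and> t \<subseteq> K \<and> s \<subseteq> t" for s t
    proof -
      have "(INF Z\<in>{Y (q ` t)}. h Z) \<le> h (Y (q ` s))"
      proof (rule realizable_fun_le[OF h])
        fix r assume "\<And>Z. Z \<in> {Y (q ` t)} \<Longrightarrow> r \<in> Z"
        then have "g r ` q ` t \<in> \<Delta>" by (simp add: Y_def)
        moreover have "g r ` q ` s \<subseteq> g r ` q ` t" using that by blast
        ultimately show "r \<in> Y (q ` s)" using sub by (simp add: Y_def)
      qed simp
      then show ?thesis by (simp add: A'_def)
    qed
  qed
  then have "pattern_distribution K I \<Delta> A'"
    unfolding pattern_distribution_def
  proof (intro conjI allI impI)
    fix s c assume s: "finite s \<and> s \<subseteq> K \<and> c \<noteq> bot \<and> (\<forall>t\<subseteq>s. c \<le> A' t \<or> inf c (A' t) = bot)"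
    then have "finite ((\<lambda>t. Y (q ` t)) ` Pow s)" "c \<noteq> bot" by simp_all
    moreover have "decides c (h Z)" if "Z \<in> (\<lambda>t. Y (q ` t)) ` Pow s" for Z
      using that s by (auto simp: decides_def A'_def)
    \<comment> \<open>A single point realizing the finitely many decided events supplies the map
      required of a pattern distribution.\<close>
    ultimately obtain r where r: "r \<in> ?R" "\<forall>Z\<in>(\<lambda>t. Y (q ` t)) ` Pow s. r \<in> Z \<longleftrightarrow> c \<le> h Z"
      using realizable_fun[OF h] by blast
    have "(\<lambda>k. g r (q k)) ` s \<subseteq> I"
      using gI[OF r(1)] qK s by (intro image_subsetI) blast
    moreover have "c \<le> A' t \<longleftrightarrow> (\<lambda>k. g r (q k)) ` t \<in> \<Delta>" if "t \<subseteq> s" for t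
      using r(2) that by (simp add: A'_def Y_def image_image)
    ultimately show "\<exists>f. f ` s \<subseteq> I \<and> (\<forall>t\<subseteq>s. c \<le> A' t \<longleftrightarrow> f ` t \<in> \<Delta>)"
      by (intro exI[of _ "\<lambda>k. g r (q k)"]) simp
  qed
  moreover have "\<not> (\<exists>B. distribution K B \<and> multiplicative K B \<and> refines K B A' \<and> dist_in K U B)"
  proof
    assume "\<exists>B. distribution K B \<and> multiplicative K B \<and> refines K B A' \<and> dist_in K U B"
    then obtain B where B: "multiplicative K B" "refines K B A'" "dist_in K U B" by blast
    have "\<exists>k. k \<in> K \<and> q k = x" if "x \<in> J \<times> {..<n}" for x
      using that unfolding q[symmetric] by blast
    then obtain \<sigma> where \<sigma>: "\<And>x. x \<in> J \<times> {..<n} \<Longrightarrow> \<sigma> x \<in> K \<and> q (\<sigma> x) = x" by metis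
    \<comment> \<open>For \<open>k\<close> in \<open>J\<close> the value at \<open>k\<close> is
      required to be nonempty, and \<open>B\<close> is used at all n names of its elements;
      elsewhere the value is required to be empty.\<close>
    define b where "b k = (if k \<in> J then inf (h (- E k)) (INF l\<in>{..<n}. B {\<sigma> (k, l)}) else h (E k))" for k
    have "b k \<in> U" if "k \<in> K" for k
    proof (cases "k \<in> J")
      case True
      have "(INF l\<in>{..<n}. B {\<sigma> (k, l)}) \<in> U"
        by (rule bool_filter_INF[OF fU]) (use B(3) \<sigma> True in \<open>auto simp: dist_in_def\<close>)
      with True J_E fU show ?thesis by (simp add: b_def bool_filter_def)
    next
      case False
      then show ?thesis using nJ_E that by (simp add: b_def)
    qed
    moreover have "(INF k\<in>s. b k) \<le> A s" if s: "finite s" "s \<subseteq> K" for s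
    proof -
      define T where "T = (s \<inter> J) \<times> {..<n}"
      let ?F = "insert (Y T) ((\<lambda>k. - E k) ` (s \<inter> J) \<union> E ` (s - J))"
      have \<sigma>T: "finite (\<sigma> ` T)" "\<sigma> ` T \<subseteq> K" "q ` \<sigma> ` T = T"
        using s \<sigma> by (force simp: T_def image_image)+
      have "(INF k\<in>s. b k) \<le> (INF Z\<in>?F. h Z)"
      proof (rule INF_greatest)
        fix Z assume "Z \<in> ?F"
        then consider "Z = Y T" | k where "k \<in> s \<inter> J" "Z = - E k" | k where "k \<in> s - J" "Z = E k" by blast
        then show "(INF k\<in>s. b k) \<le> h Z"
        proof cases
          case 1
          have "(INF k\<in>s. b k) \<le> (INF y\<in>\<sigma> ` T. B {y})"
          proof (rule INF_greatest)
            fix y assume "y \<in> \<sigma> ` T"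
            then obtain k l where kl: "k \<in> s" "k \<in> J" "l < n" "y = \<sigma> (k, l)" by (auto simp: T_def)
            have "(INF k\<in>s. b k) \<le> b k" using kl(1) by (rule INF_lower)
            also have "\<dots> \<le> (INF l\<in>{..<n}. B {\<sigma> (k, l)})" using kl(2) by (simp add: b_def)
            also have "\<dots> \<le> B {y}" using kl by (auto intro: INF_lower)
            finally show "(INF k\<in>s. b k) \<le> B {y}" .
          qed
          also have "\<dots> = B (\<sigma> ` T)" using B(1) \<sigma>T by (simp add: multiplicative_def)
          also have "\<dots> \<le> A' (\<sigma> ` T)" using B(2) \<sigma>T by (simp add: refines_def)
          also have "\<dots> = h Z" using \<sigma>T 1 by (simp add: A'_def)
          finally show ?thesis .
        next
          case 2
          have "(INF k\<in>s. b k) \<le> b k" using 2 by (intro INF_lower) simp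
          also have "\<dots> \<le> h Z" using 2 by (simp add: b_def)
          finally show ?thesis .
        next
          case 3
          have "(INF k\<in>s. b k) \<le> b k" using 3 by (intro INF_lower) simp
          also have "\<dots> \<le> h Z" using 3 by (simp add: b_def)
          finally show ?thesis .
        qed
      qed
      also have "\<dots> \<le> h (X s)"
      proof (rule realizable_fun_le[OF h])
        fix r assume r: "r \<in> ?R" "\<And>Z. Z \<in> ?F \<Longrightarrow> r \<in> Z"
        have "set (r k) \<subseteq> g r ` T" if "k \<in> s" for k
        proof (cases "k \<in> J")
          case True
          then have "r \<notin> E k" using r(2) that by blast
          then show ?thesis using g_set[OF r(1)] True that by (auto simp: T_def)
        next
          case False
          then have "r \<in> E k" using r(2) that by blast
          then show ?thesis by (simp add: E_def)
        qed
        then have "(\<Union>k\<in>s. set (r k)) \<subseteq> g r ` T" by (rule UN_least)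
        moreover have "g r ` T \<in> \<Delta>" using r(2)[of "Y T"] by (simp add: Y_def)
        ultimately have "(\<Union>k\<in>s. set (r k)) \<in> \<Delta>" by (rule sub[rotated])
        then show "r \<in> X s" by (simp add: X_def)
      qed (use s in simp)
      also have "\<dots> = A s" using s by (rule hX)
      finally show ?thesis .
    qed
    ultimately show False using refine noref by blast
  qed
  ultimately show ?thesis using inU by blast
qed

text \<open>The two properties of \<open>J\<close> whose least cardinals are compared hold for the
  same sets \<open>J\<close>.\<close>

lemma lambda_ultrafilter_power:
  assumes "bool_ultrafilter U" "pattern I \<Delta>" "1 \<le> n"
  shows "(lambda_ultrafilter U I \<Delta> :: 'k set set)
    = lambda_ultrafilter U (subsets_upto n I) (pattern_power n I \<Delta>)"
proof -
  have "(\<exists>A. pattern_distribution J I \<Delta> A \<and> dist_in J U A \<and>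
      \<not> (\<exists>B. distribution J B \<and> multiplicative J B \<and> refines J B A \<and> dist_in J U B)) \<longleftrightarrow>
    (\<exists>A. pattern_distribution J (subsets_upto n I) (pattern_power n I \<Delta>) A \<and> dist_in J U A \<and>
      \<not> (\<exists>B. distribution J B \<and> multiplicative J B \<and> refines J B A \<and> dist_in J U B))"
    for J :: "'k set"
    using pattern_distribution_power[OF assms(3)] unrefinable_power_imp[OF assms] by blast
  then show ?thesis unfolding lambda_ultrafilter_def by presburger
qed

section \<open>Models of set theory\<close>

type_synonym set_fm = "(unit, unit) fm"

text \<open>Elementarity and the two axiom schemas speak about formulas, so each relativised notion
  gets a syntactic copy whose satisfaction is equivalent to it by simplification.\<close>

definition fMem :: "nat \<Rightarrow> nat \<Rightarrow> set_fm" where "fMem x y = Rel () [Var x, Var y]"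
definition fEq :: "nat \<Rightarrow> nat \<Rightarrow> set_fm" where "fEq x y = Equal (Var x) (Var y)"
definition fImp :: "set_fm \<Rightarrow> set_fm \<Rightarrow> set_fm" where "fImp \<phi> \<psi> = Neg (Conj \<phi> (Neg \<psi>))"
definition fDisj :: "set_fm \<Rightarrow> set_fm \<Rightarrow> set_fm" where "fDisj \<phi> \<psi> = Neg (Conj (Neg \<phi>) (Neg \<psi>))"
definition fIff :: "set_fm \<Rightarrow> set_fm \<Rightarrow> set_fm" where "fIff \<phi> \<psi> = Conj (fImp \<phi> \<psi>) (fImp \<psi> \<phi>)"
definition fAll :: "nat \<Rightarrow> set_fm \<Rightarrow> set_fm" where "fAll k \<phi> = Neg (Exi k (Neg \<phi>))"
definition fAllIn :: "nat \<Rightarrow> nat \<Rightarrow> set_fm \<Rightarrow> set_fm" where "fAllIn k x \<phi> = fAll k (fImp (fMem k x) \<phi>)"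
definition fExIn :: "nat \<Rightarrow> nat \<Rightarrow> set_fm \<Rightarrow> set_fm" where "fExIn k x \<phi> = Exi k (Conj (fMem k x) \<phi>)"

lemma wf_set_fm [simp]:
  "wf_fm set_language (fMem x y)"
  "wf_fm set_language (fEq x y)"
  "wf_fm set_language (fImp \<phi> \<psi>) \<longleftrightarrow> wf_fm set_language \<phi> \<and> wf_fm set_language \<psi>"
  "wf_fm set_language (fDisj \<phi> \<psi>) \<longleftrightarrow> wf_fm set_language \<phi> \<and> wf_fm set_language \<psi>"
  "wf_fm set_language (fIff \<phi> \<psi>) \<longleftrightarrow> wf_fm set_language \<phi> \<and> wf_fm set_language \<psi>"
  "wf_fm set_language (fAll k \<phi>) \<longleftrightarrow> wf_fm set_language \<phi>"
  "wf_fm set_language (fAllIn k x \<phi>) \<longleftrightarrow> wf_fm set_language \<phi>"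
  "wf_fm set_language (fExIn k x \<phi>) \<longleftrightarrow> wf_fm set_language \<phi>"
  by (auto simp: fMem_def fEq_def fImp_def fDisj_def fIff_def fAll_def fAllIn_def fExIn_def set_language_def)

lemma carrier_set_struct [simp]: "carrier (set_struct V E) = V"
  by (simp add: set_struct_def)

lemma sat_set_fm [simp]:
  "sat (set_struct V E) e (fMem x y) \<longleftrightarrow> E (e x) (e y)"
  "sat (set_struct V E) e (fEq x y) \<longleftrightarrow> e x = e y"
  "sat (set_struct V E) e (fImp \<phi> \<psi>) \<longleftrightarrow> (sat (set_struct V E) e \<phi> \<longrightarrow> sat (set_struct V E) e \<psi>)"
  "sat (set_struct V E) e (fDisj \<phi> \<psi>) \<longleftrightarrow> sat (set_struct V E) e \<phi> \<or> sat (set_struct V E) e \<psi>"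
  "sat (set_struct V E) e (fIff \<phi> \<psi>) \<longleftrightarrow> (sat (set_struct V E) e \<phi> \<longleftrightarrow> sat (set_struct V E) e \<psi>)"
  "sat (set_struct V E) e (fAll k \<phi>) \<longleftrightarrow> (\<forall>a\<in>V. sat (set_struct V E) (e(k := a)) \<phi>)"
  "sat (set_struct V E) e (fAllIn k x \<phi>) \<longleftrightarrow>
    (\<forall>a\<in>V. E a ((e(k := a)) x) \<longrightarrow> sat (set_struct V E) (e(k := a)) \<phi>)"
  "sat (set_struct V E) e (fExIn k x \<phi>) \<longleftrightarrow>
    (\<exists>a\<in>V. E a ((e(k := a)) x) \<and> sat (set_struct V E) (e(k := a)) \<phi>)"
  by (auto simp: fMem_def fEq_def fImp_def fDisj_def fIff_def fAll_def fAllIn_def fExIn_def set_struct_def)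

text \<open>
  Bound variables are chosen to exceed the sum of the arguments, so they differ from each of them.
\<close>

definition fSub :: "nat \<Rightarrow> nat \<Rightarrow> set_fm" where
  "fSub x y = fAllIn (Suc (x + y)) x (fMem (Suc (x + y)) y)"

lemma wf_fSub [simp]: "wf_fm set_language (fSub x y)" by (simp add: fSub_def)

lemma sat_fSub [simp]: "sat (set_struct V E) e (fSub x y) \<longleftrightarrow> is_sub V E (e x) (e y)"
  by (simp add: fSub_def is_sub_def)

definition fUpair :: "nat \<Rightarrow> nat \<Rightarrow> nat \<Rightarrow> set_fm" where
  "fUpair z x y = (let u = Suc (z + x + y) in fAll u (fIff (fMem u z) (fDisj (fEq u x) (fEq u y))))"

lemma wf_fUpair [simp]: "wf_fm set_language (fUpair z x y)" by (simp add: fUpair_def Let_def)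

lemma sat_fUpair [simp]: "sat (set_struct V E) e (fUpair z x y) \<longleftrightarrow> is_upair V E (e z) (e x) (e y)"
  by (simp add: fUpair_def is_upair_def Let_def)

definition fOpair :: "nat \<Rightarrow> nat \<Rightarrow> nat \<Rightarrow> set_fm" where
  "fOpair p x y = (let u = Suc (p + x + y); w = Suc u in
     Exi u (Exi w (Conj (fUpair u x x) (Conj (fUpair w x y) (fUpair p u w)))))"

lemma wf_fOpair [simp]: "wf_fm set_language (fOpair p x y)" by (simp add: fOpair_def Let_def)

lemma sat_fOpair [simp]: "sat (set_struct V E) e (fOpair p x y) \<longleftrightarrow> is_opair V E (e p) (e x) (e y)"
  by (simp add: fOpair_def is_opair_def Let_def)

definition fPairIn :: "nat \<Rightarrow> nat \<Rightarrow> nat \<Rightarrow> set_fm" where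
  "fPairIn r x y = (let p = Suc (r + x + y) in Exi p (Conj (fOpair p x y) (fMem p r)))"

lemma wf_fPairIn [simp]: "wf_fm set_language (fPairIn r x y)" by (simp add: fPairIn_def Let_def)

lemma sat_fPairIn [simp]: "sat (set_struct V E) e (fPairIn r x y) \<longleftrightarrow> pair_in V E (e r) (e x) (e y)"
  by (simp add: fPairIn_def pair_in_def Let_def)

definition is_insert :: "'v set \<Rightarrow> ('v \<Rightarrow> 'v \<Rightarrow> bool) \<Rightarrow> 'v \<Rightarrow> 'v \<Rightarrow> 'v \<Rightarrow> bool" where
  "is_insert V E y x a \<longleftrightarrow> (\<forall>u\<in>V. E u y \<longleftrightarrow> E u x \<or> u = a)"

definition fInsert :: "nat \<Rightarrow> nat \<Rightarrow> nat \<Rightarrow> set_fm" where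
  "fInsert y x a = (let u = Suc (y + x + a) in fAll u (fIff (fMem u y) (fDisj (fMem u x) (fEq u a))))"

lemma wf_fInsert [simp]: "wf_fm set_language (fInsert y x a)" by (simp add: fInsert_def Let_def)

lemma sat_fInsert [simp]: "sat (set_struct V E) e (fInsert y x a) \<longleftrightarrow> is_insert V E (e y) (e x) (e a)"
  by (simp add: fInsert_def is_insert_def Let_def)

lemma is_succ_eq_insert: "is_succ V E z x \<longleftrightarrow> is_insert V E z x x"
  by (simp add: is_succ_def is_insert_def)

definition fEmpty :: "nat \<Rightarrow> set_fm" where
  "fEmpty z = fAll (Suc z) (Neg (fMem (Suc z) z))"

lemma wf_fEmpty [simp]: "wf_fm set_language (fEmpty z)" by (simp add: fEmpty_def)

lemma sat_fEmpty [simp]: "sat (set_struct V E) e (fEmpty z) \<longleftrightarrow> (\<forall>u\<in>V. \<not> E u (e z))"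
  by (simp add: fEmpty_def)

definition fInductive :: "nat \<Rightarrow> set_fm" where
  "fInductive w = (let x = Suc w; z = Suc x in
     Conj (Exi x (Conj (fEmpty x) (fMem x w))) (fAllIn x w (Exi z (Conj (fInsert z x x) (fMem z w)))))"

lemma wf_fInductive [simp]: "wf_fm set_language (fInductive w)" by (simp add: fInductive_def Let_def)

lemma sat_fInductive [simp]: "sat (set_struct V E) e (fInductive w) \<longleftrightarrow> is_inductive V E (e w)"
  by (simp add: fInductive_def is_inductive_def is_succ_eq_insert Let_def)

definition fOmega :: "nat \<Rightarrow> set_fm" where
  "fOmega w = Conj (fInductive w) (fAll (Suc w) (fImp (fInductive (Suc w)) (fSub w (Suc w))))"

lemma wf_fOmega [simp]: "wf_fm set_language (fOmega w)" by (simp add: fOmega_def)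

lemma sat_fOmega [simp]: "sat (set_struct V E) e (fOmega w) \<longleftrightarrow> is_omega V E (e w)"
  by (simp add: fOmega_def is_omega_def)

definition fUnique :: "nat \<Rightarrow> nat \<Rightarrow> nat \<Rightarrow> (nat \<Rightarrow> set_fm) \<Rightarrow> set_fm" where
  "fUnique y y' b \<phi> = fExIn y b (Conj (\<phi> y) (fAllIn y' b (fImp (\<phi> y') (fEq y' y))))"

definition fBijection :: "nat \<Rightarrow> nat \<Rightarrow> nat \<Rightarrow> set_fm" where
  "fBijection f a b = (let p = Suc (f + a + b); x = Suc p; y = Suc x; z = Suc y in
     Conj (fAllIn p f (fExIn x a (fExIn y b (fOpair p x y))))
       (Conj (fAllIn x a (fUnique y z b (\<lambda>y. fPairIn f x y)))
         (fAllIn y b (fUnique x z a (\<lambda>x. fPairIn f x y)))))"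

lemma wf_fBijection [simp]: "wf_fm set_language (fBijection f a b)"
  by (simp add: fBijection_def fUnique_def Let_def)

text \<open>Unique existence and the quantifiers over pairs are brought into the nested bounded form
  of \<open>fBijection\<close>.\<close>

lemma is_bijection_iff:
  "is_bijection V E f a b \<longleftrightarrow>
     (\<forall>p\<in>V. E p f \<longrightarrow> (\<exists>x\<in>V. E x a \<and> (\<exists>y\<in>V. E y b \<and> is_opair V E p x y))) \<and>
     (\<forall>x\<in>V. E x a \<longrightarrow>
        (\<exists>y\<in>V. E y b \<and> pair_in V E f x y \<and> (\<forall>z\<in>V. E z b \<longrightarrow> pair_in V E f x z \<longrightarrow> z = y))) \<and>
     (\<forall>y\<in>V. E y b \<longrightarrow>
        (\<exists>x\<in>V. E x a \<and> pair_in V E f x y \<and> (\<forall>z\<in>V. E z a \<longrightarrow> pair_in V E f z y \<longrightarrow> z = x)))"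
proof -
  have unique: "(\<exists>!y. y \<in> V \<and> Q y \<and> P y) \<longleftrightarrow> (\<exists>y\<in>V. Q y \<and> P y \<and> (\<forall>z\<in>V. Q z \<longrightarrow> P z \<longrightarrow> z = y))"
    for Q P :: "'a \<Rightarrow> bool"
    by (simp add: Ex1_def Bex_def Ball_def conj_assoc) (simp only: imp_conjL)
  have split: "(\<exists>x\<in>V. \<exists>y\<in>V. E x a \<and> E y b \<and> P x y) \<longleftrightarrow> (\<exists>x\<in>V. E x a \<and> (\<exists>y\<in>V. E y b \<and> P x y))"
    for P by blast
  show ?thesis unfolding is_bijection_def unique split ..
qed

lemma sat_fBijection [simp]:
  "sat (set_struct V E) e (fBijection f a b) \<longleftrightarrow> is_bijection V E (e f) (e a) (e b)"
  unfolding is_bijection_iff by (simp add: fBijection_def fUnique_def Let_def)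

definition fFinite :: "nat \<Rightarrow> set_fm" where
  "fFinite x = (let w = Suc x; k = Suc w; f = Suc k in
     Exi w (Conj (fOmega w) (fExIn k w (Exi f (fBijection f k x)))))"

lemma wf_fFinite [simp]: "wf_fm set_language (fFinite x)" by (simp add: fFinite_def Let_def)

lemma sat_fFinite [simp]: "sat (set_struct V E) e (fFinite x) \<longleftrightarrow> is_finite V E (e x)"
  by (simp add: fFinite_def is_finite_def Let_def)

section \<open>Finiteness in a transitive model\<close>

locale transitive_model =
  fixes mem :: "'v \<Rightarrow> 'v \<Rightarrow> bool" and V :: "'v set"
  assumes membership: "membership mem" and transitive: "transitive_in mem V" and ZFC: "ZFC_minus V mem"
begin

text \<open>By transitivity all members of an element of \<open>V\<close> lie in \<open>V\<close>,
  so relativised statements become statements about these actual sets.\<close>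

definition elts :: "'v \<Rightarrow> 'v set" where "elts x = {u. mem u x}"

lemma elts_iff [simp]: "u \<in> elts x \<longleftrightarrow> mem u x"
  by (simp add: elts_def)

lemma mem_V: "mem u x \<Longrightarrow> x \<in> V \<Longrightarrow> u \<in> V"
  using transitive by (simp add: transitive_in_def)

lemma elts_subset_V: "x \<in> V \<Longrightarrow> elts x \<subseteq> V"
  using mem_V by auto

lemma elts_inject: "elts x = elts y \<Longrightarrow> x = y"
  using membership by (auto simp: membership_def elts_def set_eq_iff)

lemma inj_elts: "inj elts"
  by (rule injI) (rule elts_inject)

lemma wfP_mem: "wfP mem"
  using membership by (simp add: membership_def)

lemma mem_irrefl: "\<not> mem x x"
  using wfP_mem by (induction x rule: wfp_induct_rule) blast

lemma ex_empty: "\<exists>z\<in>V. elts z = {}"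
proof -
  from ZFC obtain w where "w \<in> V" "is_inductive V mem w" unfolding ZFC_minus_def by meson
  then obtain z where "z \<in> V" "\<forall>u\<in>V. \<not> mem u z" unfolding is_inductive_def by meson
  then have "elts z = {}" using mem_V by (auto simp: elts_def)
  with \<open>z \<in> V\<close> show ?thesis ..
qed

lemma is_upair_iff: "z \<in> V \<Longrightarrow> x \<in> V \<Longrightarrow> y \<in> V \<Longrightarrow> is_upair V mem z x y \<longleftrightarrow> elts z = {x, y}"
  using mem_V by (auto simp: is_upair_def set_eq_iff)

lemma is_insert_iff: "z \<in> V \<Longrightarrow> x \<in> V \<Longrightarrow> y \<in> V \<Longrightarrow> is_insert V mem z x y \<longleftrightarrow> elts z = insert y (elts x)"
  using mem_V by (auto simp: is_insert_def set_eq_iff)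

lemma is_sub_iff: "x \<in> V \<Longrightarrow> is_sub V mem x y \<longleftrightarrow> elts x \<subseteq> elts y"
  using mem_V by (auto simp: is_sub_def)

lemma ex_pair:
  assumes "x \<in> V" "y \<in> V"
  shows "\<exists>z\<in>V. elts z = {x, y}"
proof -
  from ZFC have "\<forall>x\<in>V. \<forall>y\<in>V. \<exists>z\<in>V. is_upair V mem z x y" unfolding ZFC_minus_def by (elim conjE)
  with assms obtain z where "z \<in> V" "is_upair V mem z x y" by blast
  with assms show ?thesis by (auto simp: is_upair_iff)
qed

lemma ex_Union:
  assumes "x \<in> V"
  shows "\<exists>z\<in>V. elts z = (\<Union>y\<in>elts x. elts y)"
proof -
  from ZFC have "\<forall>x\<in>V. \<exists>z\<in>V. \<forall>u\<in>V. mem u z \<longleftrightarrow> (\<exists>y\<in>V. mem y x \<and> mem u y)"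
    unfolding ZFC_minus_def by (elim conjE)
  with assms obtain z where z: "z \<in> V" "\<forall>u\<in>V. mem u z \<longleftrightarrow> (\<exists>y\<in>V. mem y x \<and> mem u y)" by blast
  have "mem u z \<longleftrightarrow> (\<exists>y. mem y x \<and> mem u y)" for u
    using z mem_V assms by metis
  then have "elts z = (\<Union>y\<in>elts x. elts y)" by (auto simp: elts_def)
  with z(1) show ?thesis ..
qed

lemma ex_Un:
  assumes "x \<in> V" "y \<in> V"
  shows "\<exists>z\<in>V. elts z = elts x \<union> elts y"
proof -
  obtain p where "p \<in> V" "elts p = {x, y}" using ex_pair[OF assms] by blast
  then show ?thesis using ex_Union[of p] by simp
qed

lemma ex_insert:
  assumes "x \<in> V" "a \<in> V"
  shows "\<exists>z\<in>V. elts z = insert a (elts x)"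
proof -
  obtain s where "s \<in> V" "elts s = {a}" using ex_pair[OF assms(2) assms(2)] by auto
  then show ?thesis using ex_Un[of s x] assms(1) by simp
qed

lemma ex_finite:
  assumes "finite S" "S \<subseteq> V"
  shows "\<exists>z\<in>V. elts z = S"
  using assms
proof (induction S)
  case empty
  then show ?case using ex_empty by blast
next
  case (insert a S)
  then obtain z where "z \<in> V" "elts z = S" by blast
  with insert.prems ex_insert[of z a] show ?case by simp
qed

lemma separation:
  assumes "wf_fm set_language \<phi>" "range e \<subseteq> V" "a \<in> V"
  shows "\<exists>b\<in>V. \<forall>x. mem x b \<longleftrightarrow> mem x a \<and> sat (set_struct V mem) (e(0 := x)) \<phi>"
proof -
  from ZFC have "\<forall>\<phi>\<in>formulas set_language. \<forall>e. range e \<subseteq> V \<longrightarrow>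
        (\<forall>a\<in>V. \<exists>b\<in>V. \<forall>x\<in>V. mem x b \<longleftrightarrow> mem x a \<and> sat (set_struct V mem) (e(0 := x)) \<phi>)"
    unfolding ZFC_minus_def by (elim conjE)
  moreover have "\<phi> \<in> formulas set_language" using assms(1) by (simp add: formulas_def)
  ultimately obtain b where b: "b \<in> V"
    "\<forall>x\<in>V. mem x b \<longleftrightarrow> mem x a \<and> sat (set_struct V mem) (e(0 := x)) \<phi>"
    using assms(2,3) by meson
  then have "mem x b \<longleftrightarrow> mem x a \<and> sat (set_struct V mem) (e(0 := x)) \<phi>" for x
    using mem_V[of x b] mem_V[of x a] assms(3) by auto
  with b(1) show ?thesis by blast
qed

lemma collection:
  assumes "wf_fm set_language \<phi>" "range e \<subseteq> V" "a \<in> V"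
    and "\<And>x. mem x a \<Longrightarrow> \<exists>y\<in>V. sat (set_struct V mem) (e(0 := x, 1 := y)) \<phi>"
  shows "\<exists>b\<in>V. \<forall>x. mem x a \<longrightarrow> (\<exists>y. mem y b \<and> sat (set_struct V mem) (e(0 := x, 1 := y)) \<phi>)"
proof -
  from ZFC have "\<forall>\<phi>\<in>formulas set_language. \<forall>e. range e \<subseteq> V \<longrightarrow>
        (\<forall>a\<in>V.
           (\<forall>x\<in>V. mem x a \<longrightarrow> (\<exists>y\<in>V. sat (set_struct V mem) (e(0 := x, 1 := y)) \<phi>)) \<longrightarrow>
           (\<exists>b\<in>V. \<forall>x\<in>V. mem x a \<longrightarrow>
              (\<exists>y\<in>V. mem y b \<and> sat (set_struct V mem) (e(0 := x, 1 := y)) \<phi>)))"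
    unfolding ZFC_minus_def by (elim conjE)
  moreover have \<phi>: "\<phi> \<in> formulas set_language" using assms(1) by (simp add: formulas_def)
  moreover have prem: "\<forall>x\<in>V. mem x a \<longrightarrow> (\<exists>y\<in>V. sat (set_struct V mem) (e(0 := x, 1 := y)) \<phi>)"
    using assms(4) by simp
  ultimately have "\<exists>b\<in>V. \<forall>x\<in>V. mem x a \<longrightarrow>
      (\<exists>y\<in>V. mem y b \<and> sat (set_struct V mem) (e(0 := x, 1 := y)) \<phi>)"
    using assms(2,3) by simp
  then obtain b where b: "b \<in> V" "\<forall>x\<in>V. mem x a \<longrightarrow>
      (\<exists>y\<in>V. mem y b \<and> sat (set_struct V mem) (e(0 := x, 1 := y)) \<phi>)"
    by (elim bexE)
  then have "\<exists>y. mem y b \<and> sat (set_struct V mem) (e(0 := x, 1 := y)) \<phi>" if "mem x a" for x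
    using mem_V[OF that assms(3)] that by blast
  with b(1) show ?thesis by blast
qed

lemma is_opair_iff:
  assumes "p \<in> V" "x \<in> V" "y \<in> V"
  shows "is_opair V mem p x y \<longleftrightarrow> elts ` elts p = {{x}, {x, y}}"
proof
  assume "is_opair V mem p x y"
  then obtain u w where "u \<in> V" "w \<in> V" "is_upair V mem u x x" "is_upair V mem w x y" "is_upair V mem p u w"
    unfolding is_opair_def by blast
  with assms show "elts ` elts p = {{x}, {x, y}}" by (simp add: is_upair_iff)
next
  assume p: "elts ` elts p = {{x}, {x, y}}"
  then have "{x} \<in> elts ` elts p" "{x, y} \<in> elts ` elts p" by simp_all
  then obtain u w where u: "u \<in> elts p" "elts u = {x}" and w: "w \<in> elts p" "elts w = {x, y}"
    by (metis imageE)
  have "z = u \<or> z = w" if "z \<in> elts p" for z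
  proof -
    have "elts z \<in> {{x}, {x, y}}" using p that by blast
    then show ?thesis using u(2) w(2) elts_inject[of z u] elts_inject[of z w] by auto
  qed
  then have "elts p = {u, w}" using u(1) w(1) by blast
  moreover have "u \<in> V" "w \<in> V" using u(1) w(1) assms(1) mem_V by simp_all
  ultimately show "is_opair V mem p x y"
    unfolding is_opair_def using u(2) w(2) assms by (auto simp: is_upair_iff)
qed

lemma ex_opair:
  assumes "x \<in> V" "y \<in> V"
  shows "\<exists>p\<in>V. is_opair V mem p x y"
proof -
  obtain u where "u \<in> V" "elts u = {x}" using ex_pair[OF assms(1) assms(1)] by auto
  moreover obtain w where "w \<in> V" "elts w = {x, y}" using ex_pair[OF assms] by blast
  moreover obtain p where "p \<in> V" "elts p = {u, w}" using ex_pair calculation by blast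
  ultimately have "elts ` elts p = {{x}, {x, y}}" by simp
  with \<open>p \<in> V\<close> show ?thesis using assms is_opair_iff by blast
qed

lemma is_opair_inject:
  assumes "p \<in> V" "x \<in> V" "y \<in> V" "x' \<in> V" "y' \<in> V" "is_opair V mem p x y" "is_opair V mem p x' y'"
  shows "x = x' \<and> y = y'"
proof -
  have "{{x}, {x, y}} = {{x'}, {x', y'}}" using assms by (simp add: is_opair_iff)
  then show ?thesis by (auto simp: doubleton_eq_iff)
qed

lemma is_succ_iff: "z \<in> V \<Longrightarrow> x \<in> V \<Longrightarrow> is_succ V mem z x \<longleftrightarrow> elts z = insert x (elts x)"
  by (simp add: is_succ_eq_insert is_insert_iff)

lemma is_inductiveD:
  assumes "is_inductive V mem w"
  shows "z \<in> V \<Longrightarrow> elts z = {} \<Longrightarrow> mem z w"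
    and "w \<in> V \<Longrightarrow> mem x w \<Longrightarrow> z \<in> V \<Longrightarrow> elts z = insert x (elts x) \<Longrightarrow> mem z w"
proof -
  assume z: "z \<in> V" "elts z = {}"
  obtain z' where "z' \<in> V" "\<forall>u\<in>V. \<not> mem u z'" "mem z' w" using assms unfolding is_inductive_def by blast
  then have "elts z' = {}" using mem_V by (auto simp: elts_def)
  with z have "z' = z" by (metis elts_inject)
  with \<open>mem z' w\<close> show "mem z w" by simp
next
  assume w: "w \<in> V" and x: "mem x w" and z: "z \<in> V" "elts z = insert x (elts x)"
  have "x \<in> V" using mem_V[OF x w] .
  then obtain z' where "z' \<in> V" "is_succ V mem z' x" "mem z' w"
    using assms x unfolding is_inductive_def by blast
  then have "z' = z" using z \<open>x \<in> V\<close> elts_inject[of z' z] by (simp add: is_succ_iff)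
  with \<open>mem z' w\<close> show "mem z w" by simp
qed

lemma is_inductiveI:
  assumes "w \<in> V" "\<And>z. z \<in> V \<Longrightarrow> elts z = {} \<Longrightarrow> mem z w"
    and "\<And>x z. mem x w \<Longrightarrow> z \<in> V \<Longrightarrow> elts z = insert x (elts x) \<Longrightarrow> mem z w"
  shows "is_inductive V mem w"
  unfolding is_inductive_def
proof (intro conjI ballI impI)
  obtain z where z: "z \<in> V" "elts z = {}" using ex_empty by blast
  then show "\<exists>z\<in>V. (\<forall>u\<in>V. \<not> mem u z) \<and> mem z w"
    using assms(2)[OF z] by (intro bexI[of _ z]) (auto simp: elts_def)
next
  fix x assume x: "x \<in> V" "mem x w"
  obtain z where z: "z \<in> V" "elts z = insert x (elts x)" using ex_insert[OF x(1) x(1)] by blast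
  then show "\<exists>z\<in>V. is_succ V mem z x \<and> mem z w"
    using assms(3)[OF x(2) z] x(1) by (intro bexI[of _ z]) (simp_all add: is_succ_iff)
qed

text \<open>Separation cuts the intersection of all inductive sets out of one of them.\<close>

lemma ex_omega: "\<exists>w\<in>V. is_omega V mem w"
proof -
  from ZFC obtain w0 where w0: "w0 \<in> V" "is_inductive V mem w0" unfolding ZFC_minus_def by meson
  let ?\<phi> = "fAll 1 (fImp (fInductive 1) (fMem 0 1))"
  have "range (\<lambda>_. w0) \<subseteq> V" using w0(1) by simp
  from separation[OF _ this w0(1), of ?\<phi>]
  obtain w where w: "w \<in> V"
    "\<forall>x. mem x w \<longleftrightarrow> mem x w0 \<and> (\<forall>v\<in>V. is_inductive V mem v \<longrightarrow> mem x v)"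
    by auto
  have "is_inductive V mem w"
  proof (rule is_inductiveI[OF w(1)])
    show "mem z w" if "z \<in> V" "elts z = {}" for z
      using is_inductiveD(1) w(2) w0(2) that by blast
    show "mem z w" if "mem x w" "z \<in> V" "elts z = insert x (elts x)" for x z
      using is_inductiveD(2) w(2) w0 that by blast
  qed
  moreover have "is_sub V mem w v" if "v \<in> V" "is_inductive V mem v" for v
    using w(2) that by (simp add: is_sub_def)
  ultimately have "is_omega V mem w" by (simp add: is_omega_def)
  with w(1) show ?thesis ..
qed

text \<open>Actual finiteness is not given by a formula, so it cannot be used in separation. Instead
  one separates the members of \<open>w\<close> that are empty or successors of members of
  \<open>w\<close>; they form an inductive set, hence all of \<open>w\<close>. Finiteness then
  follows by induction along the well-founded relation \<open>mem\<close>.\<close>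

lemma finite_elts_omega:
  assumes w: "w \<in> V" "is_omega V mem w" and "mem k w"
  shows "finite (elts k)"
proof -
  let ?\<phi> = "fDisj (fEmpty 0) (fExIn 2 1 (fInsert 0 2 2))"
  have "range (\<lambda>_. w) \<subseteq> V" using w(1) by simp
  from separation[OF _ this w(1), of ?\<phi>]
  obtain v where v: "v \<in> V" and v_iff: "\<forall>x. mem x v \<longleftrightarrow> mem x w \<and>
      ((\<forall>u\<in>V. \<not> mem u x) \<or> (\<exists>k\<in>V. mem k w \<and> is_insert V mem x k k))"
    by auto
  have ind: "is_inductive V mem w" using w(2) by (simp add: is_omega_def)
  have "is_inductive V mem v"
  proof (rule is_inductiveI[OF v])
    show "mem z v" if "z \<in> V" "elts z = {}" for z
      using is_inductiveD(1)[OF ind that] v_iff that(2) by (auto simp: elts_def)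
    show "mem z v" if "mem x v" "z \<in> V" "elts z = insert x (elts x)" for x z
    proof -
      have "mem x w" using v_iff that(1) by blast
      then have "mem z w" using is_inductiveD(2)[OF ind w(1)] that by blast
      moreover have "x \<in> V" using mem_V that(1) v by blast
      moreover have "is_insert V mem z x x" using is_insert_iff that(2,3) \<open>x \<in> V\<close> by blast
      ultimately show ?thesis using v_iff \<open>mem x w\<close> by blast
    qed
  qed
  then have "is_sub V mem w v" using w(2) v by (simp add: is_omega_def)
  then have w_v: "mem x v" if "mem x w" for x
    using mem_V[OF that w(1)] that by (simp add: is_sub_def)
  from wfP_mem \<open>mem k w\<close> show ?thesis
  proof (induction k rule: wfp_induct_rule)
    case (less k)
    have k: "k \<in> V" using mem_V less.prems w(1) by blast
    from w_v[OF less.prems] v_iff consider "\<forall>u\<in>V. \<not> mem u k"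
      | l where "l \<in> V" "mem l w" "is_insert V mem k l l" by blast
    then show ?case
    proof cases
      case 1
      then have "elts k = {}" using mem_V k by (auto simp: elts_def)
      then show ?thesis by simp
    next
      case 2
      then have eq: "elts k = insert l (elts l)" using is_insert_iff k by blast
      then have "l \<in> elts k" by simp
      then have "mem l k" by simp
      with less.IH 2(2) have "finite (elts l)" by blast
      with eq show ?thesis by simp
    qed
  qed
qed

text \<open>The bijection inside \<open>V\<close> yields an actual injection of
  \<open>elts x\<close> into a member of omega, and these are finite.\<close>

lemma finite_elts_if_is_finite:
  assumes "x \<in> V" "is_finite V mem x"
  shows "finite (elts x)"
proof -
  obtain w k f where w: "w \<in> V" "is_omega V mem w" and k: "k \<in> V" "mem k w"
    and f: "is_bijection V mem f k x"
    using assms(2) unfolding is_finite_def by blast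
  have "\<forall>y\<in>V. mem y x \<longrightarrow> (\<exists>l\<in>V. mem l k \<and> pair_in V mem f l y \<and>
      (\<forall>z\<in>V. mem z k \<longrightarrow> pair_in V mem f z y \<longrightarrow> z = l))"
    using f unfolding is_bijection_iff by (elim conjE)
  then have "\<exists>l. mem l k \<and> pair_in V mem f l y" if "mem y x" for y
    using mem_V[OF that assms(1)] that by blast
  then obtain c where c: "\<And>y. mem y x \<Longrightarrow> mem (c y) k \<and> pair_in V mem f (c y) y" by metis
  have f2: "\<forall>l\<in>V. mem l k \<longrightarrow> (\<exists>y\<in>V. mem y x \<and> pair_in V mem f l y \<and>
      (\<forall>z\<in>V. mem z x \<longrightarrow> pair_in V mem f l z \<longrightarrow> z = y))"
    using f unfolding is_bijection_iff by (elim conjE)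
  have "y = z" if y: "mem y x" and z: "mem z x" and eq: "c y = c z" for y z
  proof -
    have "c y \<in> V" using c[OF y] k(1) mem_V by blast
    then obtain y0 where y0: "\<forall>z\<in>V. mem z x \<longrightarrow> pair_in V mem f (c y) z \<longrightarrow> z = y0"
      using f2 c[OF y] by blast
    have "y \<in> V" "z \<in> V" using y z assms(1) mem_V by blast+
    with y0 y z eq c[OF y] c[OF z] have "y = y0" "z = y0" by auto
    then show ?thesis by simp
  qed
  then have "inj_on c (elts x)" by (auto intro: inj_onI)
  moreover have "c ` elts x \<subseteq> elts k" using c by auto
  moreover have "finite (elts k)" using finite_elts_omega[OF w k(2)] .
  ultimately show ?thesis using inj_on_finite by blast
qed

text \<open>The numerals \<open>\<nu> i\<close> are built by external recursion. The graph of an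
  enumeration of \<open>x\<close> by them is a finite set of elements of \<open>V\<close>, hence
  itself an element of \<open>V\<close>.\<close>

lemma is_finite_if_finite_elts:
  assumes x: "x \<in> V" "finite (elts x)"
  shows "is_finite V mem x"
proof -
  obtain w where w: "w \<in> V" "is_omega V mem w" using ex_omega by blast
  then have ind: "is_inductive V mem w" by (simp add: is_omega_def)
  obtain z0 where z0: "z0 \<in> V" "elts z0 = {}" using ex_empty by blast
  define S where "S y = (SOME z. z \<in> V \<and> elts z = insert y (elts y))" for y
  have S: "S y \<in> V \<and> elts (S y) = insert y (elts y)" if "y \<in> V" for y
    unfolding S_def by (rule someI_ex) (use ex_insert[OF that that] in blast)
  define \<nu> where "\<nu> i = (S ^^ i) z0" for i
  have \<nu>V: "\<nu> i \<in> V" for i by (induction i) (simp_all add: \<nu>_def z0 S)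
  have \<nu>Suc: "elts (\<nu> (Suc i)) = insert (\<nu> i) (elts (\<nu> i))" for i
    using S[OF \<nu>V[of i]] by (simp add: \<nu>_def)
  have \<nu>_elts: "elts (\<nu> i) = \<nu> ` {..<i}" for i
  proof (induction i)
    case 0
    then show ?case using z0 by (simp add: \<nu>_def)
  next
    case (Suc i)
    then show ?case by (simp add: \<nu>Suc lessThan_Suc)
  qed
  have \<nu>_w: "mem (\<nu> i) w" for i
  proof (induction i)
    case 0
    then show ?case using is_inductiveD(1)[OF ind z0] by (simp add: \<nu>_def)
  next
    case (Suc i)
    show ?case by (rule is_inductiveD(2)[OF ind w(1) Suc \<nu>V \<nu>Suc])
  qed
  have \<nu>_less: "mem (\<nu> l) (\<nu> i)" if "l < i" for l i
  proof -
    have "\<nu> l \<in> elts (\<nu> i)" unfolding \<nu>_elts using that by blast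
    then show ?thesis by simp
  qed
  have \<nu>_inj: "\<nu> l = \<nu> i \<longleftrightarrow> l = i" for l i
    using \<nu>_less[of l i] \<nu>_less[of i l] mem_irrefl by (metis linorder_neq_iff)
  obtain a :: "nat \<Rightarrow> 'v" and N where a: "elts x = a ` {i. i < N}" "inj_on a {i. i < N}"
    using finite_imp_nat_seg_image_inj_on[OF x(2)] by blast
  have aV: "a i \<in> V" if "i < N" for i
  proof -
    have "a i \<in> elts x" unfolding a(1) using that by blast
    then show ?thesis using mem_V x(1) by simp
  qed
  have "\<exists>p. p \<in> V \<and> is_opair V mem p (\<nu> i) (a i)" if "i < N" for i
    using ex_opair[OF \<nu>V aV[OF that]] by blast
  then obtain p where p: "\<And>i. i < N \<Longrightarrow> p i \<in> V \<and> is_opair V mem (p i) (\<nu> i) (a i)" by metis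
  obtain f where f: "f \<in> V" "elts f = p ` {i. i < N}"
    using ex_finite[of "p ` {i. i < N}"] p by auto
  have pair: "pair_in V mem f l y \<longleftrightarrow> (\<exists>i<N. l = \<nu> i \<and> y = a i)" if "l \<in> V" "y \<in> V" for l y
  proof
    assume "pair_in V mem f l y"
    then obtain q where q: "q \<in> V" "is_opair V mem q l y" "q \<in> elts f" unfolding pair_in_def by auto
    then obtain i where i: "i < N" "q = p i" unfolding f(2) by blast
    then have "l = \<nu> i \<and> y = a i"
      using is_opair_inject[OF q(1) that \<nu>V[of i] aV[OF i(1)] q(2)] p[OF i(1)] by simp
    with i(1) show "\<exists>i<N. l = \<nu> i \<and> y = a i" by blast
  next
    assume "\<exists>i<N. l = \<nu> i \<and> y = a i"
    then obtain i where i: "i < N" "l = \<nu> i" "y = a i" by blast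
    then have "p i \<in> elts f" unfolding f(2) by blast
    with p[OF i(1)] i show "pair_in V mem f l y" unfolding pair_in_def by auto
  qed
  have mem_x: "mem y x \<longleftrightarrow> (\<exists>i<N. y = a i)" for y
    using a(1) by (auto simp: set_eq_iff)
  have mem_N: "mem l (\<nu> N) \<longleftrightarrow> (\<exists>i<N. l = \<nu> i)" for l
    using \<nu>_elts[of N] by (auto simp: set_eq_iff)
  have a_inj: "a i = a l \<longleftrightarrow> i = l" if "i < N" "l < N" for i l
    using a(2) that by (auto dest: inj_onD)
  have "is_bijection V mem f (\<nu> N) x"
    unfolding is_bijection_iff
  proof (intro conjI ballI impI)
    fix q assume "q \<in> V" "mem q f"
    then have "q \<in> elts f" by simp
    then obtain i where i: "i < N" "q = p i" unfolding f(2) by blast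
    then show "\<exists>l\<in>V. mem l (\<nu> N) \<and> (\<exists>y\<in>V. mem y x \<and> is_opair V mem q l y)"
      using p[OF i(1)] \<nu>V[of i] aV[OF i(1)] mem_x mem_N by blast
  next
    fix l assume "l \<in> V" "mem l (\<nu> N)"
    then obtain i where i: "i < N" "l = \<nu> i" using mem_N by blast
    have "z = a i" if "z \<in> V" "pair_in V mem f l z" for z
      using that pair[OF \<open>l \<in> V\<close> that(1)] i by (auto simp: \<nu>_inj)
    moreover have "pair_in V mem f l (a i)" using pair[OF \<open>l \<in> V\<close> aV[OF i(1)]] i by blast
    ultimately show "\<exists>y\<in>V. mem y x \<and> pair_in V mem f l y \<and>
        (\<forall>z\<in>V. mem z x \<longrightarrow> pair_in V mem f l z \<longrightarrow> z = y)"
      using aV[OF i(1)] i mem_x by blast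
  next
    fix y assume "y \<in> V" "mem y x"
    then obtain i where i: "i < N" "y = a i" using mem_x by blast
    have "z = \<nu> i" if "z \<in> V" "pair_in V mem f z y" for z
      using that pair[OF that(1) \<open>y \<in> V\<close>] i by (auto simp: a_inj)
    moreover have "pair_in V mem f (\<nu> i) y" using pair[OF \<nu>V \<open>y \<in> V\<close>] i by blast
    ultimately show "\<exists>l\<in>V. mem l (\<nu> N) \<and> pair_in V mem f l y \<and>
        (\<forall>z\<in>V. mem z (\<nu> N) \<longrightarrow> pair_in V mem f z y \<longrightarrow> z = l)"
      using \<nu>V[of i] i mem_N by blast
  qed
  with w \<nu>V[of N] \<nu>_w[of N] f(1) show ?thesis unfolding is_finite_def by blast
qed

lemma is_finite_iff: "x \<in> V \<Longrightarrow> is_finite V mem x \<longleftrightarrow> finite (elts x)"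
  using finite_elts_if_is_finite is_finite_if_finite_elts by blast

end

section \<open>The power of the pattern inside the transitive model\<close>

text \<open>When naming is given by a function, a name is an equation between an image and a set;
  this unfolds nested names layer by layer.\<close>

lemma names_graph: "names mem (\<lambda>a u. \<phi> u = a) S x \<longleftrightarrow> \<phi> ` {u. mem u x} = S"
  by (auto simp: names_def rel_set_def)

lemma subsets_upto_Suc:
  "subsets_upto (Suc n) I = subsets_upto n I \<union> {insert i S |i S. i \<in> I \<and> S \<in> subsets_upto n I}"
proof (intro equalityI subsetI)
  fix u assume u: "u \<in> subsets_upto (Suc n) I"
  show "u \<in> subsets_upto n I \<union> {insert i S |i S. i \<in> I \<and> S \<in> subsets_upto n I}"
  proof (cases "u = {}")
    case True
    then show ?thesis by (simp add: subsets_upto_def)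
  next
    case False
    then obtain i where i: "i \<in> u" by blast
    have "u = insert i (u - {i})" "i \<in> I" "u - {i} \<in> subsets_upto n I"
      using i u by (auto simp: subsets_upto_def)
    then show ?thesis by blast
  qed
next
  fix u assume "u \<in> subsets_upto n I \<union> {insert i S |i S. i \<in> I \<and> S \<in> subsets_upto n I}"
  then show "u \<in> subsets_upto (Suc n) I"
    by (auto simp: subsets_upto_def intro: order_trans[OF card_insert_le_m1] card_insert_le_m1)
qed

context transitive_model
begin

lemma names_eq: "names mem (=) S x \<longleftrightarrow> elts x = S"
proof -
  have "(=) = (\<lambda>a u :: 'v. u = a)" by (intro ext) auto
  then show ?thesis using names_graph[of mem "\<lambda>u. u" S x] by (simp add: elts_def)
qed

lemma names2: "names mem (names mem (=)) S x \<longleftrightarrow> elts ` elts x = S"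
proof -
  have "names mem (=) = (\<lambda>S x. elts x = S)" by (intro ext) (rule names_eq)
  then show ?thesis using names_graph[of mem elts S x] by (simp add: elts_def)
qed

lemma names3: "names mem (names mem (names mem (=))) S x \<longleftrightarrow> (\<lambda>s. elts ` elts s) ` elts x = S"
proof -
  have "names mem (names mem (=)) = (\<lambda>S x. elts ` elts x = S)" by (intro ext) (rule names2)
  then show ?thesis using names_graph[of mem "\<lambda>s. elts ` elts s" S x] by (simp add: elts_def)
qed

lemma elts_image_mem_iff: "elts x \<in> elts ` elts y \<longleftrightarrow> mem x y"
  using inj_image_mem_iff[OF inj_elts, of x "elts y"] by simp

text \<open>Without power set the construction goes by induction on n. For fixed \<open>u\<close>,
  collection over the index set bounds the sets obtained from \<open>u\<close> by adding one index;
  a second collection, over \<open>N\<close>, bounds these bounds. Union and separation leave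
  exactly the sets wanted.\<close>

lemma ex_subsets_upto:
  assumes I: "I\<^sub>V \<in> V" "elts I\<^sub>V = I"
  shows "\<exists>N\<in>V. elts ` elts N = subsets_upto n I"
proof (induction n)
  case 0
  obtain z where z: "z \<in> V" "elts z = {}" using ex_empty by blast
  then obtain N where "N \<in> V" "elts N = {z}" using ex_finite[of "{z}"] by auto
  with z have "elts ` elts N = subsets_upto 0 I" by (auto simp: subsets_upto_def)
  with \<open>N \<in> V\<close> show ?case ..
next
  case (Suc n)
  then obtain N where N: "N \<in> V" "elts ` elts N = subsets_upto n I" by blast
  let ?ins = "\<lambda>b u. \<forall>i\<in>V. mem i I\<^sub>V \<longrightarrow> (\<exists>y\<in>V. mem y b \<and> is_insert V mem y u i)"
  have step: "\<exists>b\<in>V. ?ins b u" if u: "u \<in> V" for u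
  proof -
    have "range (\<lambda>_. u) \<subseteq> V" using u by simp
    moreover have "\<exists>y\<in>V. is_insert V mem y u i" if "mem i I\<^sub>V" for i
      using ex_insert[OF u mem_V[OF that I(1)]] is_insert_iff u mem_V[OF that I(1)] by blast
    ultimately obtain b where b: "b \<in> V"
      "\<forall>i. mem i I\<^sub>V \<longrightarrow> (\<exists>y. mem y b \<and> is_insert V mem y u i)"
      using collection[of "fInsert 1 2 0" "\<lambda>_. u" I\<^sub>V] I(1) by auto
    then have "?ins b u" using mem_V by blast
    with b(1) show ?thesis by blast
  qed
  have "\<exists>B\<in>V. \<forall>u. mem u N \<longrightarrow> (\<exists>b. mem b B \<and> ?ins b u)"
  proof -
    have "range (\<lambda>_. I\<^sub>V) \<subseteq> V" using I(1) by simp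
    moreover have "\<exists>b\<in>V. ?ins b u" if "mem u N" for u
      using step mem_V[OF that N(1)] by blast
    ultimately show ?thesis
      using collection[of "fAllIn 3 2 (fExIn 4 1 (fInsert 4 0 3))" "\<lambda>_. I\<^sub>V" N] N(1) by simp
  qed
  then obtain B where B: "B \<in> V" "\<And>u. mem u N \<Longrightarrow> \<exists>b. mem b B \<and> ?ins b u" by blast
  obtain C where C: "C \<in> V" "elts C = (\<Union>b\<in>elts B. elts b)" using ex_Union[OF B(1)] by blast
  obtain D where D: "D \<in> V" "elts D = elts C \<union> elts N" using ex_Un[OF C(1) N(1)] by blast
  let ?\<phi> = "fDisj (fMem 0 1) (fExIn 3 1 (fExIn 4 2 (fInsert 0 3 4)))"
  have "range ((\<lambda>_. I\<^sub>V)(1 := N)) \<subseteq> V" using I(1) N(1) by auto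
  from separation[OF _ this D(1), of ?\<phi>]
  obtain R where R: "R \<in> V" "\<And>y. mem y R \<longleftrightarrow> mem y D \<and>
      (mem y N \<or> (\<exists>u\<in>V. mem u N \<and> (\<exists>i\<in>V. mem i I\<^sub>V \<and> is_insert V mem y u i)))"
    by auto
  have "elts ` elts R = subsets_upto (Suc n) I"
  proof (intro equalityI subsetI)
    fix S assume "S \<in> elts ` elts R"
    then obtain y where y: "S = elts y" "mem y R" by auto
    have "y \<in> V" using mem_V[OF y(2) R(1)] .
    from y(2) consider "mem y N" | u i where "u \<in> V" "mem u N" "i \<in> V" "mem i I\<^sub>V" "is_insert V mem y u i"
      unfolding R(2) by blast
    then show "S \<in> subsets_upto (Suc n) I"
    proof cases
      case 1
      then have "elts y \<in> elts ` elts N" by simp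
      then show ?thesis unfolding N(2) y(1) subsets_upto_Suc by blast
    next
      case 2
      then have "elts y = insert i (elts u)" using is_insert_iff \<open>y \<in> V\<close> by blast
      moreover have "elts u \<in> elts ` elts N" using 2 by simp
      moreover have "i \<in> I" using 2 I(2) by auto
      ultimately show ?thesis unfolding N(2) y(1) subsets_upto_Suc by blast
    qed
  next
    fix S assume "S \<in> subsets_upto (Suc n) I"
    then consider "S \<in> elts ` elts N" | i S' where "i \<in> I" "S' \<in> elts ` elts N" "S = insert i S'"
      unfolding subsets_upto_Suc N(2) by blast
    then show "S \<in> elts ` elts R"
    proof cases
      case 1
      then obtain y where y: "S = elts y" "y \<in> elts N" by blast
      then have "y \<in> elts D" using D(2) by blast
      with y have "y \<in> elts R" using R(2) by simp
      with y(1) show ?thesis by blast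
    next
      case 2
      then obtain u where u: "S' = elts u" "mem u N" by auto
      have uV: "u \<in> V" using mem_V[OF u(2) N(1)] .
      have i: "mem i I\<^sub>V" "i \<in> V" using 2(1) I mem_V by auto
      obtain b where b: "mem b B" "?ins b u" using B(2)[OF u(2)] by blast
      then obtain y where y: "y \<in> V" "mem y b" "is_insert V mem y u i" using i by blast
      have "y \<in> elts C" unfolding C(2) using b(1) y(2) by auto
      then have "y \<in> elts D" using D(2) by blast
      then have "y \<in> elts R" using R(2) u(2) uV i y(3) by auto
      moreover have "elts y = S" using 2(3) u(1) y is_insert_iff uV i(2) by blast
      ultimately show ?thesis by blast
    qed
  qed
  with R(1) show ?case ..
qed

lemma inj_elts2: "inj (\<lambda>s. elts ` elts s)"
proof (rule injI)
  fix s t assume "elts ` elts s = elts ` elts t"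
  then have "elts s = elts t" by (simp add: inj_image_eq_iff[OF inj_elts])
  then show "s = t" by (rule elts_inject)
qed

text \<open>A set of indices belongs to the power iff all its members are subsets of one
  \<open>d\<close> in \<Delta>. As \<open>d\<close> is finite, only finitely many sets of indices
  fit below it, so they form an element of \<open>V\<close>; collection over \<Delta>, union and
  separation then give the whole power.\<close>

lemma ex_pattern_power:
  assumes pat: "pattern I \<Delta>" and \<Delta>: "\<Delta>\<^sub>V \<in> V" "elts ` elts \<Delta>\<^sub>V = \<Delta>"
    and N: "N \<in> V" "elts ` elts N = subsets_upto n I"
  shows "\<exists>D\<in>V. (\<lambda>s. elts ` elts s) ` elts D = pattern_power n I \<Delta>"
proof -
  let ?P = "\<lambda>d s. \<forall>u\<in>V. mem u s \<longrightarrow> mem u N \<and> is_sub V mem u d"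
  have P_sub: "elts ` elts s \<subseteq> Pow (elts d)" if s: "s \<in> V" "?P d s" for d s
  proof
    fix S assume "S \<in> elts ` elts s"
    then obtain u where u: "S = elts u" "mem u s" by auto
    have "u \<in> V" using mem_V[OF u(2) s(1)] .
    with u s(2) show "S \<in> Pow (elts d)" using is_sub_iff by blast
  qed
  have d_\<Delta>: "elts d \<in> \<Delta>" if "mem d \<Delta>\<^sub>V" for d
    using that \<Delta>(2) elts_image_mem_iff[of d \<Delta>\<^sub>V] by simp
  have \<Delta>_finite: "finite S" if "S \<in> \<Delta>" for S
    using pat that by (simp add: pattern_def)
  have step: "\<exists>y\<in>V. \<forall>s\<in>V. ?P d s \<longrightarrow> mem s y" if d: "mem d \<Delta>\<^sub>V" for d
  proof -
    define X where "X = {s \<in> V. ?P d s}"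
    have "(\<lambda>s. elts ` elts s) ` X \<subseteq> Pow (Pow (elts d))"
      using P_sub by (intro image_subsetI) (simp add: X_def)
    moreover have "finite (Pow (Pow (elts d)))" using \<Delta>_finite d_\<Delta> d by simp
    ultimately have "finite X" using inj_elts2 by (meson finite_image_iff finite_subset inj_on_subset subset_UNIV)
    moreover have "X \<subseteq> V" by (auto simp: X_def)
    ultimately obtain y where y: "y \<in> V" "elts y = X" using ex_finite by blast
    have "mem s y" if "s \<in> V" "?P d s" for s
    proof -
      have "s \<in> elts y" unfolding y(2) X_def using that by blast
      then show ?thesis by simp
    qed
    with y(1) show ?thesis by blast
  qed
  have "\<exists>B\<in>V. \<forall>d. mem d \<Delta>\<^sub>V \<longrightarrow> (\<exists>y. mem y B \<and> (\<forall>s\<in>V. ?P d s \<longrightarrow> mem s y))"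
  proof -
    have "range (\<lambda>_. N) \<subseteq> V" using N(1) by simp
    with step show ?thesis
      using collection[of "fAll 3 (fImp (fAllIn 4 3 (Conj (fMem 4 2) (fSub 4 0))) (fMem 3 1))" "\<lambda>_. N" \<Delta>\<^sub>V]
        \<Delta>(1) by simp
  qed
  then obtain B where B: "B \<in> V"
    "\<And>d. mem d \<Delta>\<^sub>V \<Longrightarrow> \<exists>y. mem y B \<and> (\<forall>s\<in>V. ?P d s \<longrightarrow> mem s y)" by blast
  obtain C where C: "C \<in> V" "elts C = (\<Union>b\<in>elts B. elts b)" using ex_Union[OF B(1)] by blast
  let ?\<phi> = "fExIn 3 1 (fAllIn 4 0 (Conj (fMem 4 2) (fSub 4 3)))"
  have "range ((\<lambda>_. N)(1 := \<Delta>\<^sub>V)) \<subseteq> V" using \<Delta>(1) N(1) by auto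
  from separation[OF _ this C(1), of ?\<phi>]
  obtain D where D: "D \<in> V" "\<And>s. mem s D \<longleftrightarrow> mem s C \<and> (\<exists>d\<in>V. mem d \<Delta>\<^sub>V \<and> ?P d s)"
    by auto
  have "(\<lambda>s. elts ` elts s) ` elts D = pattern_power n I \<Delta>"
  proof (intro equalityI subsetI)
    fix \<sigma> assume "\<sigma> \<in> (\<lambda>s. elts ` elts s) ` elts D"
    then obtain s where s: "mem s D" "\<sigma> = elts ` elts s" by auto
    have sV: "s \<in> V" using mem_V[OF s(1) D(1)] .
    obtain d where d: "mem d \<Delta>\<^sub>V" "?P d s" using s(1) D(2) by blast
    have sub: "\<sigma> \<subseteq> Pow (elts d)" unfolding s(2) by (rule P_sub[OF sV d(2)])
    have "finite (Pow (elts d))" using \<Delta>_finite d_\<Delta> d(1) by simp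
    with sub have "finite \<sigma>" by (rule finite_subset)
    moreover have "\<sigma> \<subseteq> subsets_upto n I"
    proof
      fix S assume "S \<in> \<sigma>"
      then obtain u where u: "S = elts u" "mem u s" using s(2) by auto
      have "mem u N" using d(2) u(2) mem_V[OF u(2) sV] by blast
      then show "S \<in> subsets_upto n I" using u(1) N(2) elts_image_mem_iff[of u N] by simp
    qed
    moreover have "\<Union>\<sigma> \<in> \<Delta>"
    proof -
      have "\<Union>\<sigma> \<subseteq> elts d" using sub by blast
      then show ?thesis using pat d_\<Delta>[OF d(1)] by (simp add: pattern_def)
    qed
    ultimately show "\<sigma> \<in> pattern_power n I \<Delta>" by (simp add: pattern_power_def)
  next
    fix \<sigma> assume "\<sigma> \<in> pattern_power n I \<Delta>"
    then have \<sigma>: "finite \<sigma>" "\<sigma> \<subseteq> elts ` elts N" "\<Union>\<sigma> \<in> elts ` elts \<Delta>\<^sub>V"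
      by (simp_all add: pattern_power_def N(2) \<Delta>(2))
    obtain X where X: "X \<subseteq> elts N" "finite X" "\<sigma> = elts ` X"
      using finite_subset_image[OF \<sigma>(1,2)] by blast
    have "X \<subseteq> V" using X(1) elts_subset_V[OF N(1)] by blast
    then obtain s where s: "s \<in> V" "elts s = X" using ex_finite[OF X(2)] by blast
    obtain d where d: "mem d \<Delta>\<^sub>V" "\<Union>\<sigma> = elts d" using \<sigma>(3) by auto
    have dV: "d \<in> V" using mem_V[OF d(1) \<Delta>(1)] .
    have P: "?P d s"
    proof (intro ballI impI)
      fix u assume u: "u \<in> V" "mem u s"
      then have "u \<in> X" using s(2) by auto
      then have "elts u \<subseteq> elts d" using d(2) X(3) by blast
      with u(1) \<open>u \<in> X\<close> X(1) show "mem u N \<and> is_sub V mem u d" using is_sub_iff by auto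
    qed
    obtain y where y: "mem y B" "\<forall>s\<in>V. ?P d s \<longrightarrow> mem s y" using B(2)[OF d(1)] by blast
    then have "mem s y" using s(1) P by blast
    then have "s \<in> elts C" unfolding C(2) using y(1) by auto
    then have "s \<in> elts D" using D(2) d(1) dV P by auto
    moreover have "\<sigma> = elts ` elts s" using X(3) s(2) by simp
    ultimately show "\<sigma> \<in> (\<lambda>s. elts ` elts s) ` elts D" by blast
  qed
  with D(1) show ?thesis ..
qed

end

section \<open>Standard cardinality bounds and unbounded sets\<close>

lemma in_extension_iff: "u \<in> extension W E x \<longleftrightarrow> u \<in> W \<and> E u x"
  by (simp add: extension_def)

lemma is_sub_iff_extension: "is_sub W E x y \<longleftrightarrow> extension W E x \<subseteq> extension W E y"
  by (auto simp: is_sub_def extension_def)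

text \<open>States that \<open>x\<close> has at most n elements: it is covered by one point and a
  set with one element fewer allowed. The recursion is on the standard number n, so the bound keeps
  its external meaning in an ill-founded structure.\<close>

fun fCardLe :: "nat \<Rightarrow> nat \<Rightarrow> set_fm" where
  "fCardLe 0 x = fEmpty x"
| "fCardLe (Suc n) x = Exi (Suc x) (Exi (Suc (Suc x)) (Conj (fCardLe n (Suc (Suc x)))
     (fAllIn (Suc (Suc (Suc x))) x
       (fDisj (fMem (Suc (Suc (Suc x))) (Suc (Suc x))) (fEq (Suc (Suc (Suc x))) (Suc x))))))"

lemma wf_fCardLe [simp]: "wf_fm set_language (fCardLe n x)"
  by (induction n arbitrary: x) simp_all

lemma finite_extension_if_card_le:
  "sat (set_struct W E) e (fCardLe n x) \<Longrightarrow> finite (extension W E (e x))"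
proof (induction n arbitrary: x e)
  case 0
  then have "extension W E (e x) = {}" by (simp add: extension_def)
  then show ?case by simp
next
  case (Suc n)
  then obtain v y where y: "v \<in> W" "y \<in> W"
    and few: "sat (set_struct W E) (e(Suc x := v, Suc (Suc x) := y)) (fCardLe n (Suc (Suc x)))"
    and cov: "\<forall>u\<in>W. E u (e x) \<longrightarrow> E u y \<or> u = v"
    by auto
  from Suc.IH[OF few] have "finite (extension W E y)" by simp
  moreover have "extension W E (e x) \<subseteq> insert v (extension W E y)"
    using cov by (auto simp: extension_def)
  ultimately show ?case by (meson finite.insertI finite_subset)
qed

text \<open>The witnesses \<open>X\<close> in the definition of \<open>lambda_model\<close>, with
  the cardinality bound split off.\<close>

definition unbounded_set :: "'w set \<Rightarrow> ('w \<Rightarrow> 'w \<Rightarrow> bool) \<Rightarrow> 'w \<Rightarrow> 'w \<Rightarrow> 'w set \<Rightarrow> bool" where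
  "unbounded_set W E i d X \<longleftrightarrow> pseudofinite W E X \<and> X \<subseteq> extension W E i \<and>
     (\<forall>s. finite s \<and> s \<subseteq> X \<longrightarrow> (\<exists>x\<in>W. E x d \<and> extension W E x = s)) \<and>
     \<not> (\<exists>x\<in>W. E x d \<and> X \<subseteq> extension W E x)"

lemma lambda_model_eq:
  "lambda_model W E i d = least_card (\<lambda>K :: 'k set. \<exists>X. unbounded_set W E i d X \<and> |X| \<le>o |K| )"
  unfolding lambda_model_def unbounded_set_def by (rule arg_cong[of _ _ least_card]) (intro ext iff_exI; blast)

text \<open>A finite \<open>X\<close> would be one of its own finite subsets, hence contained in a
  member of \<open>d\<close>.\<close>

lemma infinite_if_unbounded_set:
  "unbounded_set W E i d X \<Longrightarrow> infinite X"
  unfolding unbounded_set_def by blast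

context transitive_model
begin

lemma sat_fCardLe:
  "e x \<in> V \<Longrightarrow> finite (elts (e x)) \<Longrightarrow> card (elts (e x)) \<le> n \<Longrightarrow> sat (set_struct V mem) e (fCardLe n x)"
proof (induction n arbitrary: e x)
  case 0
  then have "elts (e x) = {}" by simp
  then show ?case by (auto simp: elts_def)
next
  case (Suc n)
  \<comment> \<open>If \<open>e x\<close> has no members, \<open>e x\<close> itself can serve as
    \<open>v\<close>.\<close>
  obtain v where v: "v \<in> V" "elts (e x) = {} \<or> v \<in> elts (e x)"
    using Suc.prems(1) elts_subset_V by blast
  have "elts (e x) - {v} \<subseteq> V" using elts_subset_V[OF Suc.prems(1)] by blast
  then obtain y where y: "y \<in> V" "elts y = elts (e x) - {v}"
    using ex_finite[of "elts (e x) - {v}"] Suc.prems(2) by auto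
  have "card (elts y) \<le> n"
  proof (cases "elts (e x) = {}")
    case False
    with v(2) Suc.prems(2,3) show ?thesis by (simp add: y(2))
  qed (simp add: y(2))
  then have "sat (set_struct V mem) (e(Suc x := v, Suc (Suc x) := y)) (fCardLe n (Suc (Suc x)))"
    using Suc.prems(2) y by (intro Suc.IH) simp_all
  moreover have "mem u y \<or> u = v" if "mem u (e x)" for u
  proof -
    have "u \<in> elts y \<or> u = v" using that unfolding y(2) by simp
    then show ?thesis by simp
  qed
  ultimately show ?case using v(1) y(1) by auto
qed

end

section \<open>Facts transferred along the elementary embedding\<close>

locale pattern_embedding = transitive_model mem V
  for mem :: "'v \<Rightarrow> 'v \<Rightarrow> bool" and V :: "'v set" +
  fixes I :: "'v set" and \<Delta> :: "'v set set" and n :: nat and I\<^sub>V \<Delta>\<^sub>V N D :: 'v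
    and E :: "'w \<Rightarrow> 'w \<Rightarrow> bool" and W :: "'w set" and j :: "'v \<Rightarrow> 'w"
  assumes embedding: "elementary_embedding set_language (set_struct V mem) (set_struct W E) j"
    and pat: "pattern I \<Delta>" and n: "1 \<le> n"
    and params: "I\<^sub>V \<in> V" "\<Delta>\<^sub>V \<in> V" "N \<in> V" "D \<in> V"
    and elts_I: "elts I\<^sub>V = I" and elts_\<Delta>: "elts ` elts \<Delta>\<^sub>V = \<Delta>"
    and elts_N: "elts ` elts N = subsets_upto n I"
    and elts_D: "(\<lambda>s. elts ` elts s) ` elts D = pattern_power n I \<Delta>"
begin

lemma mem_I: "mem i I\<^sub>V \<longleftrightarrow> i \<in> I" using elts_I by auto
lemma mem_\<Delta>: "mem d \<Delta>\<^sub>V \<longleftrightarrow> elts d \<in> \<Delta>" using elts_\<Delta> elts_image_mem_iff[of d \<Delta>\<^sub>V] by simp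
lemma mem_N: "mem u N \<longleftrightarrow> elts u \<in> subsets_upto n I" using elts_N elts_image_mem_iff[of u N] by simp

lemma mem_D: "mem s D \<Longrightarrow> elts ` elts s \<in> pattern_power n I \<Delta>"
  using elts_D by auto

lemma ex_mem_D:
  assumes "\<sigma> \<in> pattern_power n I \<Delta>"
  shows "\<exists>s\<in>V. mem s D \<and> (\<forall>u. mem u s \<longleftrightarrow> elts u \<in> \<sigma>)"
proof -
  obtain s where s: "mem s D" "elts ` elts s = \<sigma>" using assms unfolding elts_D[symmetric] by auto
  then show ?thesis using elts_image_mem_iff[of _ s] mem_V[OF s(1) params(4)] by auto
qed

text \<open>In all transferred sentences the variables 0 to 3 denote these parameters, so bound
  variables start at 4.\<close>

definition env :: "nat \<Rightarrow> 'v" where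
  "env k = (if k = 0 then I\<^sub>V else if k = 1 then \<Delta>\<^sub>V else if k = 2 then N else D)"

lemma env_simps [simp]: "env 0 = I\<^sub>V" "env (Suc 0) = \<Delta>\<^sub>V" "env 2 = N" "env 3 = D"
  by (simp_all add: env_def)

lemma transfer_sat:
  assumes "wf_fm set_language \<phi>" "sat (set_struct V mem) env \<phi>"
  shows "sat (set_struct W E) (j \<circ> env) \<phi>"
proof -
  have "env k \<in> V" for k using params by (simp add: env_def)
  with assms embedding show ?thesis
    by (simp add: elementary_embedding_def elementary_on_def formulas_def)
qed

lemma ext_W:
  assumes "x \<in> W" "y \<in> W" "extension W E x = extension W E y"
  shows "x = y"
proof -
  have "sat (set_struct V mem) env (fAll 4 (fAll 5 (fImp (fAll 6 (fIff (fMem 6 4) (fMem 6 5))) (fEq 4 5))))"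
    using ZFC unfolding ZFC_minus_def by simp
  from transfer_sat[OF _ this] assms show ?thesis
    by (auto simp: extension_def set_eq_iff)
qed

text \<open>The empty set and the addition of one element transfer from \<open>V\<close>; induction
  on the actual finite set does the rest.\<close>

lemma ex_finite_W:
  assumes "finite S" "S \<subseteq> W"
  shows "\<exists>z\<in>W. extension W E z = S"
  using assms
proof (induction S)
  case empty
  have "sat (set_struct V mem) env (Exi 4 (fEmpty 4))"
    using ex_empty by (auto simp: elts_def)
  from transfer_sat[OF _ this] show ?case by (auto simp: extension_def)
next
  case (insert a S)
  then obtain x where x: "x \<in> W" "extension W E x = S" by blast
  have "sat (set_struct V mem) env (fAll 4 (fAll 5 (Exi 6 (fInsert 6 4 5))))"
    using ex_insert is_insert_iff by simp
  from transfer_sat[OF _ this] have "\<forall>x\<in>W. \<forall>a\<in>W. \<exists>y\<in>W. is_insert W E y x a" by simp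
  with x(1) insert.prems obtain y where "y \<in> W" "is_insert W E y x a" by blast
  then have "extension W E y = insert a (extension W E x)"
    using insert.prems by (auto simp: extension_def is_insert_def)
  with \<open>y \<in> W\<close> x(2) show ?case by auto
qed

lemma W_\<Delta>_subset:
  assumes "d \<in> W" "E d (j \<Delta>\<^sub>V)" "x \<in> W" "extension W E x \<subseteq> extension W E d"
  shows "E x (j \<Delta>\<^sub>V)"
proof -
  have "mem x \<Delta>\<^sub>V" if "d \<in> V" "mem d \<Delta>\<^sub>V" "x \<in> V" "is_sub V mem x d" for d x
    using that pat by (simp add: mem_\<Delta> is_sub_iff pattern_def)
  then have "sat (set_struct V mem) env (fAllIn 4 1 (fAll 5 (fImp (fSub 5 4) (fMem 5 1))))"
    by simp
  from transfer_sat[OF _ this] have "\<forall>d\<in>W. E d (j \<Delta>\<^sub>V) \<longrightarrow> (\<forall>x\<in>W. is_sub W E x d \<longrightarrow> E x (j \<Delta>\<^sub>V))"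
    by simp
  with assms show ?thesis unfolding is_sub_iff_extension by blast
qed

text \<open>In \<open>V\<close> the witness is the set of all indices contained in \<open>d\<close>:
  it is finite, and its union is a subset of \<open>d\<close>.\<close>

lemma W_power_of_\<Delta>:
  assumes "d \<in> W" "E d (j \<Delta>\<^sub>V)"
  shows "\<exists>x\<in>W. E x (j D) \<and> (\<forall>u\<in>W. E u (j N) \<longrightarrow> extension W E u \<subseteq> extension W E d \<longrightarrow> E u x)"
proof -
  have "\<exists>x\<in>V. mem x D \<and> (\<forall>u\<in>V. mem u N \<longrightarrow> is_sub V mem u d \<longrightarrow> mem u x)"
    if d: "d \<in> V" "mem d \<Delta>\<^sub>V" for d
  proof -
    let ?\<sigma> = "{S \<in> subsets_upto n I. S \<subseteq> elts d}"
    have "elts d \<in> \<Delta>" using d mem_\<Delta> by simp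
    moreover have "finite ?\<sigma>"
      by (rule finite_subset[of _ "Pow (elts d)"]) (use \<open>elts d \<in> \<Delta>\<close> pat in \<open>auto simp: pattern_def\<close>)
    moreover have "\<Union>?\<sigma> \<subseteq> elts d" by blast
    ultimately have "?\<sigma> \<in> pattern_power n I \<Delta>"
      using pat unfolding pattern_power_def pattern_def by blast
    from ex_mem_D[OF this] show ?thesis by (auto simp: mem_N is_sub_iff)
  qed
  then have "sat (set_struct V mem) env (fAllIn 4 1 (fExIn 5 3 (fAllIn 6 2 (fImp (fSub 6 4) (fMem 6 5)))))"
    by simp
  from transfer_sat[OF _ this] assms have
    "\<exists>x\<in>W. E x (j D) \<and> (\<forall>u\<in>W. E u (j N) \<longrightarrow> is_sub W E u d \<longrightarrow> E u x)" by simp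
  then show ?thesis unfolding is_sub_iff_extension .
qed

lemma W_Union_of_power:
  assumes "s \<in> W" "E s (j D)"
  shows "\<exists>d\<in>W. E d (j \<Delta>\<^sub>V) \<and> (\<forall>u\<in>W. E u s \<longrightarrow> extension W E u \<subseteq> extension W E d)"
proof -
  have "\<exists>d\<in>V. mem d \<Delta>\<^sub>V \<and> (\<forall>u\<in>V. mem u s \<longrightarrow> (\<forall>i\<in>V. mem i u \<longrightarrow> mem i d))"
    if s: "s \<in> V" "mem s D" for s
  proof -
    have "\<Union>(elts ` elts s) \<in> \<Delta>" using mem_D[OF s(2)] by (simp add: pattern_power_def)
    then obtain d where d: "mem d \<Delta>\<^sub>V" "elts d = \<Union>(elts ` elts s)"
      unfolding elts_\<Delta>[symmetric] by auto
    have "mem i d" if "mem u s" "mem i u" for u i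
    proof -
      have "i \<in> elts d" unfolding d(2) using that by auto
      then show ?thesis by simp
    qed
    then show ?thesis using d(1) mem_V[OF d(1) params(2)] by blast
  qed
  then have "sat (set_struct V mem) env (fAllIn 4 3 (fExIn 5 1 (fAllIn 6 4 (fAllIn 7 6 (fMem 7 5)))))"
    by simp
  from transfer_sat[OF _ this] assms have
    "\<exists>d\<in>W. E d (j \<Delta>\<^sub>V) \<and> (\<forall>u\<in>W. E u s \<longrightarrow> (\<forall>i\<in>W. E i u \<longrightarrow> E i d))" by simp
  then show ?thesis unfolding extension_def by blast
qed

lemma W_N_subset:
  assumes "u \<in> W" "E u (j N)"
  shows "extension W E u \<subseteq> extension W E (j I\<^sub>V)"
proof -
  have "mem i I\<^sub>V" if "mem u N" "mem i u" for u i
    using that by (auto simp: mem_N mem_I subsets_upto_def)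
  then have "sat (set_struct V mem) env (fAllIn 4 2 (fAllIn 5 4 (fMem 5 0)))" by simp
  from transfer_sat[OF _ this] have "\<forall>u\<in>W. E u (j N) \<longrightarrow> (\<forall>i\<in>W. E i u \<longrightarrow> E i (j I\<^sub>V))" by simp
  with assms show ?thesis unfolding extension_def by blast
qed

lemma W_N_finite:
  assumes "u \<in> W" "E u (j N)"
  shows "finite (extension W E u)"
proof -
  have "sat (set_struct V mem) env (fAllIn 4 2 (fCardLe n 4))"
    by (auto intro!: sat_fCardLe simp: mem_N subsets_upto_def)
  from transfer_sat[OF _ this] assms
  have "sat (set_struct W E) ((j \<circ> env)(4 := u)) (fCardLe n 4)" by simp
  from finite_extension_if_card_le[OF this] show ?thesis by simp
qed

text \<open>In \<open>V\<close> a finite set of members of \<open>N\<close> has a finite union, and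
  its finiteness there is actual finiteness, so the statement can be proved in \<open>V\<close> and
  transferred. A finite set covering \<open>X\<close> may contain elements outside
  \<open>j N\<close> with arbitrary members; the intersection discards them.\<close>

lemma W_pseudofinite_Union:
  assumes "pseudofinite W E X"
  shows "pseudofinite W E (\<Union>u\<in>X \<inter> extension W E (j N). extension W E u)"
proof -
  obtain x where x: "x \<in> W" "is_finite W E x" "X \<subseteq> extension W E x"
    using assms unfolding pseudofinite_def by blast
  have "\<exists>y\<in>V. is_finite V mem y \<and> (\<forall>u\<in>V. mem u x \<longrightarrow> mem u N \<longrightarrow> (\<forall>i\<in>V. mem i u \<longrightarrow> mem i y))"
    if x: "x \<in> V" "is_finite V mem x" for x
  proof -
    let ?Y = "\<Union>u\<in>elts x \<inter> elts N. elts u"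
    have "finite (elts x)" using x is_finite_iff by blast
    then have "finite ?Y" by (auto simp: mem_N subsets_upto_def)
    moreover have "?Y \<subseteq> V" using mem_V[OF _ params(3)] mem_V by auto
    ultimately obtain y where y: "y \<in> V" "elts y = ?Y" using ex_finite[of ?Y] by blast
    have "mem i y" if "mem u x" "mem u N" "mem i u" for u i
    proof -
      have "i \<in> elts y" unfolding y(2) using that by auto
      then show ?thesis by simp
    qed
    moreover have "is_finite V mem y" using y \<open>finite ?Y\<close> is_finite_iff by metis
    ultimately show ?thesis using y(1) by blast
  qed
  then have "sat (set_struct V mem) env (fAll 4 (fImp (fFinite 4) (Exi 5 (Conj (fFinite 5)
      (fAllIn 6 4 (fImp (fMem 6 2) (fAllIn 7 6 (fMem 7 5))))))))"
    by simp
  from transfer_sat[OF _ this] have "\<forall>x\<in>W. is_finite W E x \<longrightarrow> (\<exists>y\<in>W. is_finite W E y \<and>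
      (\<forall>u\<in>W. E u x \<longrightarrow> E u (j N) \<longrightarrow> (\<forall>i\<in>W. E i u \<longrightarrow> E i y)))"
    by simp
  with x(1,2) obtain y where y: "y \<in> W" "is_finite W E y"
    "\<forall>u\<in>W. E u x \<longrightarrow> E u (j N) \<longrightarrow> (\<forall>i\<in>W. E i u \<longrightarrow> E i y)"
    by blast
  have "(\<Union>u\<in>X \<inter> extension W E (j N). extension W E u) \<subseteq> extension W E y"
    using x(3) y(3) by (auto simp: extension_def)
  with y(1,2) show ?thesis unfolding pseudofinite_def by blast
qed

definition sing :: "'w \<Rightarrow> 'w" where "sing i = (SOME u. u \<in> W \<and> extension W E u = {i})"

lemma sing: "i \<in> W \<Longrightarrow> sing i \<in> W \<and> extension W E (sing i) = {i}"
  unfolding sing_def by (rule someI_ex) (use ex_finite_W[of "{i}"] in auto)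

lemma is_upair_W: "i \<in> W \<Longrightarrow> u \<in> W \<Longrightarrow> is_upair W E u i i \<longleftrightarrow> u = sing i"
proof -
  assume i: "i \<in> W" and u: "u \<in> W"
  have "is_upair W E u i i \<longleftrightarrow> extension W E u = {i}"
    using i by (auto simp: is_upair_def extension_def set_eq_iff)
  also have "\<dots> \<longleftrightarrow> u = sing i" using sing[OF i] ext_W[OF u] by metis
  finally show ?thesis .
qed

lemma is_upair_V: "i \<in> V \<Longrightarrow> u \<in> V \<Longrightarrow> is_upair V mem u i i \<longleftrightarrow> elts u = {i}"
  by (simp add: is_upair_iff)

lemma W_sing_N:
  assumes "i \<in> W" "E i (j I\<^sub>V)"
  shows "E (sing i) (j N)"
proof -
  have "mem u N" if "i \<in> V" "mem i I\<^sub>V" "u \<in> V" "is_upair V mem u i i" for i u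
    using that n by (simp add: is_upair_V mem_N mem_I subsets_upto_def)
  then have "sat (set_struct V mem) env (fAllIn 4 0 (fAll 5 (fImp (fUpair 5 4 4) (fMem 5 2))))"
    by simp
  from transfer_sat[OF _ this]
  have "\<forall>i\<in>W. E i (j I\<^sub>V) \<longrightarrow> (\<forall>u\<in>W. is_upair W E u i i \<longrightarrow> E u (j N))" by simp
  with assms sing[OF assms(1)] is_upair_W show ?thesis by blast
qed

lemma W_pseudofinite_sing:
  assumes "pseudofinite W E X"
  shows "pseudofinite W E (sing ` X)"
proof -
  obtain x where x: "x \<in> W" "is_finite W E x" "X \<subseteq> extension W E x"
    using assms unfolding pseudofinite_def by blast
  have "\<exists>y\<in>V. is_finite V mem y \<and> (\<forall>i\<in>V. mem i x \<longrightarrow> (\<forall>u\<in>V. is_upair V mem u i i \<longrightarrow> mem u y))"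
    if x: "x \<in> V" "is_finite V mem x" for x
  proof -
    let ?Y = "{u \<in> V. \<exists>i\<in>elts x. elts u = {i}}"
    have "elts ` ?Y \<subseteq> (\<lambda>i. {i}) ` elts x" by blast
    moreover have "finite (elts x)" using x is_finite_iff by blast
    ultimately have "finite (elts ` ?Y)" by (meson finite_imageI finite_subset)
    then have fin: "finite ?Y" using finite_imageD inj_on_subset[OF inj_elts subset_UNIV] by blast
    moreover have "?Y \<subseteq> V" by blast
    ultimately obtain y where y: "y \<in> V" "elts y = ?Y" using ex_finite[of ?Y] by blast
    have "mem u y" if "i \<in> V" "mem i x" "u \<in> V" "is_upair V mem u i i" for i u
    proof -
      have "u \<in> elts y" unfolding y(2) using that by (auto simp: is_upair_V)
      then show ?thesis by simp
    qed
    moreover have "is_finite V mem y" using y fin is_finite_iff by metis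
    ultimately show ?thesis using y(1) by blast
  qed
  then have "sat (set_struct V mem) env (fAll 4 (fImp (fFinite 4) (Exi 5 (Conj (fFinite 5)
      (fAllIn 6 4 (fAll 7 (fImp (fUpair 7 6 6) (fMem 7 5))))))))"
    by simp
  from transfer_sat[OF _ this] have "\<forall>x\<in>W. is_finite W E x \<longrightarrow> (\<exists>y\<in>W. is_finite W E y \<and>
      (\<forall>i\<in>W. E i x \<longrightarrow> (\<forall>u\<in>W. is_upair W E u i i \<longrightarrow> E u y)))"
    by simp
  with x(1,2) obtain y where y: "y \<in> W" "is_finite W E y"
    "\<forall>i\<in>W. E i x \<longrightarrow> (\<forall>u\<in>W. is_upair W E u i i \<longrightarrow> E u y)"
    by blast
  have "sing ` X \<subseteq> extension W E y"
  proof (rule image_subsetI)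
    fix i assume "i \<in> X"
    then have i: "i \<in> W" "E i x" using x(3) by (auto simp: extension_def)
    with y(3) sing[OF i(1)] show "sing i \<in> extension W E y"
      by (simp add: is_upair_W extension_def)
  qed
  with y(1,2) show ?thesis unfolding pseudofinite_def by blast
qed

lemma W_sing_power:
  assumes "d \<in> W" "E d (j \<Delta>\<^sub>V)"
  shows "\<exists>x\<in>W. E x (j D) \<and> extension W E x = sing ` extension W E d"
proof -
  have "\<exists>x\<in>V. mem x D \<and> (\<forall>u\<in>V. mem u x \<longleftrightarrow> (\<exists>i\<in>V. mem i d \<and> is_upair V mem u i i))"
    if d: "d \<in> V" "mem d \<Delta>\<^sub>V" for d
  proof -
    have d\<Delta>: "elts d \<in> \<Delta>" using d mem_\<Delta> by simp
    then have "finite (elts d)" "elts d \<subseteq> I" using pat by (auto simp: pattern_def)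
    with d\<Delta> have "(\<lambda>i. {i}) ` elts d \<in> pattern_power n I \<Delta>"
      using pattern_power_singletons[OF n] by blast
    from ex_mem_D[OF this] obtain x where x: "x \<in> V" "mem x D"
      "\<And>u. mem u x \<longleftrightarrow> elts u \<in> (\<lambda>i. {i}) ` elts d" by blast
    have "mem u x \<longleftrightarrow> (\<exists>i\<in>V. mem i d \<and> is_upair V mem u i i)" if "u \<in> V" for u
    proof -
      have "elts u \<in> (\<lambda>i. {i}) ` elts d \<longleftrightarrow> (\<exists>i. mem i d \<and> elts u = {i})" by auto
      also have "\<dots> \<longleftrightarrow> (\<exists>i\<in>V. mem i d \<and> elts u = {i})" using mem_V[OF _ d(1)] by blast
      also have "\<dots> \<longleftrightarrow> (\<exists>i\<in>V. mem i d \<and> is_upair V mem u i i)" using is_upair_V that by blast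
      finally show ?thesis using x(3) by simp
    qed
    with x(1,2) show ?thesis by blast
  qed
  then have "sat (set_struct V mem) env
      (fAllIn 4 1 (fExIn 5 3 (fAll 6 (fIff (fMem 6 5) (fExIn 7 4 (fUpair 6 7 7))))))"
    by simp
  from transfer_sat[OF _ this] have "\<forall>d\<in>W. E d (j \<Delta>\<^sub>V) \<longrightarrow>
      (\<exists>x\<in>W. E x (j D) \<and> (\<forall>u\<in>W. E u x \<longleftrightarrow> (\<exists>i\<in>W. E i d \<and> is_upair W E u i i)))"
    by simp
  with assms obtain x where x: "x \<in> W" "E x (j D)"
    "\<forall>u\<in>W. E u x \<longleftrightarrow> (\<exists>i\<in>W. E i d \<and> is_upair W E u i i)"
    by blast
  have "u \<in> extension W E x \<longleftrightarrow> u \<in> sing ` extension W E d" for u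
  proof -
    have "u \<in> extension W E x \<longleftrightarrow> u \<in> W \<and> (\<exists>i\<in>W. E i d \<and> u = sing i)"
      using x(3) is_upair_W by (auto simp: in_extension_iff)
    also have "\<dots> \<longleftrightarrow> u \<in> sing ` extension W E d"
      using sing by (auto simp: in_extension_iff)
    finally show ?thesis .
  qed
  then have "extension W E x = sing ` extension W E d" by blast
  with x(1,2) show ?thesis by blast
qed

section \<open>Moving unbounded sets between the two patterns\<close>

lemma unbounded_set_power:
  assumes "unbounded_set W E (j I\<^sub>V) (j \<Delta>\<^sub>V) X"
  shows "unbounded_set W E (j N) (j D) (sing ` X)"
  unfolding unbounded_set_def
proof (intro conjI allI impI)
  have X: "pseudofinite W E X" "X \<subseteq> extension W E (j I\<^sub>V)"
    "\<And>s. finite s \<Longrightarrow> s \<subseteq> X \<Longrightarrow> \<exists>x\<in>W. E x (j \<Delta>\<^sub>V) \<and> extension W E x = s"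
    "\<not> (\<exists>x\<in>W. E x (j \<Delta>\<^sub>V) \<and> X \<subseteq> extension W E x)"
    using assms unfolding unbounded_set_def by auto
  show "pseudofinite W E (sing ` X)" using X(1) by (rule W_pseudofinite_sing)
  have XW: "i \<in> W" "E i (j I\<^sub>V)" if "i \<in> X" for i
    using X(2) that by (auto simp: extension_def)
  show "sing ` X \<subseteq> extension W E (j N)"
    using XW sing W_sing_N by (intro image_subsetI) (simp add: extension_def)
  show "\<exists>x\<in>W. E x (j D) \<and> extension W E x = s" if s: "finite s \<and> s \<subseteq> sing ` X" for s
  proof -
    obtain t where t: "t \<subseteq> X" "finite t" "s = sing ` t" using finite_subset_image[of s sing X] s by blast
    then obtain d where d: "d \<in> W" "E d (j \<Delta>\<^sub>V)" "extension W E d = t" using X(3) by blast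
    from W_sing_power[OF d(1,2)] show ?thesis unfolding d(3) t(3) .
  qed
  show "\<not> (\<exists>x\<in>W. E x (j D) \<and> sing ` X \<subseteq> extension W E x)"
  proof
    assume "\<exists>x\<in>W. E x (j D) \<and> sing ` X \<subseteq> extension W E x"
    then obtain x where x: "x \<in> W" "E x (j D)" "sing ` X \<subseteq> extension W E x" by blast
    obtain d where d: "d \<in> W" "E d (j \<Delta>\<^sub>V)" "\<forall>u\<in>W. E u x \<longrightarrow> extension W E u \<subseteq> extension W E d"
      using W_Union_of_power[OF x(1,2)] by blast
    have "X \<subseteq> extension W E d"
    proof
      fix i assume i: "i \<in> X"
      then have "sing i \<in> W" "E (sing i) x" using x(3) by (auto simp: extension_def)
      with d(3) have "extension W E (sing i) \<subseteq> extension W E d" by blast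
      with sing[OF XW(1)[OF i]] show "i \<in> extension W E d" by simp
    qed
    with d X(4) show False by blast
  qed
qed

text \<open>A finite part of \<open>Y\<close> is covered by finitely many members of
  \<open>X\<close>, which form a member of \<open>j D\<close>; its union lies within a member of
  \<open>j \<Delta>\<^sub>V\<close>, and subset closure applies. If some \<open>d\<close> bounded
  \<open>Y\<close>, the set of all indices below \<open>d\<close> would bound
  \<open>X\<close>.\<close>

lemma unbounded_set_from_power:
  assumes "unbounded_set W E (j N) (j D) X"
  defines "Y \<equiv> \<Union>u\<in>X. extension W E u"
  shows "unbounded_set W E (j I\<^sub>V) (j \<Delta>\<^sub>V) Y" "|Y| \<le>o |X|"
proof -
  have X: "pseudofinite W E X" "X \<subseteq> extension W E (j N)"
    "\<And>s. finite s \<Longrightarrow> s \<subseteq> X \<Longrightarrow> \<exists>x\<in>W. E x (j D) \<and> extension W E x = s"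
    "\<not> (\<exists>x\<in>W. E x (j D) \<and> X \<subseteq> extension W E x)"
    using assms unfolding unbounded_set_def by auto
  have XW: "u \<in> W" "E u (j N)" if "u \<in> X" for u
    using X(2) that by (auto simp: extension_def)
  \<comment> \<open>The members of \<open>X\<close> are finite from outside and \<open>X\<close> is
    infinite, so the union is no larger than \<open>X\<close>.\<close>
  have "|extension W E u| \<le>o |X|" if "u \<in> X" for u
    using ordLeq_total[OF card_of_Well_order card_of_Well_order, of "extension W E u" X]
      card_of_ordLeq_finite[of X "extension W E u"] infinite_if_unbounded_set[OF assms(1)]
      W_N_finite[OF XW[OF that]] by blast
  then show "|Y| \<le>o |X|"
    unfolding Y_def using infinite_if_unbounded_set[OF assms(1)]
    by (intro card_of_UNION_ordLeq_infinite ordLeq_refl card_of_Card_order) auto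
  show "unbounded_set W E (j I\<^sub>V) (j \<Delta>\<^sub>V) Y"
    unfolding unbounded_set_def
  proof (intro conjI allI impI)
    have "X \<inter> extension W E (j N) = X" using X(2) by blast
    then show "pseudofinite W E Y" using W_pseudofinite_Union[OF X(1)] by (simp add: Y_def)
    show "Y \<subseteq> extension W E (j I\<^sub>V)"
      unfolding Y_def using W_N_subset XW by (intro UN_least) blast
    show "\<exists>d\<in>W. E d (j \<Delta>\<^sub>V) \<and> extension W E d = s" if s: "finite s \<and> s \<subseteq> Y" for s
    proof -
      have "\<exists>u. u \<in> X \<and> i \<in> extension W E u" if "i \<in> s" for i
        using s that unfolding Y_def by blast
      then obtain c where c: "\<And>i. i \<in> s \<Longrightarrow> c i \<in> X \<and> i \<in> extension W E (c i)" by metis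
      then obtain x where x: "x \<in> W" "E x (j D)" "extension W E x = c ` s"
        using X(3)[of "c ` s"] s by blast
      obtain d where d: "d \<in> W" "E d (j \<Delta>\<^sub>V)" "\<forall>u\<in>W. E u x \<longrightarrow> extension W E u \<subseteq> extension W E d"
        using W_Union_of_power[OF x(1,2)] by blast
      have "s \<subseteq> extension W E d"
      proof
        fix i assume i: "i \<in> s"
        then have "c i \<in> extension W E x" using x(3) by blast
        then have "extension W E (c i) \<subseteq> extension W E d" using d(3) by (simp add: in_extension_iff)
        with c[OF i] show "i \<in> extension W E d" by blast
      qed
      moreover have "s \<subseteq> W" using s unfolding Y_def extension_def by blast
      then obtain z where "z \<in> W" "extension W E z = s" using ex_finite_W s by blast
      ultimately show ?thesis using W_\<Delta>_subset[OF d(1,2)] by blast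
    qed
    show "\<not> (\<exists>d\<in>W. E d (j \<Delta>\<^sub>V) \<and> Y \<subseteq> extension W E d)"
    proof
      assume "\<exists>d\<in>W. E d (j \<Delta>\<^sub>V) \<and> Y \<subseteq> extension W E d"
      then obtain d where d: "d \<in> W" "E d (j \<Delta>\<^sub>V)" "Y \<subseteq> extension W E d" by blast
      obtain x where x: "x \<in> W" "E x (j D)"
        "\<forall>u\<in>W. E u (j N) \<longrightarrow> extension W E u \<subseteq> extension W E d \<longrightarrow> E u x"
        using W_power_of_\<Delta>[OF d(1,2)] by blast
      have "X \<subseteq> extension W E x"
      proof
        fix u assume u: "u \<in> X"
        then have "extension W E u \<subseteq> extension W E d" using d(3) unfolding Y_def by blast
        with x(3) XW[OF u] show "u \<in> extension W E x" by (simp add: in_extension_iff)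
      qed
      with x(1,2) X(4) show False by blast
    qed
  qed
qed

text \<open>Neither construction increases cardinality, so the same sets \<open>K\<close> bound
  witnesses for both patterns.\<close>

lemma lambda_model_power:
  "(lambda_model W E (j I\<^sub>V) (j \<Delta>\<^sub>V) :: 'k set set) = lambda_model W E (j N) (j D)"
proof -
  have "(\<exists>X. unbounded_set W E (j I\<^sub>V) (j \<Delta>\<^sub>V) X \<and> |X| \<le>o |K| ) \<longleftrightarrow>
      (\<exists>X. unbounded_set W E (j N) (j D) X \<and> |X| \<le>o |K| )" for K :: "'k set"
  proof
    assume "\<exists>X. unbounded_set W E (j I\<^sub>V) (j \<Delta>\<^sub>V) X \<and> |X| \<le>o |K|"
    then obtain X where X: "unbounded_set W E (j I\<^sub>V) (j \<Delta>\<^sub>V) X" "|X| \<le>o |K|" by blast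
    have "|sing ` X| \<le>o |K|" using card_of_image X(2) ordLeq_transitive by blast
    with unbounded_set_power[OF X(1)] show "\<exists>X. unbounded_set W E (j N) (j D) X \<and> |X| \<le>o |K|" by blast
  next
    assume "\<exists>X. unbounded_set W E (j N) (j D) X \<and> |X| \<le>o |K|"
    then obtain X where X: "unbounded_set W E (j N) (j D) X" "|X| \<le>o |K|" by blast
    from unbounded_set_from_power[OF X(1)] X(2)
    show "\<exists>X. unbounded_set W E (j I\<^sub>V) (j \<Delta>\<^sub>V) X \<and> |X| \<le>o |K|"
      using ordLeq_transitive by blast
  qed
  then show ?thesis unfolding lambda_model_eq by presburger
qed

end

lemma lambda_model_pattern_power:
  assumes "membership mem" "transitive_in mem V" "ZFC_minus V mem" and "pattern I \<Delta>" "1 \<le> n"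
    and I: "I\<^sub>V \<in> V" "names mem (=) I I\<^sub>V" and \<Delta>: "\<Delta>\<^sub>V \<in> V" "names mem (names mem (=)) \<Delta> \<Delta>\<^sub>V"
    and emb: "elementary_embedding set_language (set_struct V mem) (set_struct W E) j"
  shows "\<exists>In\<^sub>V\<in>V. \<exists>\<Delta>n\<^sub>V\<in>V.
    names mem (names mem (=)) (subsets_upto n I) In\<^sub>V \<and>
    names mem (names mem (names mem (=))) (pattern_power n I \<Delta>) \<Delta>n\<^sub>V \<and>
    (lambda_model W E (j I\<^sub>V) (j \<Delta>\<^sub>V) :: 'k set set) = lambda_model W E (j In\<^sub>V) (j \<Delta>n\<^sub>V)"
proof -
  interpret transitive_model mem V by unfold_locales (fact assms)+
  have eI: "elts I\<^sub>V = I" and e\<Delta>: "elts ` elts \<Delta>\<^sub>V = \<Delta>"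
    using I(2) \<Delta>(2) by (simp_all only: names_eq names2)
  obtain N where N: "N \<in> V" "elts ` elts N = subsets_upto n I"
    using ex_subsets_upto[OF I(1) eI] by blast
  obtain D where D: "D \<in> V" "(\<lambda>s. elts ` elts s) ` elts D = pattern_power n I \<Delta>"
    using ex_pattern_power[OF assms(4) \<Delta>(1) e\<Delta> N] by blast
  interpret pattern_embedding mem V I \<Delta> n I\<^sub>V \<Delta>\<^sub>V N D E W j
    by unfold_locales (fact emb assms(4,5) I(1) \<Delta>(1) N D eI e\<Delta>)+
  have "names mem (names mem (=)) (subsets_upto n I) N"
    "names mem (names mem (names mem (=))) (pattern_power n I \<Delta>) D"
    using N(2) D(2) by (simp_all only: names2 names3)
  with lambda_model_power N(1) D(1) show ?thesis by blast
qed

theorem theorem7p5: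
  fixes I :: "'v set" and \<Delta> :: "'v set set" and n :: nat
    and L :: "('f, 'r) language" and T :: "('f, 'r) fm set"
    and \<kappa> :: "'c rel" and M :: "('m, 'f, 'r) struct"
    and mem :: "'v \<Rightarrow> 'v \<Rightarrow> bool" and V :: "'v set"
    and E :: "'w \<Rightarrow> 'w \<Rightarrow> bool" and W :: "'w set" and j :: "'v \<Rightarrow> 'w"
    and I\<^sub>V \<Delta>\<^sub>V :: 'v
    and U :: "'b :: {boolean_algebra, complete_lattice} set"
  assumes "pattern I \<Delta>" and "1 \<le> n"
  shows
    "(countable_language L \<and> complete_theory L T \<and>
      Card_order \<kappa> \<and> natLeq <o \<kappa> \<and> |I| <o \<kappa> \<and> monster_model \<kappa> L T M \<and>
      (\<exists>a\<in>carrier M. \<exists>b\<in>carrier M. a \<noteq> b) \<longrightarrow>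
        (admits L M I \<Delta> \<longleftrightarrow> admits L M (subsets_upto n I) (pattern_power n I \<Delta>)))
     \<and>
     (membership mem \<and> transitive_in mem V \<and> ZFC_minus V mem \<and>
      I\<^sub>V \<in> V \<and> names mem (=) I I\<^sub>V \<and>
      \<Delta>\<^sub>V \<in> V \<and> names mem (names mem (=)) \<Delta> \<Delta>\<^sub>V \<and>
      elementary_embedding set_language (set_struct V mem) (set_struct W E) j \<and>
      omega_nonstandard W E \<longrightarrow>
        (\<exists>In\<^sub>V\<in>V. \<exists>\<Delta>n\<^sub>V\<in>V.
           names mem (names mem (=)) (subsets_upto n I) In\<^sub>V \<and>
           names mem (names mem (names mem (=))) (pattern_power n I \<Delta>) \<Delta>n\<^sub>V \<and>
           (lambda_model W E (j I\<^sub>V) (j \<Delta>\<^sub>V) :: 'k set set)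
             = lambda_model W E (j In\<^sub>V) (j \<Delta>n\<^sub>V)))
     \<and>
     (bool_ultrafilter U \<longrightarrow>
        (lambda_ultrafilter U I \<Delta> :: 'k set set)
          = lambda_ultrafilter U (subsets_upto n I) (pattern_power n I \<Delta>))"
proof (intro conjI impI)
  assume "countable_language L \<and> complete_theory L T \<and>
      Card_order \<kappa> \<and> natLeq <o \<kappa> \<and> |I| <o \<kappa> \<and> monster_model \<kappa> L T M \<and>
      (\<exists>a\<in>carrier M. \<exists>b\<in>carrier M. a \<noteq> b)"
  \<comment> \<open>Two distinct elements are what distinguishes nonempty indices from the empty one
    in the formula for the power.\<close>
  then obtain a b where "a \<in> carrier M" "b \<in> carrier M" "a \<noteq> b" by blast
  then show "admits L M I \<Delta> \<longleftrightarrow> admits L M (subsets_upto n I) (pattern_power n I \<Delta>)"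
    using admits_pattern_power[OF _ assms(2)] admits_from_pattern_power[OF assms(2)] by metis
next
  assume *: "membership mem \<and> transitive_in mem V \<and> ZFC_minus V mem \<and>
      I\<^sub>V \<in> V \<and> names mem (=) I I\<^sub>V \<and>
      \<Delta>\<^sub>V \<in> V \<and> names mem (names mem (=)) \<Delta> \<Delta>\<^sub>V \<and>
      elementary_embedding set_language (set_struct V mem) (set_struct W E) j \<and>
      omega_nonstandard W E"
  show "\<exists>In\<^sub>V\<in>V. \<exists>\<Delta>n\<^sub>V\<in>V.
      names mem (names mem (=)) (subsets_upto n I) In\<^sub>V \<and>
      names mem (names mem (names mem (=))) (pattern_power n I \<Delta>) \<Delta>n\<^sub>V \<and>
      (lambda_model W E (j I\<^sub>V) (j \<Delta>\<^sub>V) :: 'k set set) = lambda_model W E (j In\<^sub>V) (j \<Delta>n\<^sub>V)"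
    by (rule lambda_model_pattern_power[OF _ _ _ assms]) (use * in simp_all)
next
  assume "bool_ultrafilter U"
  then show "(lambda_ultrafilter U I \<Delta> :: 'k set set)
      = lambda_ultrafilter U (subsets_upto n I) (pattern_power n I \<Delta>)"
    by (rule lambda_ultrafilter_power[OF _ assms])
qed

end
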